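(* Let $d\ge 1$, $\alpha>0$, and let $\{z(x)\}_{x\in\mathbb{Z}^d}$ be non-negative i.i.d. random variables under $\mathbb{P}$ with $\mathbb{P}(z(x)>r)=r^{-\alpha+o(1)}$ as $r\to\infty$. Let $(S_t)_{t\ge 0}$ be the continuous time simple random walk on $\mathbb{Z}^d$ started at $0$ under $P_0$, and let $A_t=\int_0^t z(S_u)\,du$. Let $\rho>0$. Then $\mathbb{P}$-almost surely, $$P_0\left(A_t\ge t^{\rho}\right)=\exp\left\{-t^{p(\alpha,\rho)+o(1)}\right\}\quad\text{as } t\to\infty,$$ where for $d=1$ $$p(\alpha,\rho)=\begin{cases}\dfrac{2\alpha\rho}{\alpha+1}-1, & \rho\in\left(\dfrac{\alpha+1}{2\alpha}\vee 1,\ \dfrac{\alpha+1}{\alpha}\right],\\[8pt] \alpha(\rho-1), & \rho>\dfrac{\alpha+1}{\alpha},\end{cases}$$ and for $d\ge 2$ $$p(\alpha,\rho)=\begin{cases}\dfrac{2\alpha\rho-d}{2\alpha+d}, & \rho\in\left(\dfrac{d}{2\alpha}\vee 1,\ \dfrac{\alpha+d}{\alpha}\right],\\[8pt] \dfrac{\alpha(\rho-1)}{d}, & \rho>\dfrac{\alpha+d}{\alpha}.\end{cases}$$ Furthermore, when $d=1$ and $\rho<\frac{\alpha+1}{2\alpha}\vee 1$, or $d\ge 2$ and $\rho<\frac{d}{2\alpha}\vee 1$, $\mathbb{P}$-almost surely the probability $P_0(A_t\ge t^\rho)$ is bounded from below by a negative power of $t$ (that is, there is $m>0$ with $P_0(A_t\ge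 t^\rho)\ge t^{-m}$ for all sufficiently large $t$).
   Context: The scenery $z$ (law $\mathbb{P}$) and the walk (law $P_0$) are independent; $P_0$-probabilities are computed for a fixed (quenched) realization of $z$. The continuous time simple random walk on $\mathbb{Z}^d$ is the nearest neighbor walk with generator $(2d)^{-1}\Delta$, $\Delta$ being the discrete Laplacian (jump rate 1). $a\vee b=\max(a,b)$. An equality $F(t)=\exp\{-t^{p+o(1)}\}$ as $t\to\infty$ means $\log(-\log F(t))/\log t\to p$; likewise $\mathbb{P}(z(x)>r)=r^{-\alpha+o(1)}$ means $\log\mathbb{P}(z(x)>r)/\log r\to-\alpha$. *)

theory Defs
  imports "HOL-Probability.Probability"
begin

section \<open>Continuous time simple random walk on the integer lattice\<close>

text \<open>
  The lattice is \<^typ>\<open>int ^ 'd\<close>, of dimension \<open>d = CARD('d) \<ge> 1\<close>.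
\<close>

definition discrete_laplacian :: "(int ^ 'd \<Rightarrow> real) \<Rightarrow> int ^ 'd \<Rightarrow> real" where
  "discrete_laplacian f x =
     (\<Sum>i\<in>UNIV. (f (x + axis i 1) - f x) + (f (x - axis i 1) - f x))"

definition transition_semigroup :: "(real \<Rightarrow> 's \<Rightarrow> 's pmf) \<Rightarrow> bool" where
  "transition_semigroup p \<longleftrightarrow>
     (\<forall>x. p 0 x = return_pmf x) \<and>
     (\<forall>s\<ge>0. \<forall>t\<ge>0. \<forall>x. p (s + t) x = bind_pmf (p s x) (p t))"

text \<open>
  The operator \<open>L\<close> is the infinitesimal generator, in the supremum norm and with all bounded
  functions in its domain. (For a bounded operator such as the one below, this is the full domain.)
\<close>

definition has_generator ::
  "(real \<Rightarrow> 's \<Rightarrow> 's pmf) \<Rightarrow> (('s \<Rightarrow> real) \<Rightarrow> 's \<Rightarrow> real) \<Rightarrow> bool" where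
  "has_generator p L \<longleftrightarrow>
     (\<forall>f. bounded (range f) \<longrightarrow>
        uniform_limit UNIV (\<lambda>h x. (measure_pmf.expectation (p h x) f - f x) / h) (L f) (at_right 0))"

text \<open>
  The process \<open>S\<close>, indexed by times \<open>t \<ge> 0\<close>, is under \<open>Q\<close> a cadlag Markov process started at \<open>a\<close>
  with transition semigroup \<open>p\<close>; the Markov property is stated through the finite dimensional
  distributions.
\<close>

definition markov_process ::
  "'w measure \<Rightarrow> (real \<Rightarrow> 'w \<Rightarrow> 's::topological_space) \<Rightarrow> 's \<Rightarrow> (real \<Rightarrow> 's \<Rightarrow> 's pmf) \<Rightarrow> bool" where
  "markov_process Q S a p \<longleftrightarrow>
     prob_space Q \<and>
     (\<forall>t\<ge>0. S t \<in> measurable Q (count_space UNIV)) \<and>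
     (\<forall>\<omega>\<in>space Q. \<forall>t\<ge>0. continuous (at_right t) (\<lambda>u. S u \<omega>)) \<and>
     (\<forall>\<omega>\<in>space Q. \<forall>t>0. \<exists>l. ((\<lambda>u. S u \<omega>) \<longlongrightarrow> l) (at_left t)) \<and>
     (\<forall>(n::nat) (t :: nat \<Rightarrow> real) (x :: nat \<Rightarrow> 's). t 0 = 0 \<and> mono t \<longrightarrow>
        measure Q {\<omega> \<in> space Q. \<forall>i\<le>n. S (t i) \<omega> = x i} =
          of_bool (x 0 = a) * (\<Prod>i<n. pmf (p (t (Suc i) - t i) (x i)) (x (Suc i))))"

definition simple_random_walk ::
  "'w measure \<Rightarrow> (real \<Rightarrow> 'w \<Rightarrow> int ^ 'd) \<Rightarrow> int ^ 'd \<Rightarrow> bool" where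
  "simple_random_walk Q S a \<longleftrightarrow>
     (\<exists>p. transition_semigroup p \<and>
          has_generator p (\<lambda>f x. discrete_laplacian f x / (2 * real CARD('d))) \<and>
          markov_process Q S a p)"


section \<open>Random walk in random scenery\<close>

text \<open>
  For a fixed scenery \<open>\<zeta>\<close> and a cadlag path \<open>s\<close> the integrand is a step function with finitely
  many jumps on \<open>[0, t]\<close>, so the integral is never a default value.
\<close>

definition scenery_integral :: "('s \<Rightarrow> real) \<Rightarrow> (real \<Rightarrow> 's) \<Rightarrow> real \<Rightarrow> real" where
  "scenery_integral \<zeta> s t = (LBINT u:{0..t}. \<zeta> (s u))"

definition quenched_tail ::
  "'w measure \<Rightarrow> (real \<Rightarrow> 'w \<Rightarrow> 's) \<Rightarrow> ('s \<Rightarrow> real) \<Rightarrow> real \<Rightarrow> real \<Rightarrow> real" where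
  "quenched_tail Q S \<zeta> \<rho> t =
     measure Q {\<omega> \<in> space Q. scenery_integral \<zeta> (\<lambda>u. S u \<omega>) t \<ge> t powr \<rho>}"

text \<open>
  \<open>F r = r\<^sup>q\<^sup>+\<^sup>o\<^sup>(\<^sup>1\<^sup>)\<close> and \<open>F t = exp (- t\<^sup>p\<^sup>+\<^sup>o\<^sup>(\<^sup>1\<^sup>))\<close>.
  Since \<open>ln 0 = 0\<close>, the quotients vanish where \<open>F\<close> is \<open>0\<close> (in the second case also where \<open>F\<close>
  is \<open>1\<close>). A nonzero exponent therefore forces \<open>F > 0\<close> (and \<open>F \<noteq> 1\<close>) eventually; only nonzero
  exponents are used.
\<close>

definition power_asymp :: "(real \<Rightarrow> real) \<Rightarrow> real \<Rightarrow> bool" where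
  "power_asymp F q \<longleftrightarrow> ((\<lambda>r. ln (F r) / ln r) \<longlongrightarrow> q) at_top"

definition stretched_exp_asymp :: "(real \<Rightarrow> real) \<Rightarrow> real \<Rightarrow> bool" where
  "stretched_exp_asymp F p \<longleftrightarrow> ((\<lambda>t. ln (- ln (F t)) / ln t) \<longlongrightarrow> p) at_top"

definition threshold :: "nat \<Rightarrow> real \<Rightarrow> real" where
  "threshold d \<alpha> =
     (if d = 1 then max ((\<alpha> + 1) / (2 * \<alpha>)) 1 else max (real d / (2 * \<alpha>)) 1)"

text \<open>Only meaningful for \<open>\<rho> > threshold d \<alpha>\<close>.\<close>

definition rate_exponent :: "nat \<Rightarrow> real \<Rightarrow> real \<Rightarrow> real" where
  "rate_exponent d \<alpha> \<rho> =
     (if d = 1 then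
        (if \<rho> \<le> (\<alpha> + 1) / \<alpha> then 2 * \<alpha> * \<rho> / (\<alpha> + 1) - 1 else \<alpha> * (\<rho> - 1))
      else
        (if \<rho> \<le> (\<alpha> + real d) / \<alpha> then (2 * \<alpha> * \<rho> - real d) / (2 * \<alpha> + real d)
         else \<alpha> * (\<rho> - 1) / real d))"

end

theory Submission
  imports Defs "HOL-Real_Asymp.Real_Asymp"
begin

text \<open>
  Lower bounds come from one strategy: run to the best site within distance \<open>r\<close>, of height about
  \<open>r\<^sup>d\<^sup>/\<^sup>\<alpha>\<close>, and spend there the time that is needed. Reaching it costs \<open>r\<^sup>2/t\<close> (or \<open>r\<close>, up to
  logarithms, if \<open>r > t\<close>); a local time \<open>\<tau>\<close> at one site costs \<open>\<tau>\<^sup>2/t\<close> if \<open>d = 1\<close> and \<open>\<tau>\<close> if \<open>d \<ge> 2\<close>.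
  Optimizing over \<open>r\<close> gives the exponent.

  For the upper bounds, the walk leaves the ball of radius \<open>r\<close> only at a comparable cost, and inside
  this ball only sites higher than \<open>t\<^sup>\<rho>\<^sup>-\<^sup>1\<close> matter. They are split into finitely many levels. The set
  \<open>H\<close> of sites higher than \<open>t\<^sup>\<eta>\<close> is sparse: almost surely a ball whose radius is slightly smaller than
  \<open>t\<^sup>\<alpha>\<^sup>\<eta>\<^sup>/\<^sup>d\<close> contains a bounded number of them. If \<open>g\<close> is a nonnegative function, exponentially decaying
  at rate \<open>\<theta>\<close>, with \<open>L g \<le> \<theta>\<^sup>2 g - 1\<^sub>0\<close>, then \<open>\<phi> = 1 + a \<Sum>\<^sub>y g(\<cdot> - y)\<close>, summed over \<open>y \<in> H\<close>, satisfies
  \<open>L \<phi> + (a/2) 1\<^sub>H \<phi> \<le> \<theta>\<^sup>2 \<phi>\<close> as soon as \<open>\<phi> \<le> 2\<close>, and the Feynman--Kac inequality bounds the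
  exponential moments of the time spent in \<open>H\<close>.
\<close>

section \<open>The transition semigroup\<close>

text \<open>The walk is given only by its generator and finite dimensional distributions, so every
  estimate is derived from generator inequalities for test functions instead of jump chains, hitting
  times or the strong Markov property. The Feynman--Kac inequality puts no sign condition on the
  test function: with -f it yields lower bounds, namely the cost of staying at a site and, for d =
  1, of a large local time. Its condition on the position at time a separates the journey from the
  stay. Sites outside a ball enter through their expected contribution, which avoids exit times.

  The balance behind the exponents: a site at distance t^c (c \<le> 1) costs t^(2c-1) and has height
  t^(dc/\<alpha>), hence needs the time t^(\<rho>-dc/\<alpha>). Equal costs give c =
  \<alpha>\<rho>/(\<alpha>+1) for d = 1 and c = \<alpha>(\<rho>+1)/(2\<alpha>+d) for d \<ge> 2, and
  p = 2c - 1. When this c exceeds 1, staying for all of the available time is cheaper than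
  travelling farther, so the height t^(\<rho>-1) is sought and the journey alone costs
  t^(\<alpha>(\<rho>-1)/d).\<close>

abbreviation mean :: "'s pmf \<Rightarrow> ('s \<Rightarrow> real) \<Rightarrow> real" where
  "mean q f \<equiv> measure_pmf.expectation q f"

definition gen :: "(int ^ 'd \<Rightarrow> real) \<Rightarrow> int ^ 'd \<Rightarrow> real" where
  "gen f x = discrete_laplacian f x / (2 * real CARD('d))"

fun unit :: "'d \<times> bool \<Rightarrow> int ^ 'd" where
  "unit (i, b) = (if b then axis i 1 else - axis i 1)"

lemma mean_integrable: "(\<And>x. \<bar>f x\<bar> \<le> B) \<Longrightarrow> integrable (measure_pmf q) f"
  for f :: "'s \<Rightarrow> real"
  by (rule measure_pmf.integrable_const_bound[where B = B]) auto

lemma abs_mean_le: "(\<And>x. \<bar>f x\<bar> \<le> B) \<Longrightarrow> \<bar>mean q f\<bar> \<le> B"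
  for f :: "'s \<Rightarrow> real"
proof -
  assume b: "\<And>x. \<bar>f x\<bar> \<le> B"
  note i = mean_integrable[OF b]
  have "mean q f \<le> mean q (\<lambda>_. B)"
    by (rule integral_mono) (use b i in \<open>auto simp: abs_le_iff\<close>)
  moreover have "mean q (\<lambda>_. - B) \<le> mean q f"
    by (rule integral_mono) (use b i in \<open>auto simp: abs_le_iff minus_le_iff\<close>)
  ultimately show ?thesis by auto
qed

lemma mean_bind:
  fixes f :: "'s \<Rightarrow> real"
  assumes "\<And>x. \<bar>f x\<bar> \<le> B"
  shows "mean (bind_pmf q k) f = mean q (\<lambda>x. mean (k x) f)"
  unfolding measure_pmf_bind
  by (rule integral_bind[where K = "count_space UNIV" and B = B and B' = 1])
    (use assms in \<open>auto intro: measure_pmf.finite_measure_axioms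
      simp: measure_pmf.emeasure_space_1[simplified] space_subprob_algebra subprob_space_measure_pmf\<close>)

lemma mean_of_bool_eq: "mean q (\<lambda>z. of_bool (z = x)) = pmf q x"
proof -
  have "(\<lambda>z. of_bool (z = x)) = (indicator {x} :: _ \<Rightarrow> real)" by (auto simp: fun_eq_iff)
  then show ?thesis by (simp add: measure_pmf_single)
qed

lemma gen_unit:
  fixes f :: "int ^ 'd \<Rightarrow> real"
  shows "gen f x = (\<Sum>k\<in>UNIV. f (x + unit k)) / (2 * real CARD('d)) - f x"
proof -
  have "(\<Sum>k\<in>UNIV. f (x + unit k)) = (\<Sum>i\<in>UNIV. \<Sum>b\<in>UNIV. f (x + unit (i, b)))"
    unfolding sum.cartesian_product UNIV_Times_UNIV by (rule sum.cong) (auto simp del: unit.simps)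
  also have "\<dots> = (\<Sum>i\<in>UNIV. f (x + axis i 1) + f (x - axis i 1))"
    by (simp add: UNIV_bool add.commute)
  also have "\<dots> = discrete_laplacian f x + 2 * real CARD('d) * f x"
    by (simp add: discrete_laplacian_def sum.distrib sum_subtractf)
  finally show ?thesis by (simp add: gen_def field_simps)
qed

lemma gen_const [simp]: "gen (\<lambda>_. c) x = 0"
  by (simp add: gen_def discrete_laplacian_def)

lemma gen_add: "gen (\<lambda>x. f x + g x) x = gen f x + gen g x"
  by (simp add: gen_unit sum.distrib add_divide_distrib)

lemma gen_cmult: "gen (\<lambda>x. c * f x) x = c * gen f x"
  by (simp add: gen_unit sum_distrib_left[symmetric] right_diff_distrib)

lemma gen_sum: "gen (\<lambda>x. \<Sum>y\<in>A. f y x) x = (\<Sum>y\<in>A. gen (f y) x)"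
  by (induction A rule: infinite_finite_induct) (simp_all add: gen_add)

lemma gen_shift: "gen (\<lambda>x. f (x - y)) x = gen f (x - y)"
  by (simp add: gen_unit algebra_simps)

lemma gen_abs_le:
  fixes f :: "int ^ 'd \<Rightarrow> real"
  assumes "\<And>x. \<bar>f x\<bar> \<le> B"
  shows "\<bar>gen f x\<bar> \<le> 2 * B"
proof -
  have "\<bar>\<Sum>k\<in>UNIV. f (x + unit k)\<bar> \<le> (\<Sum>k\<in>(UNIV :: ('d \<times> bool) set). B)"
    by (rule order_trans[OF sum_abs sum_mono]) (rule assms)
  also have "\<dots> = 2 * real CARD('d) * B" by (simp add: card_cartesian_product)
  finally have "\<bar>(\<Sum>k\<in>UNIV. f (x + unit k)) / (2 * real CARD('d))\<bar> \<le> B"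
    by (simp add: abs_divide divide_simps mult_ac)
  then show ?thesis using assms[of x] unfolding gen_unit abs_le_iff by linarith
qed

text \<open>At a point where f attains the minimum, passing to the minimum leaves the value alone
  and can only lower the neighbours. Hence minima of supersolutions, and truncations by nonnegative
  constants, remain supersolutions.\<close>

lemma gen_min_le:
  fixes f g :: "int ^ 'd \<Rightarrow> real"
  assumes "f x \<le> g x"
  shows "gen (\<lambda>x. min (f x) (g x)) x \<le> gen f x"
proof -
  have "(\<Sum>k\<in>UNIV. min (f (x + unit k)) (g (x + unit k))) \<le> (\<Sum>k\<in>UNIV. f (x + unit k))"
    by (rule sum_mono) simp
  then show ?thesis using assms by (simp add: gen_unit divide_right_mono)
qed

lemma gen_min_le':
  "g x \<le> f x \<Longrightarrow> gen (\<lambda>x. min (f x) (g x)) x \<le> gen g x"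
  using gen_min_le[of g x f] by (simp add: min.commute)

text \<open>Semigroup derivatives exist only within the half line, one-sided at 0. Interior points
  have ordinary derivatives, and continuity at 0 does the rest.\<close>

lemma nondecreasing_from_within:
  fixes u u' :: "real \<Rightarrow> real"
  assumes "0 \<le> t"
    and d: "\<And>s. 0 \<le> s \<Longrightarrow> (u has_real_derivative u' s) (at s within {0..})"
    and "\<And>s. 0 \<le> s \<Longrightarrow> 0 \<le> u' s"
  shows "u 0 \<le> u t"
proof (rule DERIV_nonneg_imp_increasing_open[OF \<open>0 \<le> t\<close>])
  fix x :: real assume "0 < x" "x < t"
  then have "at x within {0..} = at x" by (intro at_within_interior) simp
  with d[of x] assms(3)[of x] \<open>0 < x\<close> show "\<exists>y. DERIV u x :> y \<and> y \<ge> 0" by auto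
next
  show "continuous_on {0..t} u"
    by (rule continuous_on_subset[of "{0..}"])
      (auto simp: continuous_on_eq_continuous_within intro: DERIV_continuous[OF d])
qed

locale walk_semigroup =
  fixes p :: "real \<Rightarrow> int ^ 'd \<Rightarrow> (int ^ 'd) pmf"
  assumes transition_semigroup: "transition_semigroup p"
    and has_generator: "has_generator p (\<lambda>f x. discrete_laplacian f x / (2 * real CARD('d)))"
begin

lemma p_0: "p 0 x = return_pmf x"
  using transition_semigroup by (simp add: transition_semigroup_def)

lemma mean_semigroup:
  assumes "0 \<le> s" "0 \<le> t" "\<And>x. \<bar>f x\<bar> \<le> B"
  shows "mean (p (s + t) x) f = mean (p s x) (\<lambda>y. mean (p t y) f)"
  using transition_semigroup assms mean_bind[of f B "p s x" "p t"]
  by (simp add: transition_semigroup_def)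

text \<open>The error is uniform in the starting point, so it may be integrated against any law. The
  case h = 0 is included because \<open>p 0\<close> is the identity kernel.\<close>

lemma generator_uniform:
  assumes "\<And>x. \<bar>f x\<bar> \<le> B" "0 < e"
  obtains d where "0 < d"
    "\<And>h x. 0 \<le> h \<Longrightarrow> h < d \<Longrightarrow> \<bar>mean (p h x) f - f x - h * gen f x\<bar> \<le> e * h"
proof -
  have "bounded (range f)" using assms(1) by (auto simp: bounded_iff)
  with has_generator have "uniform_limit UNIV (\<lambda>h x. (mean (p h x) f - f x) / h) (gen f) (at_right 0)"
    by (simp add: has_generator_def gen_def[abs_def])
  from uniform_limitD[OF this \<open>0 < e\<close>]
  obtain d where d: "0 < d"
    "\<And>h x. 0 < h \<Longrightarrow> h < d \<Longrightarrow> \<bar>(mean (p h x) f - f x) / h - gen f x\<bar> < e"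
    by (auto simp: eventually_at_right_field dist_real_def)
  have "\<bar>mean (p h x) f - f x - h * gen f x\<bar> \<le> e * h" if h: "0 \<le> h" "h < d" for h x
  proof (cases "h = 0")
    case False
    with h have "0 < h" by simp
    have "mean (p h x) f - f x - h * gen f x = h * ((mean (p h x) f - f x) / h - gen f x)"
      using \<open>0 < h\<close> by (simp add: field_simps)
    then show ?thesis using d(2)[OF \<open>0 < h\<close> h(2), of x] \<open>0 < h\<close> by (simp add: abs_mult mult.commute)
  qed (simp add: p_0)
  with d(1) that show ?thesis by blast
qed

text \<open>To the right of t this is the semigroup property and the uniform generator limit. To the
  left the expansion is made at the earlier time s = t - h, so the derivative appears at s. Moving
  it to t needs continuity in s of the mean of \<open>gen f\<close>, which comes from the generator
  limit for the bounded function \<open>gen f\<close> itself.\<close>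

lemma mean_has_derivative:
  assumes b: "\<And>x. \<bar>f x\<bar> \<le> B" and t: "0 \<le> t"
  shows "((\<lambda>t. mean (p t x) f) has_real_derivative mean (p t x) (gen f)) (at t within {0..})"
  unfolding has_field_derivative_def has_derivative_within_alt
proof (intro conjI allI impI)
  fix e :: real assume "0 < e"
  have B: "0 \<le> B" using b[of 0] by linarith
  have gb: "\<bar>gen f x\<bar> \<le> 2 * B" for x by (rule gen_abs_le[OF b])
  have ggb: "\<bar>gen (gen f) x\<bar> \<le> 4 * B" for x using gen_abs_le[OF gb] by simp
  obtain d1 where d1: "0 < d1"
    "\<And>h x. 0 \<le> h \<Longrightarrow> h < d1 \<Longrightarrow> \<bar>mean (p h x) f - f x - h * gen f x\<bar> \<le> e / 2 * h"
    using generator_uniform[where f = f, OF b, of "e / 2"] \<open>0 < e\<close> by (metis half_gt_zero)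
  obtain d2 where d2: "0 < d2"
    "\<And>h x. 0 \<le> h \<Longrightarrow> h < d2 \<Longrightarrow> \<bar>mean (p h x) (gen f) - gen f x - h * gen (gen f) x\<bar> \<le> 1 * h"
    using generator_uniform[where f = "gen f", OF gb, of 1] by (metis zero_less_one)
  \<comment> \<open>The last entry makes h(1 + 4B), the possible change of the mean of
    \<open>gen f\<close> over time h, at most e/2: 4B bounds \<open>gen (gen f)\<close> and 1 is the
    error allowed in \<open>d2\<close>.\<close>
  define d where "d = min d1 (min d2 (e / 2 / (1 + 4 * B)))"
  have d: "0 < d" using d1(1) d2(1) \<open>0 < e\<close> B by (simp add: d_def)
  have step: "\<bar>mean (p (s + h) x) f - mean (p s x) f - h * mean (p s x) (gen f)\<bar> \<le> e / 2 * h"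
    if "0 \<le> s" "0 \<le> h" "h < d" for s h
  proof -
    have hb: "\<bar>mean (p h y) f\<bar> \<le> B" for y by (rule abs_mean_le[OF b])
    have "mean (p (s + h) x) f - mean (p s x) f - h * mean (p s x) (gen f) =
        mean (p s x) (\<lambda>y. mean (p h y) f - f y - h * gen f y)"
      using mean_semigroup[OF that(1,2) b, of x] mean_integrable[OF b, of "p s x"]
        mean_integrable[OF gb, of "p s x"] mean_integrable[OF hb, of "p s x"]
      by simp
    also have "\<bar>\<dots>\<bar> \<le> e / 2 * h"
      by (rule abs_mean_le) (use d1(2) that in \<open>auto simp: d_def\<close>)
    finally show ?thesis .
  qed
  have cont: "\<bar>mean (p (s + h) x) (gen f) - mean (p s x) (gen f)\<bar> \<le> e / 2"
    if "0 \<le> s" "0 \<le> h" "h < d" for s h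
  proof -
    have hb: "\<bar>mean (p h y) (gen f)\<bar> \<le> 2 * B" for y by (rule abs_mean_le[OF gb])
    have "mean (p (s + h) x) (gen f) - mean (p s x) (gen f) =
        mean (p s x) (\<lambda>y. mean (p h y) (gen f) - gen f y)"
      using mean_semigroup[OF that(1,2) gb, of x] mean_integrable[OF gb, of "p s x"]
        mean_integrable[OF hb, of "p s x"]
      by simp
    also have "\<bar>\<dots>\<bar> \<le> h * (1 + 4 * B)"
    proof (rule abs_mean_le)
      fix y
      have "\<bar>h * gen (gen f) y\<bar> \<le> h * (4 * B)"
        using ggb[of y] that by (simp add: abs_mult mult_left_mono)
      moreover have "\<bar>mean (p h y) (gen f) - gen f y - h * gen (gen f) y\<bar> \<le> h"
        using d2(2)[of h y] that by (simp add: d_def)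
      ultimately show "\<bar>mean (p h y) (gen f) - gen f y\<bar> \<le> h * (1 + 4 * B)"
        by (simp add: distrib_left abs_le_iff)
    qed
    also have "\<dots> \<le> e / 2 / (1 + 4 * B) * (1 + 4 * B)"
      using that B by (intro mult_right_mono) (auto simp: d_def)
    also have "\<dots> = e / 2" using B by (simp add: field_simps)
    finally show ?thesis .
  qed
  show "\<exists>d>0. \<forall>y\<in>{0..}. norm (y - t) < d \<longrightarrow>
      norm (mean (p y x) f - mean (p t x) f - mean (p t x) (gen f) * (y - t)) \<le> e * norm (y - t)"
  proof (intro exI[of _ d] conjI ballI impI d)
    fix s assume s: "s \<in> {0..}" "norm (s - t) < d"
    show "norm (mean (p s x) f - mean (p t x) f - mean (p t x) (gen f) * (s - t)) \<le> e * norm (s - t)"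
    proof (cases "t \<le> s")
      case True
      have "e / 2 * (s - t) \<le> e * (s - t)" using True \<open>0 < e\<close> by (intro mult_right_mono) auto
      with step[of t "s - t"] t s True show ?thesis by (simp add: mult.commute)
    next
      case False
      define h where "h = t - s"
      have h: "0 \<le> h" "h < d" "t = s + h" using False s by (auto simp: h_def)
      have "\<bar>h * (mean (p (s + h) x) (gen f) - mean (p s x) (gen f))\<bar> \<le> h * (e / 2)"
        using cont[of s h] h s unfolding abs_mult by (intro mult_mono) auto
      moreover have "\<bar>mean (p (s + h) x) f - mean (p s x) f - h * mean (p s x) (gen f)\<bar> \<le> e / 2 * h"
        using step[of s h] h s by simp
      moreover have "\<bar>c1 - c2\<bar> \<le> k / 2 \<Longrightarrow> \<bar>a - b - c2\<bar> \<le> k / 2 \<Longrightarrow> \<bar>a - b - c1\<bar> \<le> k"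
        for a b c1 c2 k :: real by linarith
      ultimately
      have "\<bar>mean (p (s + h) x) f - mean (p s x) f - h * mean (p (s + h) x) (gen f)\<bar> \<le> e * h"
        unfolding right_diff_distrib by (simp add: mult.commute)
      then show ?thesis using h by (simp add: algebra_simps abs_le_iff)
    qed
  qed
qed (rule bounded_linear_mult_right)

end

section \<open>Lower bounds for transition probabilities by Poisson weights\<close>

definition disp :: "('d \<times> bool \<Rightarrow> nat) \<Rightarrow> int ^ 'd" where
  "disp c = (\<chi> i. int (c (i, True)) - int (c (i, False)))"

lemma disp_decr: "0 < c k \<Longrightarrow> disp (c(k := c k - 1)) = disp c - unit k"
  by (cases k) (auto simp: vec_eq_iff disp_def axis_def of_nat_diff)

context walk_semigroup
begin

text \<open>Forward equation: the generator of the indicator of y is a combination of the indicators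
  of y and of its neighbours.\<close>

lemma pmf_has_derivative:
  assumes "0 \<le> t"
  shows "((\<lambda>t. pmf (p t x) y) has_real_derivative
    (\<Sum>k\<in>UNIV. pmf (p t x) (y - unit k)) / (2 * real CARD('d)) - pmf (p t x) y) (at t within {0..})"
proof -
  have b: "\<bar>of_bool (z = y) :: real\<bar> \<le> 1" for z by simp
  have i: "integrable (measure_pmf (p t x)) (\<lambda>z. of_bool (z = w) :: real)" for w
    by (rule mean_integrable[of _ 1]) simp
  have "gen (\<lambda>z. of_bool (z = y)) z =
      (\<Sum>k\<in>UNIV. of_bool (z = y - unit k)) / (2 * real CARD('d)) - of_bool (z = y)" for z
    by (simp add: gen_unit eq_diff_eq)
  then have "mean (p t x) (gen (\<lambda>z. of_bool (z = y))) =
      mean (p t x) (\<lambda>z. (\<Sum>k\<in>UNIV. of_bool (z = y - unit k)) / (2 * real CARD('d)) - of_bool (z = y))"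
    by presburger
  also have "\<dots> = (\<Sum>k\<in>UNIV. pmf (p t x) (y - unit k)) / (2 * real CARD('d)) - pmf (p t x) y"
    using i by (simp add: mean_of_bool_eq del: sum_of_bool_eq)
  finally show ?thesis
    using mean_has_derivative[where f = "\<lambda>z. of_bool (z = y)" and B = 1, OF b assms, of x] by (simp add: mean_of_bool_eq)
qed

text \<open>
  The transition probability is a sum over all jump counts with the given displacement; a single term \<open>c\<close> is
  enough, and satisfies the forward equation with inequality.
\<close>

lemma pmf_ge_poisson:
  assumes "0 \<le> t"
  shows "(\<Prod>k\<in>UNIV. (t / (2 * real CARD('d))) ^ c k / fact (c k)) \<le> exp t * pmf (p t x) (x + disp c)"
  using assms
\<comment> \<open>Induction on the total number of jumps: deleting one jump of direction k moves the
  target from y to y - \<open>unit k\<close>, which is a gain term of the forward equation.\<close>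
proof (induction c arbitrary: t rule: measure_induct_rule[where f = "\<lambda>c. sum c UNIV"])
  case (less c)
  define D where "D = 2 * real CARD('d)"
  have D: "0 < D" by (simp add: D_def)
  define G where "G c t = (\<Prod>k\<in>(UNIV :: ('d \<times> bool) set). (t / D) ^ c k / fact (c k))" for c t
  define f' where "f' t k = (if c k = 0 then 0 else (t / D) ^ (c k - 1) / fact (c k - 1) / D)" for t k
  have der1: "((\<lambda>t. (t / D) ^ c k / fact (c k)) has_real_derivative f' t k) (at t)" for t k
  proof (cases "c k")
    case (Suc n)
    show ?thesis unfolding f'_def Suc
      by (auto intro!: derivative_eq_intros simp del: power_Suc of_nat_Suc) (use D in \<open>simp add: field_simps\<close>)
  qed (simp add: f'_def)
  have derG: "(G c has_real_derivative (\<Sum>k\<in>UNIV. f' t k * (\<Prod>j\<in>UNIV - {k}. (t / D) ^ c j / fact (c j)))) (at t)" for t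
    unfolding G_def[abs_def] by (rule has_field_derivative_prod) (rule der1)
  have f'G: "f' t k * (\<Prod>j\<in>UNIV - {k}. (t / D) ^ c j / fact (c j)) =
      (if c k = 0 then 0 else G (c(k := c k - 1)) t / D)" for t k
    unfolding G_def f'_def by (auto simp: prod.remove[of UNIV k] intro!: prod.cong)
  define y where "y = x + disp c"
  \<comment> \<open>The factor \<open>exp t\<close> cancels the loss term of the forward equation.
    Only gain terms are left in u', and they are compared one by one through the induction
    hypothesis.\<close>
  define u where "u t = exp t * pmf (p t x) y - G c t" for t
  define u' where "u' t = exp t * ((\<Sum>k\<in>UNIV. pmf (p t x) (y - unit k)) / D)
      - (\<Sum>k\<in>UNIV. if c k = 0 then 0 else G (c(k := c k - 1)) t / D)" for t
  have "u 0 \<le> u t"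
  proof (rule nondecreasing_from_within[where u' = u', OF \<open>0 \<le> t\<close>])
    fix s :: real assume s: "0 \<le> s"
    have "(G c has_real_derivative (\<Sum>k\<in>UNIV. if c k = 0 then 0 else G (c(k := c k - 1)) s / D)) (at s within {0..})"
      using has_field_derivative_at_within[OF derG[of s]] by (simp only: f'G)
    moreover have "((\<lambda>t. exp t * pmf (p t x) y) has_real_derivative
        exp s * ((\<Sum>k\<in>UNIV. pmf (p s x) (y - unit k)) / D)) (at s within {0..})"
      using DERIV_mult[OF has_field_derivative_at_within[OF DERIV_exp[of s], of "{0..}"] pmf_has_derivative[OF s, of x y]]
      by (simp add: D_def algebra_simps)
    ultimately show "(u has_real_derivative u' s) (at s within {0..})"
      unfolding u_def[abs_def] u'_def by (auto intro: DERIV_diff)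
    have "(\<Sum>k\<in>UNIV. if c k = 0 then 0 else G (c(k := c k - 1)) s / D)
        \<le> (\<Sum>k\<in>UNIV. exp s * (pmf (p s x) (y - unit k) / D))"
    proof (rule sum_mono)
      fix k
      show "(if c k = 0 then 0 else G (c(k := c k - 1)) s / D) \<le> exp s * (pmf (p s x) (y - unit k) / D)"
      proof (cases "c k = 0")
        case False
        have "sum (c(k := c k - 1)) UNIV < sum c UNIV"
          by (rule sum_strict_mono_ex1)
            (use False in \<open>auto intro!: exI[of _ "fst k"] exI[of _ "snd k"]\<close>)
        from less.IH[OF this s] have "G (c(k := c k - 1)) s \<le> exp s * pmf (p s x) (x + disp (c(k := c k - 1)))"
          by (simp only: G_def D_def)
        then have "G (c(k := c k - 1)) s / D \<le> exp s * pmf (p s x) (y - unit k) / D"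
          using False D disp_decr[of c k] by (intro divide_right_mono) (auto simp: y_def add_diff_eq)
        then show ?thesis using False by simp
      qed (use D in auto)
    qed
    then show "0 \<le> u' s" by (simp add: u'_def sum_distrib_left sum_divide_distrib)
  qed
  \<comment> \<open>At time 0 the Poisson product is 1 for the empty count, by 0^0 = 1, and 0
    otherwise; the empty count has displacement 0, which has probability 1.\<close>
  moreover have "0 \<le> u 0"
  proof (cases "\<forall>k. c k = 0")
    case True
    then have "disp c = 0" by (simp add: disp_def vec_eq_iff)
    moreover have "c k = 0" for k using True by blast
    ultimately show ?thesis by (simp add: u_def G_def p_0 y_def)
  next
    case False
    then obtain k where "c k \<noteq> 0" by blast
    then have "\<exists>k\<in>UNIV. (0 / D) ^ c k / fact (c k) = 0" by (intro bexI[of _ k]) simp_all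
    then have "G c 0 = 0" unfolding G_def by (rule prod_zero[OF finite])
    then show ?thesis by (simp add: u_def)
  qed
  ultimately show ?case by (simp add: u_def G_def D_def y_def)
qed

end


text \<open>Consecutive bounds are compared through (n/(n+1))^(n+1) \<le> exp (-1), which is 1 + x
  \<le> exp x at x = -1/(n+1).\<close>

lemma fact_le_Stirling: "1 \<le> n \<Longrightarrow> fact n \<le> real n ^ (n + 1) * exp (1 - real n)"
proof (induction n rule: nat_induct_at_least)
  case (Suc n)
  have "(real n / real (n + 1)) ^ (n + 1) \<le> exp (- 1 / real (n + 1)) ^ (n + 1)"
  proof (rule power_mono)
    have "1 + (- 1 / real (n + 1)) \<le> exp (- 1 / real (n + 1))" by (rule exp_ge_add_one_self)
    then show "real n / real (n + 1) \<le> exp (- 1 / real (n + 1))" by (simp add: field_simps)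
  qed simp
  also have "\<dots> = exp (- 1)" by (subst exp_of_nat_mult[symmetric]) simp
  finally have *: "real n ^ (n + 1) \<le> exp (- 1) * real (n + 1) ^ (n + 1)"
    by (simp add: power_divide divide_simps del: of_nat_Suc power_Suc)
  have "fact (Suc n) = real (n + 1) * fact n" by simp
  also have "\<dots> \<le> real (n + 1) * (real n ^ (n + 1) * exp (1 - real n))"
    by (rule mult_left_mono[OF Suc.IH]) simp
  also have "\<dots> \<le> real (n + 1) * (exp (- 1) * real (n + 1) ^ (n + 1) * exp (1 - real n))"
    by (intro mult_left_mono mult_right_mono *) auto
  also have "\<dots> = real (Suc n) ^ (Suc n + 1) * (exp (- 1) * exp (1 - real n))" by simp
  also have "exp (- 1) * exp (1 - real n) = exp (1 - real (Suc n))"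
    by (simp add: exp_add[symmetric])
  finally show ?case .
qed simp

text \<open>Stirling's bound at the integer part of \<mu>. The true order is the inverse square root
  of \<mu>, but the applications tolerate any power of \<mu>.\<close>

lemma poisson_mode_ge:
  fixes \<mu> :: real
  assumes "1 \<le> \<mu>"
  shows "exp (- 2) / \<mu> \<le> exp (- \<mu>) * (\<mu> ^ nat \<lfloor>\<mu>\<rfloor> / fact (nat \<lfloor>\<mu>\<rfloor>))"
proof -
  define J where "J = nat \<lfloor>\<mu>\<rfloor>"
  have "1 \<le> \<lfloor>\<mu>\<rfloor>" using assms by simp
  then have "real J = of_int \<lfloor>\<mu>\<rfloor>" "1 \<le> J" by (auto simp: J_def le_nat_iff)
  then have J: "1 \<le> J" "real J \<le> \<mu>" "\<mu> < real J + 1" by linarith+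
  have "fact J \<le> real J ^ (J + 1) * exp (1 - real J)" by (rule fact_le_Stirling[OF J(1)])
  also have "\<dots> \<le> \<mu> ^ (J + 1) * exp (1 - real J)" by (intro mult_right_mono power_mono) (use J in auto)
  finally have "fact J \<le> \<mu> ^ J * (\<mu> * exp (1 - real J))" by (simp add: mult_ac)
  then have "1 \<le> \<mu> ^ J / fact J * (\<mu> * exp (1 - real J))" by (simp add: field_simps)
  then have "exp (- \<mu>) * 1 \<le> exp (- \<mu>) * (\<mu> ^ J / fact J * (\<mu> * exp (1 - real J)))"
    by (intro mult_left_mono) auto
  then have "exp (- \<mu>) \<le> (exp (- \<mu>) * (\<mu> ^ J / fact J)) * (\<mu> * exp (1 - real J))"
    by (simp add: mult_ac)
  then have "exp (- \<mu>) / (\<mu> * exp (1 - real J)) \<le> exp (- \<mu>) * (\<mu> ^ J / fact J)"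
    using assms by (simp add: divide_le_eq)
  moreover have "exp (- \<mu>) / (\<mu> * exp (1 - real J)) = exp (real J - 1 - \<mu>) / \<mu>"
    by (simp add: exp_diff exp_minus exp_add field_simps)
  moreover have "exp (- 2) / \<mu> \<le> exp (real J - 1 - \<mu>) / \<mu>"
    using J assms by (intro divide_right_mono) auto
  ultimately show ?thesis unfolding J_def by linarith
qed

text \<open>The ratio of successive weights is \<mu>/(J+j) with j \<le> R, hence at least
  \<mu>/(\<mu>+R).\<close>

lemma poisson_shift_ge:
  fixes \<mu> :: real
  assumes "0 < \<mu>" "real J \<le> \<mu>" "k \<le> R"
  shows "\<mu> ^ J / fact J * (\<mu> / (\<mu> + real R)) ^ R \<le> \<mu> ^ (J + k) / fact (J + k)"
proof -
  have "\<mu> ^ J / fact J * (\<mu> / (\<mu> + real R)) ^ k \<le> \<mu> ^ (J + k) / fact (J + k)"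
    using \<open>k \<le> R\<close>
  proof (induction k)
    case (Suc k)
    have "\<mu> ^ J / fact J * (\<mu> / (\<mu> + real R)) ^ Suc k = (\<mu> ^ J / fact J * (\<mu> / (\<mu> + real R)) ^ k) * (\<mu> / (\<mu> + real R))"
      by simp
    also have "\<dots> \<le> \<mu> ^ (J + k) / fact (J + k) * (\<mu> / real (J + Suc k))"
      using Suc assms by (intro mult_mono divide_left_mono) auto
    also have "\<dots> = \<mu> ^ (J + Suc k) / fact (J + Suc k)" by (simp add: mult_ac)
    finally show ?case .
  qed simp
  moreover have "\<mu> ^ J / fact J * (\<mu> / (\<mu> + real R)) ^ R \<le> \<mu> ^ J / fact J * (\<mu> / (\<mu> + real R)) ^ k"
    using assms by (intro mult_left_mono power_decreasing) auto
  ultimately show ?thesis by linarith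
qed

section \<open>Explicit heat kernel lower bound and exponential moments\<close>

lemma gen_coord:
  fixes g :: "int \<Rightarrow> real" and x :: "int ^ 'd"
  shows "gen (\<lambda>y. g (y $ i)) x = (g (x $ i + 1) + g (x $ i - 1) - 2 * g (x $ i)) / (2 * real CARD('d))"
proof -
  have "discrete_laplacian (\<lambda>y. g (y $ i)) x =
      (\<Sum>j\<in>UNIV. if j = i then g (x $ i + 1) + g (x $ i - 1) - 2 * g (x $ i) else 0)"
    unfolding discrete_laplacian_def by (rule sum.cong) (auto simp: axis_def)
  then show ?thesis by (simp add: gen_def)
qed

lemma exp_le_quadratic:
  fixes x :: real
  assumes "\<bar>x\<bar> \<le> 1"
  shows "exp x \<le> 1 + x + x\<^sup>2"
proof (cases "0 \<le> x")
  case True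
  then show ?thesis using assms by (intro exp_bound) auto
next
  case False
  define y where "y = - x"
  have y: "0 < y" "y \<le> 1" using assms False by (auto simp: y_def)
  \<comment> \<open>The product equals 1 + y^3.\<close>
  have "1 \<le> (1 - y + y\<^sup>2) * (1 + y)" using y by (simp add: algebra_simps power2_eq_square)
  also have "\<dots> \<le> (1 - y + y\<^sup>2) * exp y"
    using y by (intro mult_left_mono exp_ge_add_one_self) auto
  finally have "exp (- y) \<le> 1 - y + y\<^sup>2" by (simp add: exp_minus field_simps)
  then show ?thesis by (simp add: y_def)
qed

lemma cosh_le_square: "\<bar>x\<bar> \<le> 1 \<Longrightarrow> cosh x \<le> 1 + x\<^sup>2" for x :: real
  using exp_le_quadratic[of x] exp_le_quadratic[of "- x"] by (simp add: cosh_def)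

context walk_semigroup
begin

text \<open>One jump count suffices. With m = t/(2d), the mean number of jumps per direction, every
  direction gets the integer part of m, and in each coordinate the direction towards y gets the
  missing jumps on top. A coordinate thus costs two mode factors and one shift factor. The entropy
  term R ln (1 + R/m) carries the exponent: it is of order R^2/t for R up to order t and R ln (R/t)
  far beyond.\<close>

lemma pmf_ge:
  fixes y :: "int ^ 'd"
  defines "\<mu> \<equiv> \<lambda>t. t / (2 * real CARD('d))"
  assumes t: "1 \<le> \<mu> t" and R: "\<And>i. \<bar>y $ i\<bar> \<le> int R"
  shows "exp (- real CARD('d) * (4 + 2 * ln (\<mu> t) + real R * ln (1 + real R / \<mu> t))) \<le> pmf (p t x) (x + y)"
proof -
  define m where "m = \<mu> t"
  have m: "1 \<le> m" "t = real CARD('d) * (2 * m)" using t by (simp_all add: m_def \<mu>_def)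
  have t0: "0 \<le> t" using m by simp
  have m_eq: "m = t / (2 * real CARD('d))" by (simp add: m_def \<mu>_def)
  define J where "J = nat \<lfloor>m\<rfloor>"
  have J: "real J \<le> m" using m by (simp add: J_def)
  define c where "c = (\<lambda>(i, b). J + nat (if b then y $ i else - y $ i))"
  define q where "q = (m / (m + real R)) ^ R"
  have q: "0 \<le> q" "q \<le> 1" using m by (auto simp: q_def intro!: power_le_one)
  define P where "P n = exp (- m) * (m ^ n / fact n)" for n :: nat
  have P0: "exp (- 2) / m \<le> P J" unfolding P_def J_def by (rule poisson_mode_ge[OF m(1)])
  have P1: "exp (- 2) / m * q \<le> P (J + k)" if "k \<le> R" for k
  proof -
    have "exp (- 2) / m * q \<le> P J * q" using P0 q by (intro mult_right_mono)
    also have "\<dots> = exp (- m) * (m ^ J / fact J * q)" by (simp add: P_def)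
    also have "\<dots> \<le> P (J + k)"
      unfolding P_def q_def using m J that by (intro mult_left_mono poisson_shift_ge) auto
    finally show ?thesis .
  qed
  have disp: "disp c = y" by (simp add: disp_def c_def vec_eq_iff)
  have *: "(exp (- 2) / m)\<^sup>2 * q \<le> P (c (i, True)) * P (c (i, False))" for i
  proof (cases "0 \<le> y $ i")
    case True
    have "exp (- 2) / m * q * (exp (- 2) / m) \<le> P (J + nat (y $ i)) * P J"
      by (rule mult_mono[OF P1 P0]) (use True R[of i] m in \<open>auto simp: P_def\<close>)
    with True show ?thesis by (simp add: c_def power2_eq_square mult_ac)
  next
    case False
    have "exp (- 2) / m * (exp (- 2) / m * q) \<le> P J * P (J + nat (- y $ i))"
      by (rule mult_mono[OF P0 P1]) (use False R[of i] m q in \<open>auto simp: P_def\<close>)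
    with False show ?thesis by (simp add: c_def power2_eq_square mult_ac)
  qed
  have "((exp (- 2) / m)\<^sup>2 * q) ^ CARD('d) = (\<Prod>i\<in>(UNIV :: 'd set). (exp (- 2) / m)\<^sup>2 * q)" by simp
  also have "\<dots> \<le> (\<Prod>i\<in>UNIV. P (c (i, True)) * P (c (i, False)))"
    by (rule prod_mono) (use * q in auto)
  also have "\<dots> = (\<Prod>i\<in>UNIV. \<Prod>b\<in>UNIV. P (c (i, b)))" by (simp add: UNIV_bool mult.commute)
  also have "\<dots> = (\<Prod>k\<in>UNIV. P (c k))" unfolding prod.cartesian_product UNIV_Times_UNIV by (simp add: case_prod_unfold)
  also have "\<dots> = exp (- t) * (\<Prod>k\<in>UNIV. m ^ c k / fact (c k))"
    unfolding P_def prod.distrib by (simp add: exp_of_nat_mult[symmetric] m card_cartesian_product del: prod_constant) (simp add: exp_of_nat_mult[symmetric] card_cartesian_product)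
  also have "\<dots> \<le> exp (- t) * (exp t * pmf (p t x) (x + disp c))"
    by (intro mult_left_mono) (use pmf_ge_poisson[of t c x, folded m_eq] t0 in auto)
  also have "\<dots> = pmf (p t x) (x + y)" by (simp add: disp mult.assoc[symmetric] exp_add[symmetric])
  finally have main: "((exp (- 2) / m)\<^sup>2 * q) ^ CARD('d) \<le> pmf (p t x) (x + y)" .
  have "(exp (- 2) / m)\<^sup>2 * q = exp (2 * (- 2 - ln m) - real R * ln (1 + real R / m))"
  proof -
    have "exp (- 2) / m = exp (- 2 - ln m)" using m by (simp add: exp_diff)
    moreover have "m / (m + real R) = exp (- ln (1 + real R / m))"
      using m by (simp add: exp_minus field_simps add_pos_nonneg)
    ultimately have "(exp (- 2) / m)\<^sup>2 * q = (exp (- 2 - ln m))\<^sup>2 * exp (- ln (1 + real R / m)) ^ R"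
      by (simp add: q_def)
    also have "\<dots> = exp (2 * (- 2 - ln m)) * exp (real R * - ln (1 + real R / m))"
      by (simp only: exp_double exp_of_nat_mult)
    also have "\<dots> = exp (2 * (- 2 - ln m) - real R * ln (1 + real R / m))"
      by (simp add: exp_add[symmetric])
    finally show ?thesis .
  qed
  then have "((exp (- 2) / m)\<^sup>2 * q) ^ CARD('d) =
      exp (real CARD('d) * (2 * (- 2 - ln m) - real R * ln (1 + real R / m)))"
    by (simp only: exp_of_nat_mult)
  also have "\<dots> = exp (- real CARD('d) * (4 + 2 * ln m + real R * ln (1 + real R / m)))"
    by (simp add: algebra_simps)
  finally have "((exp (- 2) / m)\<^sup>2 * q) ^ CARD('d) =
      exp (- real CARD('d) * (4 + 2 * ln m + real R * ln (1 + real R / m)))" .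
  with main show ?thesis by (simp add: m_def)
qed

text \<open>Gronwall: exp (-lam t) times the mean of f is nonincreasing, since its derivative is a
  mean of \<open>gen f\<close> - lam f.\<close>

lemma supersolution_mean_le:
  assumes t: "0 \<le> t" and "0 \<le> lam" and b: "\<And>x. \<bar>f x\<bar> \<le> B" and "\<And>x. gen f x \<le> lam * f x"
  shows "mean (p t x) f \<le> exp (lam * t) * f x"
proof -
  have gb: "\<bar>gen f x\<bar> \<le> 2 * B" for x by (rule gen_abs_le[OF b])
  define u where "u t = - (exp (- lam * t) * mean (p t x) f)" for t
  define u' where "u' t = exp (- lam * t) * (lam * mean (p t x) f - mean (p t x) (gen f))" for t
  have "u 0 \<le> u t"
  proof (rule nondecreasing_from_within[where u' = u', OF t])
    fix s :: real assume s: "0 \<le> s"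
    have e: "((\<lambda>t. exp (- lam * t)) has_real_derivative (- lam) * exp (- lam * s)) (at s within {0..})"
      by (auto intro!: derivative_eq_intros)
    show "(u has_real_derivative u' s) (at s within {0..})"
      using DERIV_minus[OF DERIV_mult[OF e mean_has_derivative[where f = f, OF b s, of x]]]
      unfolding u_def[abs_def] u'_def by (simp add: algebra_simps)
    have "mean (p s x) (gen f) \<le> mean (p s x) (\<lambda>x. lam * f x)"
      by (rule integral_mono)
        (use assms mean_integrable[where f = "gen f", OF gb] mean_integrable[where f = f, OF b] in auto)
    then show "0 \<le> u' s" by (simp add: u'_def)
  qed
  then have "exp (lam * t) * (exp (- lam * t) * mean (p t x) f) \<le> exp (lam * t) * f x"
    by (intro mult_left_mono) (simp_all add: u_def p_0)
  then show ?thesis by (simp add: mult.assoc[symmetric] exp_add[symmetric])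
qed

text \<open>The function cosh is an eigenfunction with eigenvalue (cosh \<theta> - 1)/d but
  unbounded, while the generator is available for bounded functions only. Truncation at n keeps a
  supersolution, and monotone convergence removes n. An even function controls both signs of the
  displacement at once.\<close>

lemma cosh_moment:
  assumes "0 \<le> t" "\<bar>\<theta>\<bar> \<le> 1"
  shows "(\<integral>\<^sup>+ y. ennreal (cosh (\<theta> * real_of_int (y $ i - x $ i))) \<partial>measure_pmf (p t x)) \<le> ennreal (exp (\<theta>\<^sup>2 * t))"
proof -
  define h where "h y = cosh (\<theta> * real_of_int (y $ i - x $ i))" for y
  define lam where "lam = cosh \<theta> - 1"
  have lam: "0 \<le> lam" "lam \<le> \<theta>\<^sup>2" using cosh_le_square[of \<theta>] assms(2) cosh_real_ge_1[of \<theta>] by (auto simp: lam_def)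
  have h0: "1 \<le> h y" for y unfolding h_def by (rule cosh_real_ge_1)
  have gh: "gen h y \<le> lam * h y" for y
  proof -
    define a where "a = \<theta> * real_of_int (y $ i - x $ i)"
    have eq: "\<theta> * real_of_int (y $ i + 1 - x $ i) = a + \<theta>" "\<theta> * real_of_int (y $ i - 1 - x $ i) = a - \<theta>"
      by (simp_all add: a_def algebra_simps)
    have "gen h y = (cosh (a + \<theta>) + cosh (a - \<theta>) - 2 * cosh a) / (2 * real CARD('d))"
      unfolding h_def[abs_def] gen_coord[of "\<lambda>k. cosh (\<theta> * real_of_int (k - x $ i))"] eq a_def[symmetric] ..
    also have "cosh (a + \<theta>) + cosh (a - \<theta>) - 2 * cosh a = 2 * (lam * h y)"
      by (simp add: cosh_add cosh_diff lam_def h_def[of y, folded a_def] algebra_simps)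
    finally have "gen h y = lam * h y / real CARD('d)" by simp
    moreover have "lam * h y / real CARD('d) \<le> lam * h y / 1"
      using lam h0[of y] by (intro divide_left_mono) (auto simp: Suc_le_eq)
    ultimately show ?thesis by simp
  qed
  have trunc: "mean (p t x) (\<lambda>y. min (h y) (real n)) \<le> exp (\<theta>\<^sup>2 * t)" for n
  proof -
    have "mean (p t x) (\<lambda>y. min (h y) (real n)) \<le> exp (lam * t) * min (h x) (real n)"
    proof (rule supersolution_mean_le[OF \<open>0 \<le> t\<close> lam(1)])
      show "\<bar>min (h y) (real n)\<bar> \<le> real n" for y using h0[of y] by auto
      show "gen (\<lambda>y. min (h y) (real n)) y \<le> lam * min (h y) (real n)" for y
      proof (cases "h y \<le> real n")
        case True
        with gen_min_le[of h y "\<lambda>_. real n"] gh[of y] show ?thesis by simp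
      next
        case False
        with gen_min_le'[of "\<lambda>_. real n" y h] have "gen (\<lambda>y. min (h y) (real n)) y \<le> 0" by simp
        also have "0 \<le> lam * min (h y) (real n)" using lam h0[of y] by (auto simp: min_def)
        finally show ?thesis .
      qed
    qed
    also have "\<dots> \<le> exp (lam * t) * 1" by (intro mult_left_mono) (auto simp: h_def)
    also have "\<dots> \<le> exp (\<theta>\<^sup>2 * t)" using lam \<open>0 \<le> t\<close> by (simp add: mult_right_mono)
    finally show ?thesis .
  qed
  have sup: "ennreal (h y) = (SUP n. ennreal (min (h y) (real n)))" for y
  proof (rule antisym)
    have "h y \<le> real (nat \<lceil>h y\<rceil>)" by linarith
    then show "ennreal (h y) \<le> (SUP n. ennreal (min (h y) (real n)))"
      by (intro SUP_upper2[of "nat \<lceil>h y\<rceil>"]) auto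
    show "(SUP n. ennreal (min (h y) (real n))) \<le> ennreal (h y)"
      by (intro SUP_least ennreal_leI) auto
  qed
  have "(\<integral>\<^sup>+ y. ennreal (h y) \<partial>measure_pmf (p t x)) = (SUP n. \<integral>\<^sup>+ y. ennreal (min (h y) (real n)) \<partial>measure_pmf (p t x))"
    unfolding sup
    by (rule nn_integral_monotone_convergence_SUP)
      (auto intro!: incseq_SucI le_funI ennreal_leI)
  also have "\<dots> \<le> ennreal (exp (\<theta>\<^sup>2 * t))"
  proof (rule SUP_least)
    fix n
    have "integrable (measure_pmf (p t x)) (\<lambda>y. min (h y) (real n))"
      by (rule mean_integrable[of _ "real n"]) (use order_trans[OF zero_le_one h0] in \<open>auto simp: min_def\<close>)
    then have "(\<integral>\<^sup>+ y. ennreal (min (h y) (real n)) \<partial>measure_pmf (p t x)) = ennreal (mean (p t x) (\<lambda>y. min (h y) (real n)))"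
      by (rule nn_integral_eq_integral) (auto intro: order_trans[OF zero_le_one h0])
    with trunc[of n] show "(\<integral>\<^sup>+ y. ennreal (min (h y) (real n)) \<partial>measure_pmf (p t x)) \<le> ennreal (exp (\<theta>\<^sup>2 * t))"
      by (simp add: ennreal_leI)
  qed
  finally show ?thesis by (simp add: h_def)
qed

end

section \<open>The walk\<close>

text \<open>A finite product of discrete spaces is discrete. Limits along paths therefore become
  eventual equalities, and right continuity means being constant for a while.\<close>

lemma open_singleton_lattice: "open {x :: int ^ 'd}"
  unfolding open_vec_def
proof (intro ballI exI conjI allI impI)
  fix y assume "y \<in> {x}"
  fix i show "open {x $ i}" by (rule discrete_topology_class.open_discrete)
  show "y $ i \<in> {x $ i}" using \<open>y \<in> {x}\<close> by simp
next
  fix y z assume "\<forall>i. z $ i \<in> {x $ i}"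
  then show "z \<in> {x}" by (simp add: vec_eq_iff)
qed

lemma tendsto_lattice_iff:
  fixes x :: "int ^ 'd"
  shows "(f \<longlongrightarrow> x) F \<longleftrightarrow> (\<forall>\<^sub>F u in F. f u = x)"
  using topological_tendstoD[OF _ open_singleton_lattice, of f x F x]
  by (auto intro: tendsto_eventually)

locale walk = walk_semigroup p
  for p :: "real \<Rightarrow> int ^ 'd \<Rightarrow> (int ^ 'd) pmf" +
  fixes Q :: "'w measure" and S :: "real \<Rightarrow> 'w \<Rightarrow> int ^ 'd"
  assumes markov: "markov_process Q S 0 p"

sublocale walk \<subseteq> Q: prob_space Q
  using markov by (simp add: markov_process_def)

context walk
begin

lemma S_measurable [measurable]: "0 \<le> t \<Longrightarrow> S t \<in> measurable Q (count_space UNIV)"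
  using markov by (simp add: markov_process_def)

lemma fdd:
  assumes "t 0 = 0" "mono t"
  shows "measure Q {\<omega> \<in> space Q. \<forall>i\<le>n. S (t i) \<omega> = x i} =
    of_bool (x 0 = 0) * (\<Prod>i<n. pmf (p (t (Suc i) - t i) (x i)) (x (Suc i)))"
  using markov assms unfolding markov_process_def by blast

lemma right_constant:
  assumes "\<omega> \<in> space Q" "0 \<le> u"
  obtains e where "0 < e" "\<And>v. u \<le> v \<Longrightarrow> v < u + e \<Longrightarrow> S v \<omega> = S u \<omega>"
proof -
  have "continuous (at_right u) (\<lambda>u. S u \<omega>)"
    using markov assms by (simp add: markov_process_def)
  then have "\<forall>\<^sub>F v in at_right u. S v \<omega> = S u \<omega>"
    by (simp add: continuous_within tendsto_lattice_iff)
  then obtain b where b: "u < b" "\<And>v. u < v \<Longrightarrow> v < b \<Longrightarrow> S v \<omega> = S u \<omega>"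
    by (auto simp: eventually_at_right_field)
  show ?thesis
    by (rule that[of "b - u"]) (use b in \<open>auto simp: le_less\<close>)
qed

lemma left_constant:
  assumes "\<omega> \<in> space Q" "0 < u"
  obtains e l where "0 < e" "\<And>v. u - e < v \<Longrightarrow> v < u \<Longrightarrow> S v \<omega> = l"
proof -
  obtain l where "((\<lambda>u. S u \<omega>) \<longlongrightarrow> l) (at_left u)"
    using markov assms unfolding markov_process_def by blast
  then have "\<forall>\<^sub>F v in at_left u. S v \<omega> = l" by (simp add: tendsto_lattice_iff)
  then obtain b where b: "b < u" "\<And>v. b < v \<Longrightarrow> v < u \<Longrightarrow> S v \<omega> = l"
    by (auto simp: eventually_at_left_field)
  show ?thesis by (rule that[of "u - b" l]) (use b in auto)
qed

text \<open>Compactness by bisection: near every time the path takes at most two values, the present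
  one and the left limit. Reading times through max 0 u covers the intervals around 0 that reach
  below it.\<close>

lemma finite_range:
  assumes \<omega>: "\<omega> \<in> space Q" and "0 \<le> t"
  shows "finite ((\<lambda>u. S (max 0 u) \<omega>) ` {0..t})"
  using \<open>0 \<le> t\<close>
proof (rule Bolzano[where P = "\<lambda>a b. finite ((\<lambda>u. S (max 0 u) \<omega>) ` {a..b})"])
  fix a b c :: real
  assume fin: "finite ((\<lambda>u. S (max 0 u) \<omega>) ` {a..b})" "finite ((\<lambda>u. S (max 0 u) \<omega>) ` {b..c})"
    and "a \<le> b" "b \<le> c"
  then have "{a..c} = {a..b} \<union> {b..c}" by auto
  with fin show "finite ((\<lambda>u. S (max 0 u) \<omega>) ` {a..c})" by (simp add: image_Un)
next
  fix x assume "0 \<le> x" "x \<le> t"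
  obtain e where e: "0 < e" "\<And>v. x \<le> v \<Longrightarrow> v < x + e \<Longrightarrow> S v \<omega> = S x \<omega>"
    using right_constant[OF \<omega> \<open>0 \<le> x\<close>] by blast
  obtain e' l where e': "0 < e'" "\<And>v. x - e' < v \<Longrightarrow> v < x \<Longrightarrow> S (max 0 v) \<omega> = l"
  proof (cases "x = 0")
    case True
    then have "S (max 0 v) \<omega> = S 0 \<omega>" if "v < x" for v using that by (simp add: max_def)
    then show ?thesis by (intro that[of 1 "S 0 \<omega>"]) auto
  next
    case False
    with \<open>0 \<le> x\<close> have "0 < x" by simp
    then obtain e l where "0 < e" "\<And>v. x - e < v \<Longrightarrow> v < x \<Longrightarrow> S v \<omega> = l"
      using left_constant[OF \<omega>] by blast
    then show ?thesis using \<open>0 < x\<close> by (intro that[of "min e x" l]) auto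
  qed
  show "\<exists>d>0. \<forall>a b. a \<le> x \<and> x \<le> b \<and> b - a < d \<longrightarrow> finite ((\<lambda>u. S (max 0 u) \<omega>) ` {a..b})"
  proof (intro exI[of _ "min e e'"] conjI allI impI)
    fix a b assume ab: "a \<le> x \<and> x \<le> b \<and> b - a < min e e'"
    have "(\<lambda>u. S (max 0 u) \<omega>) ` {a..b} \<subseteq> {l, S x \<omega>}"
    proof (rule image_subsetI)
      fix u assume u: "u \<in> {a..b}"
      show "S (max 0 u) \<omega> \<in> {l, S x \<omega>}"
      proof (cases "x \<le> u")
        case True
        moreover from this ab u have "u < x + e" by auto
        ultimately show ?thesis using e(2)[of u] \<open>0 \<le> x\<close> by (simp add: max_def)
      next
        case False
        then have "S (max 0 u) \<omega> = l" using ab u by (intro e'(2)) auto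
        then show ?thesis by simp
      qed
    qed
    then show "finite ((\<lambda>u. S (max 0 u) \<omega>) ` {a..b})" by (rule finite_subset) simp
  qed (use e(1) e'(1) in simp)
qed

text \<open>
  Sampling at grid points strictly to the right of \<open>u\<close> makes right continuity sufficient.
\<close>

lemma floor_sample:
  assumes "\<omega> \<in> space Q" "0 \<le> u"
  obtains e where "0 < e" "\<And>d. 0 < d \<Longrightarrow> d < e \<Longrightarrow> S (a + of_int (\<lfloor>(u - a) / d\<rfloor> + 1) * d) \<omega> = S u \<omega>"
proof -
  obtain e where e: "0 < e" "\<And>v. u \<le> v \<Longrightarrow> v < u + e \<Longrightarrow> S v \<omega> = S u \<omega>"
    using right_constant[OF assms(1,2)] by blast
  show ?thesis
  proof (rule that[OF e(1)], rule e(2))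
    fix d :: real assume d: "0 < d" "d < e"
    have "(u - a) / d < of_int (\<lfloor>(u - a) / d\<rfloor> + 1)" by linarith
    then have "u - a < of_int (\<lfloor>(u - a) / d\<rfloor> + 1) * d" using d(1) by (simp only: pos_divide_less_eq)
    then show "u \<le> a + of_int (\<lfloor>(u - a) / d\<rfloor> + 1) * d" by linarith
    have "of_int (\<lfloor>(u - a) / d\<rfloor> + 1) \<le> (u - a) / d + 1" by linarith
    then have "of_int (\<lfloor>(u - a) / d\<rfloor> + 1) * d \<le> ((u - a) / d + 1) * d"
      using d by (intro mult_right_mono) auto
    also have "\<dots> = u - a + d" using d by (simp add: field_simps)
    finally show "a + of_int (\<lfloor>(u - a) / d\<rfloor> + 1) * d < u + e" using d by linarith
  qed
qed

text \<open>Pointwise limit of samples at grid times strictly to the right of u, of which there are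
  countably many. Negative times are folded to 0, because nothing is assumed about S there.\<close>

lemma joint_measurable [measurable]:
  fixes f :: "int ^ 'd \<Rightarrow> real"
  shows "(\<lambda>(u, \<omega>). f (S (max 0 u) \<omega>)) \<in> borel_measurable (borel \<Otimes>\<^sub>M Q)"
proof (rule borel_measurable_LIMSEQ_real)
  fix n :: nat
  have "(\<lambda>x. f (S (max 0 (of_int k / real (Suc n))) (snd x))) \<in> borel_measurable (borel \<Otimes>\<^sub>M Q)" for k
  proof -
    have "S (max 0 (of_int k / real (Suc n))) \<in> measurable Q (count_space UNIV)" by (rule S_measurable) simp
    from measurable_compose[OF measurable_compose[OF measurable_snd this], of f borel]
    show ?thesis by simp
  qed
  moreover have "(\<lambda>x. \<lfloor>max 0 (fst x) / (1 / real (Suc n))\<rfloor> + 1) \<in> measurable (borel \<Otimes>\<^sub>M Q) (count_space (UNIV :: int set))"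
    by measurable
  ultimately show "(\<lambda>x. f (S (max 0 (of_int (\<lfloor>max 0 (fst x) / (1 / real (Suc n))\<rfloor> + 1) / real (Suc n))) (snd x)))
      \<in> borel_measurable (borel \<Otimes>\<^sub>M Q)"
    by (rule measurable_compose_countable)
next
  fix x :: "real \<times> 'w" assume "x \<in> space (borel \<Otimes>\<^sub>M Q)"
  then have \<omega>: "snd x \<in> space Q" by (auto simp: space_pair_measure)
  obtain e where e: "0 < e" "\<And>d. 0 < d \<Longrightarrow> d < e \<Longrightarrow>
      S (0 + of_int (\<lfloor>(max 0 (fst x) - 0) / d\<rfloor> + 1) * d) (snd x) = S (max 0 (fst x)) (snd x)"
    using floor_sample[OF \<omega>, of "max 0 (fst x)" 0] by (metis max.cobounded1)
  have "\<forall>\<^sub>F n in sequentially. inverse (real (Suc n)) < e"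
    using e(1) LIMSEQ_inverse_real_of_nat by (rule order_tendstoD(2)[rotated])
  then have "\<forall>\<^sub>F n in sequentially.
      S (max 0 (of_int (\<lfloor>max 0 (fst x) / (1 / real (Suc n))\<rfloor> + 1) / real (Suc n))) (snd x) = S (max 0 (fst x)) (snd x)"
  proof eventually_elim
    case (elim n)
    have "0 \<le> (of_int (\<lfloor>max 0 (fst x) / (1 / real (Suc n))\<rfloor> + 1) / real (Suc n) :: real)" by simp
    then show ?case using e(2)[of "1 / real (Suc n)"] elim by (simp add: inverse_eq_divide)
  qed
  then have "\<forall>\<^sub>F n in sequentially.
      f (S (max 0 (of_int (\<lfloor>max 0 (fst x) / (1 / real (Suc n))\<rfloor> + 1) / real (Suc n))) (snd x)) = f (S (max 0 (fst x)) (snd x))"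
    by eventually_elim simp
  then show "(\<lambda>n. f (S (max 0 (of_int (\<lfloor>max 0 (fst x) / (1 / real (Suc n))\<rfloor> + 1) / real (Suc n))) (snd x)))
      \<longlonglongrightarrow> (case x of (u, \<omega>) \<Rightarrow> f (S (max 0 u) \<omega>))"
    by (simp add: case_prod_unfold tendsto_eventually)
qed

section \<open>Integrals along the path\<close>

definition occ :: "(int ^ 'd \<Rightarrow> real) \<Rightarrow> real \<Rightarrow> real \<Rightarrow> 'w \<Rightarrow> real" where
  "occ V a b \<omega> = (LBINT u:{a..b}. V (S u \<omega>))"

lemma path_measurable:
  assumes "\<omega> \<in> space Q"
  shows "(\<lambda>u. f (S (max 0 u) \<omega>) :: real) \<in> borel_measurable lborel"
  using measurable_compose[OF measurable_Pair2'[OF assms] joint_measurable[of f]] by simp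

text \<open>Only nonnegative times are seen, so folding changes nothing; the folded path is the one
  known to be jointly measurable.\<close>

lemma occ_max: "0 \<le> a \<Longrightarrow> occ V a b \<omega> = (LBINT u:{a..b}. V (S (max 0 u) \<omega>))"
  unfolding occ_def set_lebesgue_integral_def
  by (intro Bochner_Integration.integral_cong refl) (auto simp: indicator_def)

lemma path_integrable_max:
  assumes "\<omega> \<in> space Q" "0 \<le> a"
  shows "set_integrable lborel {a..b} (\<lambda>u. f (S (max 0 u) \<omega>) :: real)"
proof (cases "a \<le> b")
  case True
  have "finite ((\<lambda>u. S (max 0 u) \<omega>) ` {a..b})"
    by (rule finite_subset[OF _ finite_range[OF assms(1), of b]]) (use assms True in auto)
  then have "finite ((\<lambda>u. f (S (max 0 u) \<omega>)) ` {a..b})"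
    using finite_imageI[of "(\<lambda>u. S (max 0 u) \<omega>) ` {a..b}" f] by (simp add: image_image)
  then obtain B where "\<And>u. u \<in> {a..b} \<Longrightarrow> \<bar>f (S (max 0 u) \<omega>)\<bar> \<le> B"
    using finite_imp_bounded[of "(\<lambda>u. f (S (max 0 u) \<omega>)) ` {a..b}"] unfolding bounded_iff by fastforce
  then show ?thesis unfolding set_integrable_def
    by (intro integrableI_bounded_set[where A = "{a..b}" and B = B])
      (use path_measurable[OF assms(1), of f] True in \<open>auto simp: indicator_def\<close>)
qed (simp add: set_integrable_def)

lemma path_integrable:
  assumes "\<omega> \<in> space Q" "0 \<le> a"
  shows "set_integrable lborel {a..b} (\<lambda>u. f (S u \<omega>) :: real)"
proof -
  have "(\<lambda>u. indicat_real {a..b} u *\<^sub>R f (S (max 0 u) \<omega>)) = (\<lambda>u. indicat_real {a..b} u *\<^sub>R f (S u \<omega>))"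
    using assms(2) by (auto simp: indicator_def max_def fun_eq_iff)
  with path_integrable_max[OF assms, of b f] show ?thesis
    unfolding set_integrable_def by simp
qed

lemma occ_measurable [measurable]:
  assumes "0 \<le> a"
  shows "occ V a b \<in> borel_measurable Q"
proof -
  have "(\<lambda>\<omega>. \<integral>u. indicator {a..b} u *\<^sub>R V (S (max 0 u) \<omega>) \<partial>lborel) \<in> borel_measurable Q"
    by (rule lborel.borel_measurable_lebesgue_integral)
      (use measurable_compose[OF measurable_pair_swap' joint_measurable[of V]] in
        \<open>simp add: case_prod_unfold\<close>)
  then show ?thesis using occ_max[OF assms, of V b] by (simp add: set_lebesgue_integral_def cong: measurable_cong)
qed

lemma occ_mono:
  assumes "\<omega> \<in> space Q" "0 \<le> a" "\<And>x. f x \<le> g x"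
  shows "occ f a b \<omega> \<le> occ g a b \<omega>"
  unfolding occ_def by (rule set_integral_mono) (use assms path_integrable in auto)

lemma occ_add:
  assumes "\<omega> \<in> space Q" "0 \<le> a"
  shows "occ (\<lambda>x. f x + g x) a b \<omega> = occ f a b \<omega> + occ g a b \<omega>"
  unfolding occ_def by (rule set_integral_add) (use assms path_integrable in auto)

lemma occ_cmult: "occ (\<lambda>x. c * f x) a b \<omega> = c * occ f a b \<omega>"
  unfolding occ_def by simp

lemma occ_const: "a \<le> b \<Longrightarrow> occ (\<lambda>_. c) a b \<omega> = c * (b - a)"
  unfolding occ_def by (simp add: set_lebesgue_integral_def)

lemma occ_sum:
  assumes "\<omega> \<in> space Q" "0 \<le> a" "finite A"
  shows "occ (\<lambda>x. \<Sum>i\<in>A. f i x) a b \<omega> = (\<Sum>i\<in>A. occ (f i) a b \<omega>)"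
  using assms(3)
proof (induction A rule: finite_induct)
  case empty
  then show ?case by (simp add: occ_def)
qed (simp add: occ_add[OF assms(1,2)])

lemma occ_nonneg:
  assumes "\<And>x. 0 \<le> f x"
  shows "0 \<le> occ f a b \<omega>"
  unfolding occ_def set_lebesgue_integral_def by (rule Bochner_Integration.integral_nonneg) (use assms in auto)

lemma occ_subinterval:
  assumes "\<omega> \<in> space Q" "0 \<le> a'" "a' \<le> a" "b \<le> b'" "\<And>x. 0 \<le> f x"
  shows "occ f a b \<omega> \<le> occ f a' b' \<omega>"
  unfolding occ_def set_lebesgue_integral_def
proof (rule integral_mono)
  show "integrable lborel (\<lambda>u. indicat_real {a..b} u *\<^sub>R f (S u \<omega>))"
    using path_integrable[OF assms(1), of a b f] assms by (simp add: set_integrable_def)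
  show "integrable lborel (\<lambda>u. indicat_real {a'..b'} u *\<^sub>R f (S u \<omega>))"
    using path_integrable[OF assms(1), of a' b' f] assms by (simp add: set_integrable_def)
qed (use assms in \<open>auto simp: indicator_def\<close>)

text \<open>The sum is the integral of a step function that reads the path at the right end of each
  cell. \<open>floor_sample\<close> gives pointwise convergence, and the bound on V gives
  domination.\<close>

lemma riemann_sum:
  assumes \<omega>: "\<omega> \<in> space Q" and "0 \<le> a" "0 < t" and b: "\<And>x. \<bar>V x\<bar> \<le> v"
  shows "(\<lambda>n. t / real (Suc n) * (\<Sum>k<Suc n. V (S (a + real (Suc k) * (t / real (Suc n))) \<omega>)))
    \<longlonglongrightarrow> occ V a (a + t) \<omega>"
proof -
  define d where "d n = t / real (Suc n)" for n
  have d: "0 < d n" "real (Suc n) * d n = t" for n using \<open>0 < t\<close> by (simp_all add: d_def)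
  define I where "I n k = {a + real k * d n ..< a + real (Suc k) * d n}" for n k
  define G where "G n u = (\<Sum>k<Suc n. indicator (I n k) u * V (S (a + real (Suc k) * d n) \<omega>))" for n u
  have Geq: "G n u = (if u \<in> {a..<a+t} then V (S (a + of_int (\<lfloor>(u - a) / d n\<rfloor> + 1) * d n) \<omega>) else 0)" for n u
  proof -
    define j where "j = \<lfloor>(u - a) / d n\<rfloor>"
    have jI: "u \<in> I n k \<longleftrightarrow> j = int k" for k
      unfolding I_def j_def floor_eq_iff using d(1)[of n]
      by (auto simp: pos_le_divide_eq pos_divide_less_eq algebra_simps)
    show ?thesis
    proof (cases "u \<in> {a..<a+t}")
      case True
      have "0 \<le> j" using True d(1)[of n] by (simp add: j_def)
      moreover have "(u - a) / d n < real (Suc n)" using True d[of n] by (simp add: pos_divide_less_eq)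
      then have "j < int (Suc n)" unfolding j_def floor_less_iff by simp
      ultimately have "nat j < Suc n" by linarith
      have "G n u = (\<Sum>k<Suc n. if k = nat j then V (S (a + real (Suc k) * d n) \<omega>) else 0)"
        unfolding G_def by (rule sum.cong) (use \<open>0 \<le> j\<close> in \<open>auto simp: indicator_def jI\<close>)
      also have "\<dots> = V (S (a + real (Suc (nat j)) * d n) \<omega>)" using \<open>nat j < Suc n\<close> by simp
      also have "real (Suc (nat j)) = of_int (j + 1)" using \<open>0 \<le> j\<close> by simp
      finally show ?thesis using True by (simp add: j_def)
    next
      case False
      have "u \<notin> I n k" if "k < Suc n" for k
      proof
        assume "u \<in> I n k"
        then have "a + real k * d n \<le> u" "u < a + real (Suc k) * d n" by (auto simp: I_def)
        moreover have "real (Suc k) * d n \<le> real (Suc n) * d n" using that d(1)[of n] by (intro mult_right_mono) auto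
        moreover have "0 \<le> real k * d n" using d(1)[of n] by simp
        ultimately show False using False d(2)[of n] by auto
      qed
      then show ?thesis using False by (auto simp: G_def intro!: sum.neutral)
    qed
  qed
  have v0: "0 \<le> v" using b[of 0] by linarith
  have int: "integral\<^sup>L lborel (G n) = t / real (Suc n) * (\<Sum>k<Suc n. V (S (a + real (Suc k) * (t / real (Suc n))) \<omega>))" for n
  proof -
    have m: "measure lborel (I n k) = d n" and fin: "emeasure lborel (I n k) < \<infinity>" for k
      using d(1)[of n] by (simp_all add: I_def algebra_simps)
    have "integral\<^sup>L lborel (G n) = (\<Sum>k<Suc n. \<integral>u. indicator (I n k) u * V (S (a + real (Suc k) * d n) \<omega>) \<partial>lborel)"
      unfolding G_def
      by (rule Bochner_Integration.integral_sum)
        (intro Bochner_Integration.integrable_mult_left integrable_real_indicator fin, simp add: I_def)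
    also have "\<dots> = (\<Sum>k<Suc n. d n * V (S (a + real (Suc k) * d n) \<omega>))"
      by (rule sum.cong) (simp_all add: m I_def[symmetric])
    finally show ?thesis by (simp only: sum_distrib_left d_def)
  qed
  have "(\<lambda>n. integral\<^sup>L lborel (G n)) \<longlonglongrightarrow> integral\<^sup>L lborel (\<lambda>u. indicator {a..a+t} u *\<^sub>R V (S (max 0 u) \<omega>))"
  proof (rule integral_dominated_convergence)
    show "integrable lborel (\<lambda>u. indicator {a..a+t} u * v)"
      using \<open>0 < t\<close> by (intro Bochner_Integration.integrable_mult_left integrable_real_indicator) auto
    show "(\<lambda>u. indicator {a..a+t} u *\<^sub>R V (S (max 0 u) \<omega>)) \<in> borel_measurable lborel"
      using path_measurable[OF \<omega>, of V] by measurable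
    show "G n \<in> borel_measurable lborel" for n
      unfolding G_def[abs_def] I_def by measurable
    show "AE u in lborel. norm (G n u) \<le> indicator {a..a+t} u * v" for n
      using b v0 by (intro AE_I2) (simp add: Geq indicator_def)
    \<comment> \<open>The step functions live on half-open cells and vanish at a + t, where the
      limit integrand need not vanish.\<close>
    have "AE u in lborel. u \<noteq> a + t" by (rule AE_lborel_singleton)
    then show "AE u in lborel. (\<lambda>n. G n u) \<longlonglongrightarrow> indicator {a..a+t} u *\<^sub>R V (S (max 0 u) \<omega>)"
    proof eventually_elim
      case (elim u)
      show ?case
      proof (cases "u \<in> {a..<a+t}")
        case True
        with \<open>0 \<le> a\<close> have "0 \<le> u" by auto
        obtain e where e: "0 < e" "\<And>d. 0 < d \<Longrightarrow> d < e \<Longrightarrow> S (a + of_int (\<lfloor>(u - a) / d\<rfloor> + 1) * d) \<omega> = S u \<omega>"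
          using floor_sample[OF \<omega> \<open>0 \<le> u\<close>, of a] by blast
        have "d \<longlonglongrightarrow> 0" unfolding d_def[abs_def] by real_asymp
        then have "\<forall>\<^sub>F n in sequentially. d n < e" using e(1) by (rule order_tendstoD(2))
        then have "\<forall>\<^sub>F n in sequentially. G n u = V (S u \<omega>)"
          by eventually_elim (use e(2) d(1) True in \<open>simp add: Geq\<close>)
        then show ?thesis using True \<open>0 \<le> u\<close> by (simp add: tendsto_eventually)
      next
        case False
        with elim show ?thesis by (auto simp: Geq indicator_def)
      qed
    qed
  qed
  then show ?thesis unfolding int occ_max[OF \<open>0 \<le> a\<close>] set_lebesgue_integral_def .
qed

end

subsection \<open>The Feynman--Kac inequality\<close>

context walk
begin

text \<open>Newest position first: a further step is a cons, and the current state is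
  \<open>hd\<close>.\<close>

primrec path_list :: "(nat \<Rightarrow> real) \<Rightarrow> nat \<Rightarrow> 'w \<Rightarrow> (int ^ 'd) list" where
  "path_list t 0 \<omega> = [S (t 0) \<omega>]"
| "path_list t (Suc n) \<omega> = S (t (Suc n)) \<omega> # path_list t n \<omega>"

primrec chain :: "(nat \<Rightarrow> real) \<Rightarrow> nat \<Rightarrow> (int ^ 'd) list pmf" where
  "chain t 0 = return_pmf [0]"
| "chain t (Suc n) = bind_pmf (chain t n) (\<lambda>l. map_pmf (\<lambda>y. y # l) (p (t (Suc n) - t n) (hd l)))"

lemma length_path_list [simp]: "length (path_list t n \<omega>) = Suc n"
  by (induction n) auto

lemma length_chain: "l \<in> set_pmf (chain t n) \<Longrightarrow> length l = Suc n"
  by (induction n arbitrary: l) auto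

lemma path_list_nth: "i \<le> n \<Longrightarrow> path_list t n \<omega> ! i = S (t (n - i)) \<omega>"
  by (induction n arbitrary: i) (auto simp: nth_Cons split: nat.splits)

lemma pmf_chain_Suc:
  "pmf (chain t (Suc n)) (y # l) = pmf (chain t n) l * pmf (p (t (Suc n) - t n) (hd l)) y"
proof -
  have "pmf (map_pmf (\<lambda>y. y # l') q) (y # l) = of_bool (l' = l) * pmf q y" for l' and q :: "(int ^ 'd) pmf"
    using pmf_map_inj'[of "\<lambda>y. y # l" q y] by (cases "l' = l") (auto simp: inj_def intro: pmf_map_outside)
  then have "pmf (chain t (Suc n)) (y # l) =
      mean (chain t n) (\<lambda>l'. of_bool (l' = l) * pmf (p (t (Suc n) - t n) (hd l')) y)"
    by (simp add: pmf_bind)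
  also have "\<dots> = mean (chain t n) (\<lambda>l'. of_bool (l' = l) * pmf (p (t (Suc n) - t n) (hd l)) y)"
    by (rule Bochner_Integration.integral_cong) auto
  also have "\<dots> = pmf (chain t n) l * pmf (p (t (Suc n) - t n) (hd l)) y"
    by (simp add: mean_of_bool_eq)
  finally show ?thesis .
qed

lemma pmf_chain:
  "length l = Suc n \<Longrightarrow> pmf (chain t n) l =
    of_bool (l ! n = 0) * (\<Prod>i<n. pmf (p (t (Suc i) - t i) (l ! (n - i))) (l ! (n - Suc i)))"
proof (induction n arbitrary: l)
  case 0
  then obtain y where "l = [y]" by (auto simp: length_Suc_conv)
  then show ?case by simp
next
  case (Suc n)
  then obtain y l' where l: "l = y # l'" "length l' = Suc n" by (auto simp: length_Suc_conv)
  have "(\<Prod>i<n. pmf (p (t (Suc i) - t i) (l ! (Suc n - i))) (l ! (Suc n - Suc i))) =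
      (\<Prod>i<n. pmf (p (t (Suc i) - t i) (l' ! (n - i))) (l' ! (n - Suc i)))"
    by (rule prod.cong) (auto simp: l nth_Cons Suc_diff_le Suc_diff_Suc[symmetric] split: nat.splits)
  moreover have "hd l' = l' ! 0" using l by (intro hd_conv_nth) auto
  ultimately show ?case using Suc.IH[OF l(2)] l
    by (simp add: pmf_chain_Suc del: chain.simps)
qed

lemma path_list_measurable:
  assumes "t 0 = 0" "mono t"
  shows "path_list t n \<in> measurable Q (count_space UNIV)"
proof (induction n)
  have t: "0 \<le> t n" for n using monoD[OF assms(2), of 0 n] assms(1) by simp
  {
    case 0
    have "(\<lambda>x. [x]) \<in> measurable (count_space UNIV) (count_space UNIV)" by simp
    from measurable_compose[OF S_measurable[OF t[of 0]] this] show ?case by simp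
  next
    case (Suc n)
    have "(\<lambda>\<omega>. (S (t (Suc n)) \<omega>, path_list t n \<omega>)) \<in> measurable Q (count_space UNIV \<Otimes>\<^sub>M count_space UNIV)"
      by (intro measurable_Pair Suc S_measurable t)
    then have "(\<lambda>\<omega>. (S (t (Suc n)) \<omega>, path_list t n \<omega>)) \<in> measurable Q (count_space UNIV)"
      by (simp add: pair_measure_countable)
    from measurable_compose[OF this, of "\<lambda>(x, l). x # l" "count_space UNIV"] show ?case by simp
  }
qed

text \<open>Lists of lattice points form a countable type, so the law is determined by single lists,
  whose probabilities are the finite dimensional distributions. Expectations of sampled paths thus
  become iterated means.\<close>

lemma distr_path_list:
  assumes t: "t 0 = 0" "mono t"
  shows "distr Q (count_space UNIV) (path_list t n) = measure_pmf (chain t n)"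
proof (rule measure_eqI_countable[where A = UNIV])
  fix l :: "(int ^ 'd) list"
  note m = path_list_measurable[OF t, of n]
  have "emeasure (distr Q (count_space UNIV) (path_list t n)) {l} = measure Q {\<omega> \<in> space Q. path_list t n \<omega> = l}"
    by (subst emeasure_distr[OF m]) (auto simp: Q.emeasure_eq_measure vimage_def Int_def conj_commute)
  also have "measure Q {\<omega> \<in> space Q. path_list t n \<omega> = l} = pmf (chain t n) l"
  proof (cases "length l = Suc n")
    case True
    have "path_list t n \<omega> = l \<longleftrightarrow> (\<forall>i\<le>n. S (t i) \<omega> = l ! (n - i))" for \<omega>
    proof -
      have "path_list t n \<omega> = l \<longleftrightarrow> (\<forall>i\<le>n. S (t (n - i)) \<omega> = l ! i)"
        by (auto simp: list_eq_iff_nth_eq True path_list_nth less_Suc_eq_le)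
      also have "\<dots> \<longleftrightarrow> (\<forall>i\<le>n. S (t i) \<omega> = l ! (n - i))"
        by (metis diff_diff_cancel diff_le_self)
      finally show ?thesis .
    qed
    then have "measure Q {\<omega> \<in> space Q. path_list t n \<omega> = l} =
        of_bool (l ! (n - 0) = 0) * (\<Prod>i<n. pmf (p (t (Suc i) - t i) (l ! (n - i))) (l ! (n - Suc i)))"
      using fdd[OF t, of n "\<lambda>i. l ! (n - i)"] by simp
    with pmf_chain[OF True] show ?thesis by simp
  next
    case False
    then have "path_list t n \<omega> \<noteq> l" for \<omega> using length_path_list[of t n \<omega>] by metis
    moreover have "l \<notin> set_pmf (chain t n)" using False length_chain by blast
    ultimately show ?thesis by (simp add: set_pmf_iff)
  qed
  finally show "emeasure (distr Q (count_space UNIV) (path_list t n)) {l} = emeasure (measure_pmf (chain t n)) {l}"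
    by (simp add: emeasure_pmf_single)
qed auto

lemma expectation_path_list:
  fixes F :: "(int ^ 'd) list \<Rightarrow> real"
  assumes "t 0 = 0" "mono t"
  shows "(LINT \<omega>|Q. F (path_list t n \<omega>)) = mean (chain t n) F"
  unfolding distr_path_list[OF assms, of n, symmetric]
  by (rule integral_distr[symmetric]) (use path_list_measurable[OF assms] in auto)

lemma mean_chain_Suc:
  assumes F: "\<And>l. \<bar>F l\<bar> \<le> B" and h: "\<And>x. \<bar>h x\<bar> \<le> B'"
  shows "mean (chain t (Suc n)) (\<lambda>l. F (tl l) * h (hd l)) =
    mean (chain t n) (\<lambda>l. F l * mean (p (t (Suc n) - t n) (hd l)) h)"
proof -
  have "0 \<le> B" "0 \<le> B'" using F[of "[]"] h[of 0] by linarith+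
  then have "\<bar>F (tl l) * h (hd l)\<bar> \<le> B * B'" for l
    unfolding abs_mult by (intro mult_mono F h) auto
  then have b: "\<bar>(\<lambda>l. F (tl l) * h (hd l)) l\<bar> \<le> B * B'" for l by simp
  show ?thesis unfolding chain.simps by (subst mean_bind[OF b]) simp
qed

lemma distr_S: "0 \<le> t \<Longrightarrow> distr Q (count_space UNIV) (S t) = measure_pmf (p t 0)"
proof -
  assume t: "0 \<le> t"
  define s where "s n = (if n = (0::nat) then 0 else t)" for n
  have s: "s 0 = 0" "mono s" using t by (auto simp: s_def mono_def)
  have "distr Q (count_space UNIV) (S t) = distr (distr Q (count_space UNIV) (path_list s 1)) (count_space UNIV) hd"
    using path_list_measurable[OF s, of 1] by (subst distr_distr) (auto simp: s_def o_def)
  also have "\<dots> = measure_pmf (map_pmf hd (chain s 1))"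
    by (simp add: distr_path_list[OF s] map_pmf_rep_eq del: chain.simps)
  also have "map_pmf hd (chain s 1) = p t 0"
    by (simp add: s_def bind_return_pmf map_pmf_comp)
  finally show ?thesis .
qed

lemma prob_S_eq:
  assumes "0 \<le> t"
  shows "Q.prob {\<omega> \<in> space Q. S t \<omega> = x} = pmf (p t 0) x"
proof -
  have "pmf (p t 0) x = measure (distr Q (count_space UNIV) (S t)) {x}"
    by (simp add: distr_S[OF assms] measure_pmf_single)
  also have "\<dots> = Q.prob {\<omega> \<in> space Q. S t \<omega> = x}"
    by (subst measure_distr) (use S_measurable[OF assms] in \<open>auto intro!: arg_cong[where f = Q.prob]\<close>)
  finally show ?thesis ..
qed

end

text \<open>First order expansion of one time step of the Feynman--Kac semigroup. Three errors of
  size e h/3 are allowed: the generator limit for f, replacing the mean of V f at time h by its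
  value at x, and the second order remainder of exp (h V).\<close>

lemma (in walk_semigroup) tilted_generator:
  assumes f: "\<And>x. \<bar>f x\<bar> \<le> B" and V: "\<And>x. \<bar>V x\<bar> \<le> v" and "0 < e"
  obtains d where "0 < d"
    "\<And>h x. 0 < h \<Longrightarrow> h < d \<Longrightarrow>
      \<bar>mean (p h x) (\<lambda>y. exp (h * V y) * f y) - f x - h * (gen f x + V x * f x)\<bar> \<le> e * h"
proof -
  have B: "0 \<le> B" and v: "0 \<le> v" using f[of 0] V[of 0] by linarith+
  have Vf: "\<bar>V x * f x\<bar> \<le> v * B" for x unfolding abs_mult using f V B v by (intro mult_mono) auto
  obtain d1 where d1: "0 < d1"
    "\<And>h x. 0 \<le> h \<Longrightarrow> h < d1 \<Longrightarrow> \<bar>mean (p h x) f - f x - h * gen f x\<bar> \<le> e / 3 * h"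
  proof -
    have "0 < e / 3" using \<open>0 < e\<close> by simp
    from generator_uniform[where f = f, OF f this] show ?thesis using that .
  qed
  obtain d2 where d2: "0 < d2"
    "\<And>h x. 0 \<le> h \<Longrightarrow> h < d2 \<Longrightarrow>
      \<bar>mean (p h x) (\<lambda>x. V x * f x) - V x * f x - h * gen (\<lambda>x. V x * f x) x\<bar> \<le> 1 * h"
    by (rule generator_uniform[where f = "\<lambda>x. V x * f x", OF Vf zero_less_one]) (rule that)
  define C where "C = 1 + 2 * (v * B)"
  have C: "0 < C" using v B by (simp add: C_def add_pos_nonneg)
  \<comment> \<open>The third entry makes h C \<le> e/3, where h C bounds the change of the mean of
    V f; the fourth gives \<bar>h V\<bar> \<le> 1, as the quadratic bound on exp requires; the fifth
    makes that remainder at most e h/3.\<close>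
  define d where "d = Min {d1, d2, e / 3 / C, 1 / (1 + v), e / 3 / (1 + v\<^sup>2 * B)}"
  have "0 < 1 + v\<^sup>2 * B" using B by (simp add: add_pos_nonneg)
  then have d0: "0 < d" using d1(1) d2(1) C v \<open>0 < e\<close> by (simp add: d_def)
  show ?thesis
  proof (rule that[OF d0])
    fix h x assume h: "0 < h" "h < d"
    then have hd: "h < d1" "h < d2" "h < e / 3 / C" "h < 1 / (1 + v)" "h < e / 3 / (1 + v\<^sup>2 * B)"
      by (simp_all add: d_def)
    have hv: "h * (1 + v) < 1" using hd(4) v by (simp add: pos_less_divide_eq)
    have hV: "\<bar>h * V y\<bar> \<le> 1" for y
    proof -
      have "\<bar>h * V y\<bar> \<le> h * (1 + v)" using h V[of y] by (simp add: abs_mult)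
      with hv show ?thesis by linarith
    qed
    define R where "R y = (exp (h * V y) - 1 - h * V y) * f y" for y
    have R: "\<bar>R y\<bar> \<le> e / 3 * h" for y
    proof -
      have "\<bar>exp (h * V y) - 1 - h * V y\<bar> \<le> (h * V y)\<^sup>2"
        using exp_le_quadratic[OF hV[of y]] exp_ge_add_one_self[of "h * V y"] zero_le_power2[of "h * V y"] by linarith
      also have "\<dots> = h * h * (V y)\<^sup>2" by (simp add: power2_eq_square)
      also have "\<dots> \<le> h * h * v\<^sup>2" using power_mono[OF V[of y], of 2] h by (intro mult_left_mono) auto
      finally have "\<bar>R y\<bar> \<le> h * h * v\<^sup>2 * B"
        unfolding R_def abs_mult using f h by (intro mult_mono) auto
      also have "\<dots> \<le> h * (h * (1 + v\<^sup>2 * B))" using h by (simp add: algebra_simps)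
      also have "h * (1 + v\<^sup>2 * B) \<le> e / 3" using hd(5) \<open>0 < 1 + v\<^sup>2 * B\<close> by (simp add: pos_less_divide_eq algebra_simps)
      finally show ?thesis using h by (simp add: mult.commute)
    qed
    have split: "exp (h * V y) * f y = f y + (h * (V y * f y) + R y)" for y
      by (simp add: R_def algebra_simps)
    have "mean (p h x) (\<lambda>y. exp (h * V y) * f y) =
        mean (p h x) f + (h * mean (p h x) (\<lambda>y. V y * f y) + mean (p h x) R)"
      unfolding split using mean_integrable[where f = f, OF f] mean_integrable[where f = "\<lambda>y. V y * f y", OF Vf]
        mean_integrable[where f = R, OF R] by simp
    moreover have "\<bar>mean (p h x) R\<bar> \<le> e / 3 * h" by (rule abs_mean_le[OF R])
    moreover have "\<bar>mean (p h x) f - f x - h * gen f x\<bar> \<le> e / 3 * h" using d1(2) h hd by simp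
    moreover have "\<bar>h * mean (p h x) (\<lambda>y. V y * f y) - h * (V x * f x)\<bar> \<le> e / 3 * h"
    proof -
      have "\<bar>h * gen (\<lambda>x. V x * f x) x\<bar> \<le> h * (2 * (v * B))"
        unfolding abs_mult using h gen_abs_le[of "\<lambda>x. V x * f x", OF Vf, of x] by (intro mult_mono) auto
      moreover have "\<bar>mean (p h x) (\<lambda>x. V x * f x) - V x * f x - h * gen (\<lambda>x. V x * f x) x\<bar> \<le> h"
        using d2(2)[of h x] h hd by simp
      ultimately have "\<bar>mean (p h x) (\<lambda>x. V x * f x) - V x * f x\<bar> \<le> h * C"
        unfolding C_def distrib_left by linarith
      also have "\<dots> \<le> e / 3" using hd(3) C by (simp add: pos_less_divide_eq)
      finally have "h * \<bar>mean (p h x) (\<lambda>x. V x * f x) - V x * f x\<bar> \<le> h * (e / 3)"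
        using h by (intro mult_left_mono) auto
      moreover have "h * mean (p h x) (\<lambda>y. V y * f y) - h * (V x * f x) = h * (mean (p h x) (\<lambda>x. V x * f x) - V x * f x)"
        by (simp add: right_diff_distrib)
      ultimately show ?thesis using h by (simp add: abs_mult mult.commute)
    qed
    moreover have "\<bar>a + (b + c) - a' - (g + b')\<bar> \<le> e * h"
      if "\<bar>c\<bar> \<le> e / 3 * h" "\<bar>a - a' - g\<bar> \<le> e / 3 * h" "\<bar>b - b'\<bar> \<le> e / 3 * h" for a b c a' b' g
    proof -
      have "e / 3 * h = e * h / 3" by simp
      with that show ?thesis by linarith
    qed
    ultimately show "\<bar>mean (p h x) (\<lambda>y. exp (h * V y) * f y) - f x - h * (gen f x + V x * f x)\<bar> \<le> e * h"
      by (simp add: distrib_left)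
  qed
qed

context walk
begin

text \<open>Index 0 is time 0, where the finite dimensional distributions must start; the uniform
  grid begins at time a with index 1.\<close>

fun grid :: "real \<Rightarrow> real \<Rightarrow> nat \<Rightarrow> real" where
  "grid a h 0 = 0"
| "grid a h (Suc k) = a + real k * h"

text \<open>In a list sampled on \<open>grid a h\<close> up to index n + 1, newest first, entry n is
  the position at time a, and the entries k < n are those at the times from a + n h down to a +
  h.\<close>

definition weight :: "int ^ 'd \<Rightarrow> (int ^ 'd \<Rightarrow> real) \<Rightarrow> nat \<Rightarrow> (int ^ 'd) list \<Rightarrow> real" where
  "weight x w n l = of_bool (l ! n = x) * (\<Prod>k<n. w (l ! k))"

lemma mono_grid: "0 \<le> a \<Longrightarrow> 0 \<le> h \<Longrightarrow> mono (grid a h)"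
  unfolding mono_iff_le_Suc
proof
  fix n assume "0 \<le> a" "0 \<le> h"
  then show "grid a h n \<le> grid a h (Suc n)" by (cases n) (auto simp: algebra_simps)
qed

lemma abs_weight_le:
  assumes "\<And>x. 0 \<le> w x \<and> w x \<le> c"
  shows "\<bar>weight x w n l\<bar> \<le> c ^ n"
proof -
  have "0 \<le> (\<Prod>k<n. w (l ! k))" by (intro prod_nonneg) (use assms in auto)
  moreover have "(\<Prod>k<n. w (l ! k)) \<le> (\<Prod>k<n. c)" by (intro prod_mono) (use assms in auto)
  moreover have "0 \<le> c" using assms[of 0] by linarith
  ultimately show ?thesis by (auto simp: weight_def)
qed

text \<open>The newest position is integrated out first: by the step bound this replaces w f by k f,
  at the price of e times a weight of size at most c^n. Going down to time a leaves the mass at x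
  and n such errors.\<close>

lemma weight_recursion:
  assumes w: "\<And>x. 0 \<le> w x \<and> w x \<le> c" and "1 \<le> c" and f: "\<And>x. \<bar>f x\<bar> \<le> B"
    and step: "\<And>x. mean (p h x) (\<lambda>y. w y * f y) \<le> k * f x + e"
    and k: "0 \<le> k" "k \<le> c" and "0 \<le> e"
  shows "mean (chain (grid a h) (Suc n)) (\<lambda>l. weight x w n l * f (hd l))
    \<le> k ^ n * (pmf (p a 0) x * f x) + real n * e * c ^ n"
proof (induction n)
  case 0
  have "mean (chain (grid a h) (Suc 0)) (\<lambda>l. weight x w 0 l * f (hd l)) = mean (p a 0) (\<lambda>y. of_bool (y = x) * f x)"
    by (simp add: bind_return_pmf weight_def del: Bochner_Integration.integral_mult_left_zero)
      (rule Bochner_Integration.integral_cong, auto)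
  also have "\<dots> = pmf (p a 0) x * f x" by (simp add: mean_of_bool_eq)
  finally show ?case by simp
next
  case (Suc n)
  let ?q = "\<lambda>n. chain (grid a h) (Suc n)"
  have c0: "0 \<le> c" using \<open>1 \<le> c\<close> by simp
  have B: "0 \<le> B" using f[of 0] by linarith
  have W: "\<bar>weight x w n l\<bar> \<le> c ^ n" for n l by (rule abs_weight_le[OF w])
  have W0: "0 \<le> weight x w n l" for n l
    unfolding weight_def using w by (intro mult_nonneg_nonneg prod_nonneg) auto
  have wf: "\<bar>w y * f y\<bar> \<le> c * B" for y unfolding abs_mult using w[of y] f[of y] B by (intro mult_mono) auto
  have iW: "integrable (measure_pmf q) (weight x w n)" for q by (rule mean_integrable[OF W])
  have "\<bar>weight x w n l * f (hd l)\<bar> \<le> c ^ n * B" for l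
    unfolding abs_mult by (intro mult_mono W f) (use c0 in auto)
  then have iWf: "integrable (measure_pmf q) (\<lambda>l. weight x w n l * f (hd l))" for q by (rule mean_integrable)
  have "mean (?q (Suc n)) (\<lambda>l. weight x w (Suc n) l * f (hd l)) =
      mean (?q (Suc n)) (\<lambda>l. weight x w n (tl l) * (w (hd l) * f (hd l)))"
  proof (rule integral_cong_AE)
    show "AE l in measure_pmf (?q (Suc n)). weight x w (Suc n) l * f (hd l) = weight x w n (tl l) * (w (hd l) * f (hd l))"
    proof (rule AE_pmfI)
      fix l assume "l \<in> set_pmf (?q (Suc n))"
      then obtain y l' where "l = y # l'" using length_chain[of l] by (cases l) force+
      then show "weight x w (Suc n) l * f (hd l) = weight x w n (tl l) * (w (hd l) * f (hd l))"
        by (simp add: weight_def prod.lessThan_Suc_shift del: prod.lessThan_Suc)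
    qed
  qed auto
  also have "\<dots> = mean (?q n) (\<lambda>l. weight x w n l * mean (p h (hd l)) (\<lambda>y. w y * f y))"
    using mean_chain_Suc[of "weight x w n", OF W wf, of "grid a h" "Suc n"] by (simp add: algebra_simps del: chain.simps)
  also have "\<dots> \<le> mean (?q n) (\<lambda>l. k * (weight x w n l * f (hd l)) + e * weight x w n l)"
  proof (rule integral_mono)
    have "\<bar>weight x w n l * mean (p h (hd l)) (\<lambda>y. w y * f y)\<bar> \<le> c ^ n * (c * B)" for l
      unfolding abs_mult by (intro mult_mono W abs_mean_le[OF wf]) (use c0 in auto)
    then show "integrable (measure_pmf (?q n)) (\<lambda>l. weight x w n l * mean (p h (hd l)) (\<lambda>y. w y * f y))"
      by (rule mean_integrable)
    show "integrable (measure_pmf (?q n)) (\<lambda>l. k * (weight x w n l * f (hd l)) + e * weight x w n l)"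
      using iW iWf by simp
    fix l
    show "weight x w n l * mean (p h (hd l)) (\<lambda>y. w y * f y) \<le> k * (weight x w n l * f (hd l)) + e * weight x w n l"
      using mult_left_mono[OF step[of "hd l"] W0[of n l]] by (simp add: algebra_simps)
  qed
  also have "\<dots> = k * mean (?q n) (\<lambda>l. weight x w n l * f (hd l)) + e * mean (?q n) (weight x w n)"
    using iW iWf by simp
  also have "\<dots> \<le> k * (k ^ n * (pmf (p a 0) x * f x) + real n * e * c ^ n) + e * c ^ n"
  proof (intro add_mono mult_left_mono Suc.IH k \<open>0 \<le> e\<close>)
    show "mean (?q n) (weight x w n) \<le> c ^ n" using abs_mean_le[of "weight x w n", OF W, of "?q n"] by linarith
  qed
  also have "\<dots> = k ^ Suc n * (pmf (p a 0) x * f x) + k * (real n * e * c ^ n) + e * c ^ n"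
    by (simp add: algebra_simps)
  also have "\<dots> \<le> k ^ Suc n * (pmf (p a 0) x * f x) + c * (real n * e * c ^ n) + c * (e * c ^ n)"
  proof -
    have "k * (real n * e * c ^ n) \<le> c * (real n * e * c ^ n)"
      using k \<open>0 \<le> e\<close> c0 by (intro mult_right_mono) auto
    moreover have "1 * (e * c ^ n) \<le> c * (e * c ^ n)"
      using \<open>1 \<le> c\<close> \<open>0 \<le> e\<close> c0 by (intro mult_right_mono) auto
    ultimately show ?thesis by linarith
  qed
  also have "\<dots> = k ^ Suc n * (pmf (p a 0) x * f x) + real (Suc n) * e * c ^ Suc n" by (simp add: algebra_simps)
  finally show ?case .
qed


lemma path_list_grid_nth:
  "j \<le> n \<Longrightarrow> path_list (grid a h) (Suc n) \<omega> ! j = S (a + real (n - j) * h) \<omega>"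
  by (subst path_list_nth) (simp_all add: Suc_diff_le)

lemma expectation_weight_grid:
  assumes "0 \<le> a" "0 \<le> h"
  shows "(LINT \<omega>|Q. of_bool (S a \<omega> = x) * exp (h * (\<Sum>k<n. V (S (a + real (Suc k) * h) \<omega>))) * f (S (a + real n * h) \<omega>))
    = mean (chain (grid a h) (Suc n)) (\<lambda>l. weight x (\<lambda>y. exp (h * V y)) n l * f (hd l))"
proof -
  have "of_bool (S a \<omega> = x) * exp (h * (\<Sum>k<n. V (S (a + real (Suc k) * h) \<omega>))) * f (S (a + real n * h) \<omega>)
      = (\<lambda>l. weight x (\<lambda>y. exp (h * V y)) n l * f (hd l)) (path_list (grid a h) (Suc n) \<omega>)" for \<omega>
  proof -
    have "exp (h * (\<Sum>k<n. V (S (a + real (Suc k) * h) \<omega>))) = (\<Prod>k<n. exp (h * V (S (a + real (Suc k) * h) \<omega>)))"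
      by (simp add: sum_distrib_left exp_sum)
    also have "\<dots> = (\<Prod>k<n. exp (h * V (S (a + real (Suc (n - Suc k)) * h) \<omega>)))"
      by (rule prod.nat_diff_reindex[symmetric])
    also have "\<dots> = (\<Prod>k<n. exp (h * V (path_list (grid a h) (Suc n) \<omega> ! k)))"
      by (rule prod.cong) (auto simp: path_list_grid_nth Suc_diff_Suc simp del: path_list.simps)
    finally show ?thesis
      using path_list_grid_nth[of n n a h \<omega>] by (simp add: weight_def del: path_list.simps(1))
  qed
  then show ?thesis
    using expectation_path_list[OF grid.simps(1) mono_grid[OF assms], where n = "Suc n"
        and F = "\<lambda>l. weight x (\<lambda>y. exp (h * V y)) n l * f (hd l)"] by presburger
qed

text \<open>With step h = t/(n+1), one step multiplies by 1 + \<kappa> h up to an error e h. All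
  steps together give (1 + \<kappa> h)^(n+1) and a total error of e t exp (L t). The Riemann sums
  converge to the path integral as n grows, and then e tends to 0.\<close>

theorem Feynman_Kac_le:
  assumes "0 \<le> a" "0 < t" and f: "\<And>x. \<bar>f x\<bar> \<le> B" and V: "\<And>x. \<bar>V x\<bar> \<le> v"
    and gen: "\<And>x. gen f x + V x * f x \<le> \<kappa> * f x"
  shows "(LINT \<omega>|Q. of_bool (S a \<omega> = x) * exp (occ V a (a + t) \<omega>) * f (S (a + t) \<omega>))
    \<le> pmf (p a 0) x * exp (\<kappa> * t) * f x"
proof -
  define h where "h n = t / real (Suc n)" for n
  have h: "0 < h n" "real (Suc n) * h n = t" for n using \<open>0 < t\<close> by (simp_all add: h_def)
  have h0: "h \<longlonglongrightarrow> 0" unfolding h_def[abs_def] by real_asymp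
  have v0: "0 \<le> v" and B0: "0 \<le> B" using V[of 0] f[of 0] by linarith+
  define X where "X n \<omega> = of_bool (S a \<omega> = x) * exp (h n * (\<Sum>k<Suc n. V (S (a + real (Suc k) * h n) \<omega>))) * f (S (a + t) \<omega>)" for n \<omega>
  define Y where "Y \<omega> = of_bool (S a \<omega> = x) * exp (occ V a (a + t) \<omega>) * f (S (a + t) \<omega>)" for \<omega>
  have [measurable]: "S a \<in> measurable Q (count_space UNIV)" "S (a + t) \<in> measurable Q (count_space UNIV)"
    "occ V a (a + t) \<in> borel_measurable Q"
    using assms by (auto intro!: S_measurable occ_measurable)
  have [measurable]: "S (a + real (Suc k) * h n) \<in> measurable Q (count_space UNIV)" for k n
    using assms h(1)[of n] by (intro S_measurable) (auto simp: less_imp_le)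
  have [measurable]: "(g :: int ^ 'd \<Rightarrow> real) \<in> borel_measurable (count_space UNIV)" for g by simp
  have lim: "(\<lambda>n. integral\<^sup>L Q (X n)) \<longlonglongrightarrow> integral\<^sup>L Q Y"
  proof (rule integral_dominated_convergence)
    show "Y \<in> borel_measurable Q" unfolding Y_def[abs_def] by measurable
    show "X n \<in> borel_measurable Q" for n unfolding X_def[abs_def] by measurable
    show "integrable Q (\<lambda>_. exp (t * v) * B)" by simp
    show "AE \<omega> in Q. norm (X n \<omega>) \<le> exp (t * v) * B" for n
    proof (rule AE_I2)
      fix \<omega>
      have "(\<Sum>k<Suc n. V (S (a + real (Suc k) * h n) \<omega>)) \<le> (\<Sum>k<Suc n. v)"
        by (rule sum_mono) (use V in \<open>auto simp: abs_le_iff\<close>)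
      then have "h n * (\<Sum>k<Suc n. V (S (a + real (Suc k) * h n) \<omega>)) \<le> h n * (real (Suc n) * v)"
        using h(1)[of n] by (intro mult_left_mono) auto
      also have "\<dots> = t * v" using h(2)[of n] by (metis mult.assoc mult.commute)
      finally have "exp (h n * (\<Sum>k<Suc n. V (S (a + real (Suc k) * h n) \<omega>))) \<le> exp (t * v)" by simp
      then have "of_bool (S a \<omega> = x) * exp (h n * (\<Sum>k<Suc n. V (S (a + real (Suc k) * h n) \<omega>))) * \<bar>f (S (a + t) \<omega>)\<bar> \<le> 1 * exp (t * v) * B"
        using f by (intro mult_mono) auto
      then show "norm (X n \<omega>) \<le> exp (t * v) * B" by (simp add: X_def abs_mult)
    qed
    show "AE \<omega> in Q. (\<lambda>n. X n \<omega>) \<longlonglongrightarrow> Y \<omega>"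
    proof (rule AE_I2)
      fix \<omega> assume "\<omega> \<in> space Q"
      from riemann_sum[OF this \<open>0 \<le> a\<close> \<open>0 < t\<close>, of V v, OF V]
      show "(\<lambda>n. X n \<omega>) \<longlonglongrightarrow> Y \<omega>"
        unfolding X_def Y_def h_def by (intro tendsto_intros) 
    qed
  qed
  \<comment> \<open>exp (L h) dominates both the weight exp (h V) and the factor 1 + \<kappa> h, as
    \<open>weight_recursion\<close> requires of its c.\<close>
  define L where "L = v + \<bar>\<kappa>\<bar>"
  have L0: "0 \<le> L" using v0 by (simp add: L_def)
  define P where "P = pmf (p a 0) x * f x"
  have bound: "integral\<^sup>L Q Y \<le> exp (\<kappa> * t) * P + e * (t * exp (L * t))" if "0 < e" for e
  proof -
    obtain d where d: "0 < d" "\<And>h x. 0 < h \<Longrightarrow> h < d \<Longrightarrow>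
        \<bar>mean (p h x) (\<lambda>y. exp (h * V y) * f y) - f x - h * (gen f x + V x * f x)\<bar> \<le> e * h"
      by (rule tilted_generator[where f = f and V = V, OF f V \<open>0 < e\<close>]) (rule that)
    have ev: "\<forall>\<^sub>F n in sequentially. integral\<^sup>L Q (X n) \<le> (1 + \<kappa> * t / real (Suc n)) ^ Suc n * P + e * (t * exp (L * t))"
    proof -
      have "\<forall>\<^sub>F n in sequentially. h n < d" using h0 d(1) by (rule order_tendstoD(2))
      moreover have "\<forall>\<^sub>F n in sequentially. h n < 1 / (1 + \<bar>\<kappa>\<bar>)" using h0 by (rule order_tendstoD(2)) (simp add: add_pos_nonneg)
      ultimately show ?thesis
      proof eventually_elim
        case (elim n)
        have hk: "h n * \<bar>\<kappa>\<bar> \<le> 1"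
        proof -
          have "h n * (1 + \<bar>\<kappa>\<bar>) < 1" using elim(2) by (simp add: pos_less_divide_eq add_pos_nonneg)
          then show ?thesis using h(1)[of n] by (simp add: distrib_left)
        qed
        have "integral\<^sup>L Q (X n) = mean (chain (grid a (h n)) (Suc (Suc n))) (\<lambda>l. weight x (\<lambda>y. exp (h n * V y)) (Suc n) l * f (hd l))"
          unfolding X_def h(2)[of n, symmetric]
          by (rule expectation_weight_grid) (use h(1)[of n] assms in auto)
        also have "\<dots> \<le> (1 + \<kappa> * h n) ^ Suc n * (pmf (p a 0) x * f x) + real (Suc n) * (e * h n) * exp (L * h n) ^ Suc n"
        proof (rule weight_recursion[OF _ _ f])
          show "0 \<le> exp (h n * V y) \<and> exp (h n * V y) \<le> exp (L * h n)" for y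
          proof -
            have "h n * V y \<le> h n * L" using h(1)[of n] V[of y] by (intro mult_left_mono) (auto simp: L_def)
            then show ?thesis by (simp add: mult.commute)
          qed
          show "1 \<le> exp (L * h n)" using L0 h(1)[of n] by simp
          show "mean (p (h n) y) (\<lambda>z. exp (h n * V z) * f z) \<le> (1 + \<kappa> * h n) * f y + e * h n" for y
          proof -
            have "h n * (gen f y + V y * f y) \<le> h n * (\<kappa> * f y)"
              using gen[of y] h(1)[of n] by (intro mult_left_mono) auto
            moreover have "mean (p (h n) y) (\<lambda>z. exp (h n * V z) * f z) \<le> f y + h n * (gen f y + V y * f y) + e * h n"
              using d(2)[OF h(1) elim(1), of y] by (simp only: abs_le_iff) linarith
            ultimately show ?thesis by (simp add: algebra_simps)
          qed
          show "0 \<le> 1 + \<kappa> * h n" using hk h(1)[of n] by (cases "0 \<le> \<kappa>") (auto simp: mult.commute)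
          have "1 + \<kappa> * h n \<le> 1 + L * h n" using h(1)[of n] v0 by (intro add_left_mono mult_right_mono) (auto simp: L_def)
          also have "\<dots> \<le> exp (L * h n)" by (rule exp_ge_add_one_self)
          finally show "1 + \<kappa> * h n \<le> exp (L * h n)" .
          show "0 \<le> e * h n" using \<open>0 < e\<close> h(1)[of n] by simp
        qed
        also have "real (Suc n) * (e * h n) * exp (L * h n) ^ Suc n = e * (t * exp (L * t))"
        proof -
          have "exp (L * h n) ^ Suc n = exp (real (Suc n) * (L * h n))" by (rule exp_of_nat_mult[symmetric])
          moreover have "real (Suc n) * (L * h n) = L * t" using h(2)[of n] by (simp only: mult.left_commute)
          moreover have "real (Suc n) * (e * h n) = e * t" using h(2)[of n] by (simp only: mult.left_commute)
          ultimately show ?thesis by (simp only: mult.assoc)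
        qed
        finally show ?case by (simp add: P_def h_def)
      qed
    qed
    have "(\<lambda>n. (1 + \<kappa> * t / real (Suc n)) ^ Suc n * P + e * (t * exp (L * t))) \<longlonglongrightarrow> exp (\<kappa> * t) * P + e * (t * exp (L * t))"
      by (intro tendsto_intros LIMSEQ_Suc[OF tendsto_exp_limit_sequentially])
    from tendsto_le[OF sequentially_bot this lim ev] show ?thesis .
  qed
  have "integral\<^sup>L Q Y \<le> exp (\<kappa> * t) * P"
  proof (rule field_le_epsilon)
    fix e :: real assume "0 < e"
    have "integral\<^sup>L Q Y \<le> exp (\<kappa> * t) * P + e / (t * exp (L * t)) * (t * exp (L * t))"
      by (rule bound) (use \<open>0 < e\<close> \<open>0 < t\<close> in auto)
    then show "integral\<^sup>L Q Y \<le> exp (\<kappa> * t) * P + e" using \<open>0 < t\<close> by simp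
  qed
  then show ?thesis by (simp add: Y_def[abs_def] P_def mult_ac)
qed

end

section \<open>Occupation times\<close>

subsection \<open>Supersolutions for the resolvent\<close>

definition l1 :: "int ^ 'd \<Rightarrow> real" where
  "l1 x = (\<Sum>i\<in>UNIV. \<bar>real_of_int (x $ i)\<bar>)"

definition expdec :: "real \<Rightarrow> int ^ 'd \<Rightarrow> real" where
  "expdec \<theta> x = exp (- \<theta> * l1 x)"

lemma l1_axis: "l1 (x + axis i c) = l1 x + (\<bar>real_of_int (x $ i + c)\<bar> - \<bar>real_of_int (x $ i)\<bar>)"
proof -
  have "l1 (x + axis i c) - l1 x = (\<Sum>j\<in>UNIV. if j = i then \<bar>real_of_int (x $ i + c)\<bar> - \<bar>real_of_int (x $ i)\<bar> else 0)"
    unfolding l1_def sum_subtractf[symmetric] by (rule sum.cong) (auto simp: axis_def)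
  then show ?thesis by simp
qed

lemma l1_nonneg [simp]: "0 \<le> l1 x" by (simp add: l1_def sum_nonneg)

lemma l1_0 [simp]: "l1 0 = 0" by (simp add: l1_def)

lemma expdec_pos [simp]: "0 < expdec \<theta> x" by (simp add: expdec_def)

lemma expdec_0 [simp]: "expdec \<theta> 0 = 1" by (simp add: expdec_def)

lemma expdec_le_1: "0 \<le> \<theta> \<Longrightarrow> expdec \<theta> x \<le> 1" by (simp add: expdec_def)

text \<open>Of the two steps in coordinate i one increases and one decreases the norm
  \<open>l1\<close>, unless the coordinate is 0, where both lead away; hence the two
  factors.\<close>

lemma expdec_laplacian:
  "expdec \<theta> (x + axis i 1) - expdec \<theta> x + (expdec \<theta> (x - axis i 1) - expdec \<theta> x) =
    (if x $ i = 0 then 2 * (exp (- \<theta>) - 1) else 2 * (cosh \<theta> - 1)) * expdec \<theta> x"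
proof -
  have m: "x - axis i 1 = x + axis i (- 1)" by (simp add: vec_eq_iff axis_def)
  have "expdec \<theta> (x + axis i c) = expdec \<theta> x * exp (- \<theta> * (\<bar>real_of_int (x $ i + c)\<bar> - \<bar>real_of_int (x $ i)\<bar>))" for c
    by (simp add: expdec_def l1_axis distrib_left exp_add[symmetric] algebra_simps)
  note eq = this[of 1] this[of "- 1", folded m]
  consider "x $ i = 0" | "x $ i > 0" | "x $ i < 0" by linarith
  then show ?thesis
    by cases (simp_all add: eq cosh_def algebra_simps)
qed

lemma expdec_supersolution:
  fixes x :: "int ^ 'd"
  assumes "0 \<le> \<theta>"
  shows "gen (expdec \<theta>) x \<le> (cosh \<theta> - 1) * expdec \<theta> x"
proof -
  have "exp (- \<theta>) \<le> cosh \<theta>" using assms by (simp add: cosh_def)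
  then have "discrete_laplacian (expdec \<theta>) x \<le> (\<Sum>i\<in>(UNIV :: 'd set). 2 * (cosh \<theta> - 1) * expdec \<theta> x)"
    unfolding discrete_laplacian_def expdec_laplacian
    by (intro sum_mono mult_right_mono) (auto simp: less_imp_le)
  then show ?thesis by (simp add: gen_def divide_le_eq mult_ac)
qed

lemma expdec_at_0: "gen (expdec \<theta>) 0 = exp (- \<theta>) - 1"
  unfolding gen_def discrete_laplacian_def expdec_laplacian by simp

text \<open>In one dimension only the origin has a vanishing coordinate, so the supersolution
  inequality is an equality elsewhere. The lower bound on local times uses the reverse
  inequality.\<close>

lemma expdec_eigenfunction:
  fixes x :: "int ^ 'd"
  assumes "CARD('d) = 1" "x \<noteq> 0"
  shows "gen (expdec \<theta>) x = (cosh \<theta> - 1) * expdec \<theta> x"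
proof -
  obtain i where i: "(UNIV :: 'd set) = {i}" using assms(1) by (rule card_1_singletonE)
  then have "x $ i \<noteq> 0" using assms(2) by (metis (full_types) UNIV_I singletonD vec_eq_iff zero_index)
  then show ?thesis
    unfolding gen_def discrete_laplacian_def expdec_laplacian by (simp add: i)
qed

lemma gen_two_coords:
  fixes F :: "int \<Rightarrow> int \<Rightarrow> real" and x :: "int ^ 'd"
  assumes "i \<noteq> j"
  shows "gen (\<lambda>y. F (y $ i) (y $ j)) x = (F (x $ i + 1) (x $ j) + F (x $ i - 1) (x $ j) +
    F (x $ i) (x $ j + 1) + F (x $ i) (x $ j - 1) - 4 * F (x $ i) (x $ j)) / (2 * real CARD('d))"
proof -
  have "discrete_laplacian (\<lambda>y. F (y $ i) (y $ j)) x =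
      (\<Sum>k\<in>UNIV. (if k = i then F (x $ i + 1) (x $ j) + F (x $ i - 1) (x $ j) - 2 * F (x $ i) (x $ j) else 0) +
        (if k = j then F (x $ i) (x $ j + 1) + F (x $ i) (x $ j - 1) - 2 * F (x $ i) (x $ j) else 0))"
    unfolding discrete_laplacian_def by (rule sum.cong) (use assms in \<open>auto simp: axis_def\<close>)
  then show ?thesis by (simp add: gen_def sum.distrib)
qed

text \<open>Opposite neighbours multiply to (q + 1)^2 - 4 a^2 \<le> (q + 1)^2, so each pair of
  logarithms exceeds 2 ln q by at most 2/q.\<close>

lemma ln_laplacian_upper:
  fixes a b c :: real
  assumes "1 \<le> c"
  defines "q \<equiv> \<lambda>a b. c + a\<^sup>2 + b\<^sup>2"
  shows "ln (q (a + 1) b) + ln (q (a - 1) b) + ln (q a (b + 1)) + ln (q a (b - 1)) - 4 * ln (q a b) \<le> 4 / q a b"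
proof -
  have q0: "0 < q a b" for a b using assms by (simp add: q_def add_pos_nonneg)
  have *: "ln (q (a + 1) b) + ln (q (a - 1) b) \<le> 2 * (ln (q a b) + 1 / q a b)" for a b
  proof -
    have "q (a + 1) b * q (a - 1) b = (q a b + 1)\<^sup>2 - 4 * a\<^sup>2"
      by (simp add: q_def power2_eq_square algebra_simps)
    also have "\<dots> \<le> (q a b + 1)\<^sup>2" by simp
    finally have "ln (q (a + 1) b * q (a - 1) b) \<le> ln ((q a b + 1)\<^sup>2)"
      using q0 by (intro ln_mono) auto
    then have "ln (q (a + 1) b) + ln (q (a - 1) b) \<le> 2 * ln (q a b + 1)"
      using q0[of "a + 1" b] q0[of "a - 1" b] q0[of a b] by (simp add: ln_mult ln_realpow)
    moreover have "ln (q a b + 1) = ln (q a b) + ln (1 + 1 / q a b)"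
      using q0[of a b] by (subst ln_mult_pos[symmetric]) (auto simp: field_simps add_pos_pos)
    moreover have "ln (1 + 1 / q a b) \<le> 1 / q a b"
      using q0[of a b] by (intro ln_add_one_self_le_self) auto
    ultimately have "ln (q (a + 1) b) + ln (q (a - 1) b) \<le> 2 * ln (q a b) + 2 * (1 / q a b)"
      by argo
    then show ?thesis by (simp add: distrib_left)
  qed
  have sym: "q b a = q a b" for a b by (simp add: q_def)
  from *[of a b] *[of b a] show ?thesis by (simp add: sym)
qed

text \<open>The product of the four neighbouring values is r^4 + 2 r^2 + 8 r + 5 + 16 a^2 b^2 with r
  = 1 + a^2 + b^2, hence at least r^4: the function ln r is subharmonic on the planar
  lattice.\<close>

lemma ln_laplacian_lower:
  fixes a b :: real
  defines "q \<equiv> \<lambda>a b. 1 + a\<^sup>2 + b\<^sup>2"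
  shows "0 \<le> ln (q (a + 1) b) + ln (q (a - 1) b) + ln (q a (b + 1)) + ln (q a (b - 1)) - 4 * ln (q a b)"
proof -
  have q0: "0 < q a b" for a b by (simp add: q_def add_pos_nonneg)
  define r where "r = q a b"
  have r: "0 < r" unfolding r_def by (rule q0)
  have p1: "q (a + 1) b * q (a - 1) b = (r + 1)\<^sup>2 - 4 * a\<^sup>2"
    and p2: "q a (b + 1) * q a (b - 1) = (r + 1)\<^sup>2 - 4 * b\<^sup>2"
    by (simp_all add: q_def r_def power2_eq_square algebra_simps)
  have "((r + 1)\<^sup>2 - 4 * a\<^sup>2) * ((r + 1)\<^sup>2 - 4 * b\<^sup>2) =
      (r + 1)\<^sup>2 * (r + 1)\<^sup>2 - 4 * (a\<^sup>2 + b\<^sup>2) * (r + 1)\<^sup>2 + 16 * (a\<^sup>2 * b\<^sup>2)"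
    by (simp add: algebra_simps)
  also have "a\<^sup>2 + b\<^sup>2 = r - 1" by (simp add: r_def q_def)
  also have "(r + 1)\<^sup>2 * (r + 1)\<^sup>2 - 4 * (r - 1) * (r + 1)\<^sup>2 = r ^ 4 + (2 * r\<^sup>2 + 8 * r + 5)"
    by (simp add: power2_eq_square power4_eq_xxxx algebra_simps)
  finally have "((r + 1)\<^sup>2 - 4 * a\<^sup>2) * ((r + 1)\<^sup>2 - 4 * b\<^sup>2) \<ge> r ^ 4" using r by simp
  then have "ln (r ^ 4) \<le> ln ((q (a + 1) b * q (a - 1) b) * (q a (b + 1) * q a (b - 1)))"
    using r by (intro ln_mono) (auto simp: p1 p2)
  then show ?thesis
    using q0[of "a + 1" b] q0[of "a - 1" b] q0[of a "b + 1"] q0[of a "b - 1"] r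
    by (simp add: ln_mult ln_realpow r_def[symmetric])
qed

lemma sinh_ge: "0 \<le> x \<Longrightarrow> x \<le> 1 \<Longrightarrow> x / 2 \<le> sinh x" for x :: real
proof -
  assume x: "0 \<le> x" "x \<le> 1"
  have "1 + x \<le> exp x" by (rule exp_ge_add_one_self)
  moreover have "exp (- x) \<le> 1 - x + x\<^sup>2" using exp_le_quadratic[of "- x"] x by simp
  moreover have "x\<^sup>2 \<le> x" using x by (simp add: power2_eq_square mult_left_le)
  ultimately show ?thesis unfolding sinh_field_def by argo
qed

lemma sinh_le: "0 \<le> x \<Longrightarrow> x \<le> 1 \<Longrightarrow> sinh x \<le> 2 * x" for x :: real
proof -
  assume x: "0 \<le> x" "x \<le> 1"
  have "1 - x \<le> exp (- x)" using exp_ge_add_one_self[of "- x"] by simp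
  moreover have "exp x \<le> 1 + x + x\<^sup>2" using exp_le_quadratic[of x] x by simp
  moreover have "x\<^sup>2 \<le> x" using x by (simp add: power2_eq_square mult_left_le)
  ultimately show ?thesis using x unfolding sinh_field_def by argo
qed

text \<open>Size at the origin of a resolvent kernel with killing rate of order \<theta>^2: of order
  1/\<theta> for d = 1, logarithmic for d = 2. For d \<ge> 3 the true kernel is bounded, but a
  logarithm leaves the exponents unchanged. The constant 2d / ln 16 is the inverse of the value at 0
  of the generator of ln (1 + a^2 + b^2), in two coordinates a and b.\<close>

definition green_bound :: "nat \<Rightarrow> real \<Rightarrow> real" where
  "green_bound d \<theta> = (if d = 1 then 2 / \<theta> else 2 * real d / ln 16 * ln (1 + 1 / \<theta>\<^sup>2))"

lemma green_bound_pos: "0 < d \<Longrightarrow> 0 < \<theta> \<Longrightarrow> 0 < green_bound d \<theta>"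
  by (auto simp: green_bound_def intro!: divide_pos_pos mult_pos_pos ln_gt_zero)

text \<open>
  In dimension \<open>d \<ge> 2\<close> the first two coordinates suffice for the local behaviour, where the
  logarithmic kernel replaces the bound \<open>2 / \<theta>\<close> by a logarithm; far away it is cut off by taking the
  minimum with the exponential, as a minimum of supersolutions is one.
\<close>

lemma resolvent_supersolution:
  assumes \<theta>: "0 < \<theta>" "\<theta> \<le> 1"
  obtains g :: "int ^ 'd \<Rightarrow> real" where
    "\<And>x. 0 \<le> g x" "\<And>x. g x \<le> green_bound CARD('d) \<theta> * expdec \<theta> x"
    "\<And>x. gen g x \<le> \<theta>\<^sup>2 * g x - of_bool (x = 0)"
proof -
  have ch: "cosh \<theta> - 1 \<le> \<theta>\<^sup>2" using cosh_le_square[of \<theta>] \<theta> by simp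
  have E: "gen (expdec \<theta>) x \<le> \<theta>\<^sup>2 * expdec \<theta> x" for x :: "int ^ 'd"
    by (rule order_trans[OF expdec_supersolution mult_right_mono[OF ch less_imp_le[OF expdec_pos]]])
      (use \<theta> in simp)
  show ?thesis
  proof (cases "CARD('d) = 1")
    case True
    have sh: "\<theta> / 2 \<le> sinh \<theta>" "0 < sinh \<theta>" using sinh_ge[of \<theta>] \<theta> by auto
    \<comment> \<open>Since exp (-\<theta>) - 1 = (cosh \<theta> - 1) - sinh \<theta>, the function
      \<open>expdec\<close> has, relative to its eigenvalue cosh \<theta> - 1, a source of mass sinh
      \<theta> at 0; it is normalised to 1.\<close>
    define g where "g x = inverse (sinh \<theta>) * expdec \<theta> x" for x :: "int ^ 'd"
    show ?thesis
    proof
      fix x :: "int ^ 'd"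
      show "0 \<le> g x" using sh by (simp add: g_def less_imp_le)
      have "inverse (sinh \<theta>) \<le> inverse (\<theta> / 2)" using sh \<theta> by (intro le_imp_inverse_le) auto
      then show "g x \<le> green_bound CARD('d) \<theta> * expdec \<theta> x"
        unfolding g_def green_bound_def using True by (intro mult_right_mono) (auto simp: less_imp_le inverse_eq_divide)
      show "gen g x \<le> \<theta>\<^sup>2 * g x - of_bool (x = 0)"
      proof (cases "x = 0")
        case True
        have "gen g 0 = inverse (sinh \<theta>) * (exp (- \<theta>) - 1)"
          unfolding g_def[abs_def] gen_cmult expdec_at_0 ..
        also have "exp (- \<theta>) - 1 = (cosh \<theta> - 1) - sinh \<theta>" by (simp add: cosh_def sinh_def field_simps)
        also have "inverse (sinh \<theta>) * \<dots> = inverse (sinh \<theta>) * (cosh \<theta> - 1) - 1"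
          using sh by (simp add: right_diff_distrib)
        also have "\<dots> \<le> inverse (sinh \<theta>) * \<theta>\<^sup>2 - 1" using sh ch by (intro diff_right_mono mult_left_mono) auto
        finally have "gen g 0 \<le> inverse (sinh \<theta>) * \<theta>\<^sup>2 - 1" .
        moreover have "g 0 = inverse (sinh \<theta>)" by (simp add: g_def)
        ultimately show ?thesis using True by (simp add: mult.commute)
      next
        case False
        then show ?thesis unfolding g_def[abs_def] gen_cmult
          using mult_left_mono[OF E[of x], of "inverse (sinh \<theta>)"] sh by (simp add: mult_ac)
      qed
    qed
  next
    case False
    have d2: "2 \<le> CARD('d)" using False zero_less_card_finite[where 'a = 'd] by linarith
    then obtain i j :: 'd where ij: "i \<noteq> j"
      by (metis (full_types) One_nat_def UNIV_I card_le_Suc0_iff_eq finite not_less_eq_eq numeral_2_eq_2)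
    \<comment> \<open>By \<theta>^2 K = 1 the bound 1/(r + K) on the generator of the larger
      logarithm becomes \<theta>^2 K/(r + K), and K/(r + K) \<le> ln (1 + K/r), which is the value
      of \<open>g1\<close>.\<close>
    define K where "K = 1 / \<theta>\<^sup>2"
    have K: "0 < K" using \<theta> by (simp add: K_def)
    define c where "c = ln 16 / (2 * real CARD('d))"
    have c: "0 < c" by (simp add: c_def)
    define q where "q c a b = c + (real_of_int a)\<^sup>2 + (real_of_int b)\<^sup>2" for c a b
    have q1: "1 \<le> q 1 a b" for a b by (simp add: q_def)
    have qK: "q (1 + K) a b = q 1 a b + K" for a b by (simp add: q_def)
    define g1 where "g1 x = ln (q (1 + K) (x $ i) (x $ j)) - ln (q 1 (x $ i) (x $ j))" for x
    \<comment> \<open>The two branches of the minimum agree at 0, so the exponential branch is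
      strictly smaller only away from the source.\<close>
    define B where "B = ln (1 + K) / c"
    have B0: "0 < B" using K c by (simp add: B_def)
    define g where "g x = min (1 / c * g1 x) (B * expdec \<theta> x)" for x
    have g1pos: "0 < g1 x" for x using K q1[of "x $ i" "x $ j"] by (simp add: g1_def qK)
    have gen_ln: "gen (\<lambda>x. ln (q c (x $ i) (x $ j))) x =
      (ln (q c (x $ i + 1) (x $ j)) + ln (q c (x $ i - 1) (x $ j)) + ln (q c (x $ i) (x $ j + 1))
        + ln (q c (x $ i) (x $ j - 1)) - 4 * ln (q c (x $ i) (x $ j))) / (2 * real CARD('d))" for c x
      by (rule gen_two_coords[OF ij, of "\<lambda>a b. ln (q c a b)"])
    have up: "gen (\<lambda>x. ln (q (1 + K) (x $ i) (x $ j))) x \<le> \<theta>\<^sup>2 * g1 x" for x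
    proof -
      define r where "r = q 1 (x $ i) (x $ j)"
      have r: "1 \<le> r" unfolding r_def by (rule q1)
      have "gen (\<lambda>x. ln (q (1 + K) (x $ i) (x $ j))) x \<le> 4 / (r + K) / (2 * real CARD('d))"
        unfolding gen_ln r_def qK[symmetric]
        using ln_laplacian_upper[of "1 + K" "real_of_int (x $ i)" "real_of_int (x $ j)"] K
        by (intro divide_right_mono) (auto simp: q_def)
      also have "\<dots> \<le> 4 / (r + K) / 4" using d2 r K by (intro divide_left_mono) auto
      also have "\<dots> = \<theta>\<^sup>2 * (K / (r + K))"
      proof -
        have *: "\<theta>\<^sup>2 * K = 1" using \<theta> by (simp add: K_def)
        have **: "4 / u / 4 = 1 / u" for u :: real by simp
        show ?thesis by (simp only: times_divide_eq_right * **)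
      qed
      also have "K / (r + K) \<le> g1 x"
      proof -
        have "ln (r / (r + K)) \<le> r / (r + K) - 1" using r K by (intro ln_le_minus_one) auto
        also have "\<dots> = - (K / (r + K))" using r K by (simp add: field_simps)
        also have "ln (r / (r + K)) = - g1 x" using r K by (simp add: g1_def qK r_def[symmetric] ln_div)
        finally show ?thesis by simp
      qed
      finally show ?thesis using \<theta> by (simp add: mult_left_mono)
    qed
    have low: "c * of_bool (x = 0) \<le> gen (\<lambda>x. ln (q 1 (x $ i) (x $ j))) x" for x
    proof (cases "x = 0")
      case True
      have "ln (16 :: real) = 4 * ln 2" using ln_realpow[of 2 4] by simp
      then show ?thesis unfolding gen_ln by (simp add: True q_def c_def)
    next
      case False
      then show ?thesis unfolding gen_ln
        using ln_laplacian_lower[of "real_of_int (x $ i)" "real_of_int (x $ j)"] by (simp add: q_def)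
    qed
    have gg1: "gen (\<lambda>x. 1 / c * g1 x) x \<le> \<theta>\<^sup>2 * (1 / c * g1 x) - of_bool (x = 0)" for x
    proof -
      have "gen g1 x = gen (\<lambda>x. ln (q (1 + K) (x $ i) (x $ j))) x - gen (\<lambda>x. ln (q 1 (x $ i) (x $ j))) x"
        using gen_add[of "\<lambda>x. ln (q (1 + K) (x $ i) (x $ j))" "\<lambda>x. (- 1) * ln (q 1 (x $ i) (x $ j))" x]
        unfolding gen_cmult by (simp add: g1_def[abs_def])
      also have "\<dots> \<le> \<theta>\<^sup>2 * g1 x - c * of_bool (x = 0)" by (intro diff_mono up low)
      finally have "1 / c * gen g1 x \<le> 1 / c * (\<theta>\<^sup>2 * g1 x - c * of_bool (x = 0))"
        using c by (intro mult_left_mono) auto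
      also have "\<dots> = \<theta>\<^sup>2 * (1 / c * g1 x) - of_bool (x = 0)" using c by (simp add: field_simps)
      finally show ?thesis unfolding gen_cmult .
    qed
    have gE: "gen (\<lambda>x. B * expdec \<theta> x) x \<le> \<theta>\<^sup>2 * (B * expdec \<theta> x)" for x :: "int ^ 'd"
      unfolding gen_cmult using mult_left_mono[OF E[of x], of B] B0 by (simp add: mult_ac)
    show ?thesis
    proof
      fix x :: "int ^ 'd"
      show "0 \<le> g x" using g1pos[of x] c B0 by (simp add: g_def less_imp_le)
      have "B = green_bound CARD('d) \<theta>" using False by (simp add: B_def c_def green_bound_def K_def)
      then show "g x \<le> green_bound CARD('d) \<theta> * expdec \<theta> x" by (simp add: g_def)
      show "gen g x \<le> \<theta>\<^sup>2 * g x - of_bool (x = 0)"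
      proof (cases "1 / c * g1 x \<le> B * expdec \<theta> x")
        case True
        then have "g x = 1 / c * g1 x" by (simp add: g_def)
        with gen_min_le[of "\<lambda>x. 1 / c * g1 x" x "\<lambda>x. B * expdec \<theta> x", OF True] gg1[of x] show ?thesis by (simp add: g_def[abs_def])
      next
        case ne: False
        then have "g x = B * expdec \<theta> x" by (simp add: g_def)
        moreover have "x \<noteq> 0"
        proof
          assume "x = 0"
          then have "g1 x = ln (1 + K)" by (simp add: g1_def q_def)
          with ne \<open>x = 0\<close> show False by (simp add: B_def)
        qed
        moreover have "gen g x \<le> gen (\<lambda>x. B * expdec \<theta> x) x"
          unfolding g_def[abs_def] by (rule gen_min_le') (use ne in simp)
        ultimately show ?thesis using gE[of x] by simp
      qed
    qed
  qed
qed


subsection \<open>Exponential bounds\<close>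

lemma gen_uminus: "gen (\<lambda>x. - f x) x = - gen f x"
  using gen_cmult[of "- 1" f x] by simp

context walk
begin

lemma FK_integrable:
  assumes "0 \<le> a" "0 \<le> t" and f: "\<And>x. \<bar>f x\<bar> \<le> B" and V: "\<And>x. \<bar>V x\<bar> \<le> v"
  shows "integrable Q (\<lambda>\<omega>. of_bool (S a \<omega> = x) * exp (occ V a (a + t) \<omega>) * f (S (a + t) \<omega>))"
proof (rule Q.integrable_const_bound[where B = "exp (v * t) * B"])
  have [measurable]: "S a \<in> measurable Q (count_space UNIV)" "S (a + t) \<in> measurable Q (count_space UNIV)"
    "occ V a (a + t) \<in> borel_measurable Q"
    using assms by (auto intro!: S_measurable occ_measurable)
  have [measurable]: "(g :: int ^ 'd \<Rightarrow> real) \<in> borel_measurable (count_space UNIV)" for g by simp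
  show "(\<lambda>\<omega>. of_bool (S a \<omega> = x) * exp (occ V a (a + t) \<omega>) * f (S (a + t) \<omega>)) \<in> borel_measurable Q"
    by measurable
  show "AE \<omega> in Q. norm (of_bool (S a \<omega> = x) * exp (occ V a (a + t) \<omega>) * f (S (a + t) \<omega>)) \<le> exp (v * t) * B"
  proof (rule AE_I2)
    fix \<omega> assume "\<omega> \<in> space Q"
    then have "occ V a (a + t) \<omega> \<le> occ (\<lambda>_. v) a (a + t) \<omega>"
      by (rule occ_mono) (use assms V in \<open>auto simp: abs_le_iff\<close>)
    also have "\<dots> = v * t" using assms by (simp add: occ_const)
    finally have "of_bool (S a \<omega> = x) * exp (occ V a (a + t) \<omega>) * \<bar>f (S (a + t) \<omega>)\<bar> \<le> 1 * exp (v * t) * B"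
      using f by (intro mult_mono) auto
    then show "norm (of_bool (S a \<omega> = x) * exp (occ V a (a + t) \<omega>) * f (S (a + t) \<omega>)) \<le> exp (v * t) * B"
      by (simp add: abs_mult)
  qed
qed

lemma FK_event [measurable]:
  assumes "0 \<le> a" "0 \<le> b"
  shows "{\<omega> \<in> space Q. S a \<omega> = x \<and> \<tau> \<le> occ V b c \<omega>} \<in> sets Q"
proof -
  have [measurable]: "S a \<in> measurable Q (count_space UNIV)" "occ V b c \<in> borel_measurable Q"
    using assms by (auto intro!: S_measurable occ_measurable)
  show ?thesis by measurable
qed

lemma occ_event [measurable]:
  assumes "0 \<le> b"
  shows "{\<omega> \<in> space Q. \<tau> \<le> occ V b c \<omega>} \<in> sets Q"
  using occ_measurable[OF assms, of V c] by measurable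

lemma pmf_0: "pmf (p 0 0) 0 = 1" by (simp add: p_0)

text \<open>Exponential Markov inequality at rate 1/(2 G D), where G is the Green bound: the
  supersolution lies between 1 and 2, so its final value may be dropped and its initial value gives
  the factor 2. D measures how much the exponential profiles around the sites of H overlap.\<close>

lemma occupation_tail:
  assumes "0 < \<theta>" "\<theta> \<le> 1" "0 < t" "finite H" "0 < D"
    and D: "\<And>x. (\<Sum>y\<in>H. expdec \<theta> (x - y)) \<le> D"
  shows "Q.prob {\<omega> \<in> space Q. \<tau> \<le> occ (indicator H) 0 t \<omega>}
    \<le> 2 * exp (\<theta>\<^sup>2 * t - \<tau> / (2 * green_bound CARD('d) \<theta> * D))"
proof -
  define G where "G = green_bound CARD('d) \<theta>"
  have G: "0 < G" using assms by (simp add: G_def green_bound_pos)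
  obtain g :: "int ^ 'd \<Rightarrow> real" where g: "\<And>x. 0 \<le> g x" "\<And>x. g x \<le> G * expdec \<theta> x"
    "\<And>x. gen g x \<le> \<theta>\<^sup>2 * g x - of_bool (x = 0)"
    by (rule resolvent_supersolution[where 'd = 'd, OF assms(1,2), folded G_def]) (rule that)
  define a where "a = 1 / (G * D)"
  have a: "0 < a" "a * (G * D) = 1" using G assms by (simp_all add: a_def)
  define f where "f x = 1 + a * (\<Sum>y\<in>H. g (x - y))" for x
  have f1: "1 \<le> f x" for x using g a by (simp add: f_def sum_nonneg)
  have f2: "f x \<le> 2" for x
  proof -
    have "(\<Sum>y\<in>H. g (x - y)) \<le> (\<Sum>y\<in>H. G * expdec \<theta> (x - y))" by (rule sum_mono) (rule g)
    also have "\<dots> \<le> G * D" using D[of x] G by (simp add: sum_distrib_left[symmetric])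
    finally have "a * (\<Sum>y\<in>H. g (x - y)) \<le> a * (G * D)" using a by (intro mult_left_mono) auto
    then show ?thesis using a by (simp add: f_def)
  qed
  define lam where "lam = a / 2"
  have lam: "0 < lam" using a by (simp add: lam_def)
  define V where "V x = lam * indicator H x" for x
  have gen: "gen f x + V x * f x \<le> \<theta>\<^sup>2 * f x" for x
  proof -
    have "gen f x = a * (\<Sum>y\<in>H. gen g (x - y))"
      using gen_add[of "\<lambda>_. 1" "\<lambda>x. a * (\<Sum>y\<in>H. g (x - y))" x]
      by (simp add: f_def[abs_def] gen_cmult gen_sum gen_shift)
    also have "\<dots> \<le> a * (\<Sum>y\<in>H. \<theta>\<^sup>2 * g (x - y) - of_bool (x - y = 0))"
      using a by (intro mult_left_mono sum_mono g(3)) auto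
    also have "(\<Sum>y\<in>H. \<theta>\<^sup>2 * g (x - y) - of_bool (x - y = 0)) = \<theta>\<^sup>2 * (\<Sum>y\<in>H. g (x - y)) - indicator H x"
    proof -
      have "(\<Sum>y\<in>H. of_bool (x - y = 0)) = (\<Sum>y\<in>H. if y = x then 1 else (0::real))"
        by (rule sum.cong) auto
      also have "\<dots> = indicator H x" using assms by (simp add: indicator_def)
      finally show ?thesis by (simp add: sum_subtractf sum_distrib_left)
    qed
    also have "a * \<dots> = \<theta>\<^sup>2 * (f x - 1) - a * indicator H x" by (simp add: f_def algebra_simps)
    finally have "gen f x \<le> \<theta>\<^sup>2 * (f x - 1) - a * indicator H x" .
    moreover have "V x * f x \<le> a * indicator H x"
      using f2[of x] a by (auto simp: V_def lam_def indicator_def)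
    moreover have "\<theta>\<^sup>2 * (f x - 1) \<le> \<theta>\<^sup>2 * f x" by (simp add: mult_left_mono)
    ultimately show ?thesis by linarith
  qed
  have fB: "\<bar>f x\<bar> \<le> 2" for x using f1[of x] f2[of x] by linarith
  have VB: "\<bar>V x\<bar> \<le> lam" for x using lam by (auto simp: V_def indicator_def)
  define A where "A = {\<omega> \<in> space Q. S 0 \<omega> = 0 \<and> \<tau> \<le> occ (indicator H) 0 t \<omega>}"
  have A: "A \<in> sets Q" unfolding A_def by (rule FK_event) auto
  have occV: "occ V 0 (0 + t) \<omega> = lam * occ (indicator H) 0 t \<omega>" for \<omega>
    unfolding V_def[abs_def] occ_cmult by simp
  have "exp (lam * \<tau>) * Q.prob A = (LINT \<omega>|Q. exp (lam * \<tau>) * indicator A \<omega>)" using A by simp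
  also have "\<dots> \<le> (LINT \<omega>|Q. of_bool (S 0 \<omega> = 0) * exp (occ V 0 (0 + t) \<omega>) * f (S (0 + t) \<omega>))"
  proof (rule integral_mono)
    show "integrable Q (\<lambda>\<omega>. exp (lam * \<tau>) * indicator A \<omega>)" using A by (simp add: Q.emeasure_eq_measure)
    show "integrable Q (\<lambda>\<omega>. of_bool (S 0 \<omega> = 0) * exp (occ V 0 (0 + t) \<omega>) * f (S (0 + t) \<omega>))"
      by (rule FK_integrable[where f = f and V = V, OF _ _ fB VB]) (use assms in auto)
    fix \<omega>
    have "exp (lam * \<tau>) * 1 \<le> exp (lam * occ (indicator H) 0 t \<omega>) * f (S (0 + t) \<omega>)" if "\<omega> \<in> A"
      using that lam f1 by (intro mult_mono) (auto simp: A_def)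
    moreover have "0 \<le> f x" for x using f1[of x] by linarith
    ultimately show "exp (lam * \<tau>) * indicator A \<omega> \<le> of_bool (S 0 \<omega> = 0) * exp (occ V 0 (0 + t) \<omega>) * f (S (0 + t) \<omega>)"
      unfolding occV by (auto simp: indicator_def A_def)
  qed
  also have "\<dots> \<le> pmf (p 0 0) 0 * exp (\<theta>\<^sup>2 * t) * f 0"
    by (rule Feynman_Kac_le[where f = f and V = V, OF _ \<open>0 < t\<close> fB VB gen]) simp
  also have "\<dots> \<le> exp (\<theta>\<^sup>2 * t) * 2" using f2[of 0] by (simp add: pmf_0)
  finally have "Q.prob A \<le> 2 * exp (\<theta>\<^sup>2 * t) / exp (lam * \<tau>)" by (simp add: field_simps)
  also have "\<dots> = 2 * exp (\<theta>\<^sup>2 * t - \<tau> / (2 * G * D))"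
    by (simp add: exp_diff lam_def a_def)
  \<comment> \<open>The Feynman--Kac bound fixes the initial position, which equals 0 only almost
    surely.\<close>
  also have "Q.prob A = Q.prob {\<omega> \<in> space Q. \<tau> \<le> occ (indicator H) 0 t \<omega>}"
  proof (rule Q.finite_measure_eq_AE)
    have "AE \<omega> in Q. S 0 \<omega> = 0"
    proof -
      have "{\<omega> \<in> space Q. S 0 \<omega> = 0} \<in> sets Q" using S_measurable[of 0] by simp
      then show ?thesis using prob_S_eq[of 0 0] pmf_0 by (subst Q.prob_Collect_eq_1[symmetric]) auto
    qed
    then show "AE \<omega> in Q. (\<omega> \<in> A) = (\<omega> \<in> {\<omega> \<in> space Q. \<tau> \<le> occ (indicator H) 0 t \<omega>})"
      by eventually_elim (simp add: A_def)
  qed (use A in auto)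
  finally show ?thesis by (simp add: G_def)
qed

text \<open>With f equal to -1 at x and 0 elsewhere, the generator inequality holds at rate -1,
  because the walk leaves x at rate 1. This bounds from below the mean of exp (-4 (time away from
  x)) over paths that are at x at both ends. Those away for more than half of the time have weight
  at most exp (-2t), which is at most half of exp (-t) when t \<ge> 1.\<close>

lemma stay_prob:
  assumes "0 \<le> a" "1 \<le> t"
  shows "pmf (p a 0) x * exp (- t) / 2 \<le> Q.prob {\<omega> \<in> space Q. S a \<omega> = x \<and> t / 2 \<le> occ (indicator {x}) a (a + t) \<omega>}"
    (is "_ \<le> Q.prob ?A")
proof -
  define f :: "int ^ 'd \<Rightarrow> real" where "f y = - of_bool (y = x)" for y
  define V :: "int ^ 'd \<Rightarrow> real" where "V y = (-4) * of_bool (y \<noteq> x)" for y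
  have fB: "\<bar>f y\<bar> \<le> 1" for y by (simp add: f_def)
  have VB: "\<bar>V y\<bar> \<le> 4" for y by (simp add: V_def)
  have gen: "gen f y + V y * f y \<le> (-1) * f y" for y
  proof -
    have "(\<Sum>k\<in>UNIV. f (y + unit k)) \<le> 0" by (rule sum_nonpos) (simp add: f_def)
    then have "gen f y \<le> - f y" by (simp add: gen_unit divide_nonpos_pos)
    moreover have "V y * f y = 0" by (simp add: V_def f_def)
    ultimately show ?thesis by linarith
  qed
  have A: "?A \<in> sets Q" by (rule FK_event) (use assms in auto)
  have B: "{\<omega> \<in> space Q. S a \<omega> = x} \<in> sets Q" using S_measurable[OF assms(1)] by simp
  have PB: "(LINT \<omega>|Q. of_bool (S a \<omega> = x)) = pmf (p a 0) x"
  proof -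
    have "(LINT \<omega>|Q. of_bool (S a \<omega> = x) :: real) = (LINT \<omega>|Q. indicator {\<omega> \<in> space Q. S a \<omega> = x} \<omega>)"
      by (rule Bochner_Integration.integral_cong) (auto simp: indicator_def)
    then show ?thesis using B prob_S_eq[OF assms(1), of x] by simp
  qed
  have iB: "integrable Q (\<lambda>\<omega>. of_bool (S a \<omega> = x) :: real)"
  proof -
    have "integrable Q (indicat_real {\<omega> \<in> space Q. S a \<omega> = x})" using B by (simp add: Q.emeasure_eq_measure)
    then show ?thesis by (rule Bochner_Integration.integrable_cong[THEN iffD1, rotated 2]) (auto simp: indicator_def)
  qed
  have iA: "integrable Q (indicat_real ?A)" using A by (simp add: Q.emeasure_eq_measure)
  have FKi: "integrable Q (\<lambda>\<omega>. of_bool (S a \<omega> = x) * exp (occ V a (a + t) \<omega>) * f (S (a + t) \<omega>))"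
    by (rule FK_integrable[where f = f and V = V, OF _ _ fB VB]) (use assms in auto)
  have "(LINT \<omega>|Q. of_bool (S a \<omega> = x) * exp (occ V a (a + t) \<omega>) * f (S (a + t) \<omega>))
      \<le> pmf (p a 0) x * exp ((-1) * t) * f x"
    by (rule Feynman_Kac_le[where f = f and V = V, OF _ _ fB VB gen]) (use assms in auto)
  moreover have "(LINT \<omega>|Q. - (indicator ?A \<omega> + exp (- 2 * t) * of_bool (S a \<omega> = x)))
      \<le> (LINT \<omega>|Q. of_bool (S a \<omega> = x) * exp (occ V a (a + t) \<omega>) * f (S (a + t) \<omega>))"
  proof (rule integral_mono[OF _ FKi])
    show "integrable Q (\<lambda>\<omega>. - (indicator ?A \<omega> + exp (- 2 * t) * of_bool (S a \<omega> = x)))" using iA iB by simp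
    fix \<omega> assume \<omega>: "\<omega> \<in> space Q"
    have "(\<lambda>y. indicator {x} y + of_bool (y \<noteq> x)) = (\<lambda>_ :: int ^ 'd. 1 :: real)" by (auto simp: fun_eq_iff)
    then have sum: "occ (indicator {x}) a (a + t) \<omega> + occ (\<lambda>y. of_bool (y \<noteq> x)) a (a + t) \<omega> = t"
      using occ_add[OF \<omega> assms(1), of "indicator {x}" "\<lambda>y. of_bool (y \<noteq> x)" "a + t"] occ_const[of a "a + t" 1 \<omega>] assms
      by simp
    have occV: "occ V a (a + t) \<omega> = (-4) * occ (\<lambda>y. of_bool (y \<noteq> x)) a (a + t) \<omega>"
      unfolding V_def[abs_def] occ_cmult ..
    have n0: "0 \<le> occ (\<lambda>y. of_bool (y \<noteq> x)) a (a + t) \<omega>" by (rule occ_nonneg) simp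
    have hx: "exp (occ V a (a + t) \<omega>) * 1 \<le> indicator ?A \<omega> + exp (- 2 * t)" if "S a \<omega> = x"
    proof (cases "\<omega> \<in> ?A")
      case True
      have "exp (occ V a (a + t) \<omega>) \<le> 1" using occV n0 by simp
      then show ?thesis using True by (simp add: add_increasing2)
    next
      case False
      then have "occ (indicator {x}) a (a + t) \<omega> < t / 2" using that \<omega> by auto
      then have "occ V a (a + t) \<omega> \<le> - 2 * t" using sum occV by linarith
      then show ?thesis using False by simp
    qed
    have i0: "- (indicat_real ?A \<omega> + exp (- 2 * t) * of_bool (S a \<omega> = x)) \<le> 0"
      unfolding neg_le_0_iff_le by (intro add_nonneg_nonneg) auto
    show "- (indicator ?A \<omega> + exp (- 2 * t) * of_bool (S a \<omega> = x)) \<le>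
        of_bool (S a \<omega> = x) * exp (occ V a (a + t) \<omega>) * f (S (a + t) \<omega>)"
    proof (cases "S a \<omega> = x \<and> S (a + t) \<omega> = x")
      case True
      then show ?thesis using hx by (simp add: f_def)
    next
      case False
      then have z: "of_bool (S a \<omega> = x) * exp (occ V a (a + t) \<omega>) * f (S (a + t) \<omega>) = 0" by (auto simp: f_def)
      show ?thesis unfolding z by (rule i0)
    qed
  qed
  ultimately have "- (Q.prob ?A + exp (- 2 * t) * pmf (p a 0) x) \<le> - (pmf (p a 0) x * exp (- t))"
    using iA iB A PB by (simp add: f_def)
  moreover have "exp (- 2 * t) * pmf (p a 0) x \<le> exp (- t) / 2 * pmf (p a 0) x"
  proof (rule mult_right_mono)
    have "exp (- t) \<le> exp (- 1)" using assms by simp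
    also have "exp (- 1 :: real) \<le> 1 / 2" using exp_ge_add_one_self[of 1] by (simp add: exp_minus field_simps)
    finally have "exp (- t) * exp (- t) \<le> exp (- t) * (1 / 2)" by (intro mult_left_mono) auto
    then show "exp (- 2 * t) \<le> exp (- t) / 2" by (simp add: exp_add[symmetric])
  qed simp
  ultimately show ?thesis by (simp add: mult.commute)
qed


text \<open>
  A second moment argument: with \<open>L\<close> the occupation time, \<open>\<lambda> = sinh \<theta>\<close> and \<open>\<theta>\<close> of order \<open>\<tau> / t\<close>,
  the lower bound on the mean of \<open>exp (\<lambda> L)\<close> beats \<open>exp (\<lambda> \<tau>)\<close>, while the mean of its square is comparable.
\<close>

lemma local_time_lower:
  assumes d1: "CARD('d) = 1" and "0 \<le> a" "0 < t" and \<tau>: "sqrt t \<le> 8 * \<tau>" "128 * \<tau> \<le> t"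
  shows "pmf (p a 0) x * exp (- 16384 * \<tau>\<^sup>2 / t) / 2
    \<le> Q.prob {\<omega> \<in> space Q. S a \<omega> = x \<and> \<tau> \<le> occ (indicator {x}) a (a + t) \<omega>}"
    (is "_ \<le> Q.prob ?A")
proof -
  \<comment> \<open>From cosh \<theta> - 1 \<ge> \<theta>^2/8 it follows that k t \<ge> 128
    \<tau>^2/t, while lam \<tau> \<le> 2 \<theta> \<tau> = 64 \<tau>^2/t. The difference is at least
    1 by the first assumption on \<tau>; the second makes 4 \<theta> \<le> 1.\<close>
  define \<theta> where "\<theta> = 32 * \<tau> / t"
  have "0 < sqrt t" using \<open>0 < t\<close> by simp
  then have \<tau>0: "0 < \<tau>" using \<tau>(1) by linarith
  have \<theta>: "0 < \<theta>" "4 * \<theta> \<le> 1" using \<tau>0 \<tau>(2) \<open>0 < t\<close> by (auto simp: \<theta>_def pos_divide_le_eq)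
  define lam where "lam = sinh \<theta>"
  have lam: "0 < lam" "lam \<le> 2 * \<theta>" using sinh_ge[of \<theta>] sinh_le[of \<theta>] \<theta> by (auto simp: lam_def)
  have sinh4: "4 * lam \<le> sinh (4 * \<theta>)"
  proof -
    have db: "2 * sinh u \<le> sinh (2 * u)" if "0 \<le> u" for u :: real
    proof -
      have "sinh u * 1 \<le> sinh u * cosh u" using that cosh_real_ge_1[of u] by (intro mult_left_mono) auto
      then show ?thesis by (simp add: sinh_double)
    qed
    show ?thesis using db[of \<theta>] db[of "2 * \<theta>"] \<theta> by (simp add: lam_def)
  qed
  define P where "P = pmf (p a 0) x"
  define L where "L = occ (indicator {x}) a (a + t)"
  define k where "k = cosh \<theta> - 1"
  \<comment> \<open>For the square the rate is 2 lam. The profile 1 +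
    \<open>expdec (4 * \<theta>)\<close> has the value 2 at x, so its source must cover 4 lam, which
    is \<open>sinh4\<close>; it grows at rate at most (4\<theta>)^2. The product k' t is the 16384
    \<tau>^2/t of the claim.\<close>
  define k' where "k' = (4 * \<theta>)\<^sup>2"
  have k: "0 \<le> k" using cosh_real_ge_1[of \<theta>] by (simp add: k_def)
  have kt: "lam * \<tau> + 1 \<le> k * t"
  proof -
    have "cosh \<theta> = 2 * (sinh (\<theta> / 2))\<^sup>2 + 1"
      using cosh_double[of "\<theta> / 2"] cosh_square_eq[of "\<theta> / 2"] by simp
    moreover have "(\<theta> / 4)\<^sup>2 \<le> (sinh (\<theta> / 2))\<^sup>2" using sinh_ge[of "\<theta> / 2"] \<theta> by (intro power_mono) auto
    ultimately have "\<theta>\<^sup>2 / 8 \<le> k" by (simp add: k_def power_divide)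
    then have "\<theta>\<^sup>2 / 8 * t \<le> k * t" using \<open>0 < t\<close> by (intro mult_right_mono) auto
    moreover have "\<theta>\<^sup>2 / 8 * t = 128 * (\<tau>\<^sup>2 / t)" using \<open>0 < t\<close> by (simp add: \<theta>_def power2_eq_square)
    moreover have "lam * \<tau> \<le> 2 * \<theta> * \<tau>" using lam \<tau>0 by (intro mult_right_mono) auto
    moreover have "2 * \<theta> * \<tau> = 64 * (\<tau>\<^sup>2 / t)" by (simp add: \<theta>_def power2_eq_square)
    moreover have "1 \<le> 64 * (\<tau>\<^sup>2 / t)"
    proof -
      have "(sqrt t)\<^sup>2 \<le> (8 * \<tau>)\<^sup>2" using \<tau>(1) \<open>0 < t\<close> by (intro power_mono) auto
      then show ?thesis using \<open>0 < t\<close> by (simp add: power2_eq_square field_simps)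
    qed
    ultimately show ?thesis by linarith
  qed
  define e1 where "e1 \<omega> = of_bool (S a \<omega> = x) * exp (lam * L \<omega>)" for \<omega>
  define e2 where "e2 \<omega> = of_bool (S a \<omega> = x) * exp (2 * lam * L \<omega>)" for \<omega>
  have occV: "occ (\<lambda>y. c * indicator {x} y) a (a + t) \<omega> = c * L \<omega>" for c \<omega>
    by (simp add: occ_cmult L_def)
  have VB: "\<bar>c * indicator {x} y\<bar> \<le> c" if "0 \<le> c" for c :: real and y
    using that by (auto simp: indicator_def)
  have int1: "integrable Q (\<lambda>\<omega>. of_bool (S a \<omega> = x) * exp (c * L \<omega>))" if "0 \<le> c" for c
    using FK_integrable[where f = "\<lambda>_. 1" and V = "\<lambda>y. c * indicator {x} y" and B = 1 and v = c and a = a and t = t and x = x, OF _ _ _ VB[OF that]]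
      assms(2,3) by (simp add: occV)
  have i1: "integrable Q e1" unfolding e1_def by (rule int1) (use lam in simp)
  have i2: "integrable Q e2" unfolding e2_def by (rule int1) (use lam in simp)
  have E1: "P * exp (k * t) \<le> integral\<^sup>L Q e1"
  proof -
    define f where "f y = - expdec \<theta> (y - x)" for y :: "int ^ 'd"
    have fB: "\<bar>f y\<bar> \<le> 1" for y using expdec_le_1[of \<theta> "y - x"] \<theta> by (simp add: f_def less_imp_le)
    \<comment> \<open>Equality holds everywhere: lam = sinh \<theta> cancels the source of
      \<open>expdec\<close> at x exactly.\<close>
    have gen: "gen f y + lam * indicator {x} y * f y \<le> k * f y" for y
    proof (cases "y = x")
      case True
      have "gen f y = - (exp (- \<theta>) - 1)"
        unfolding f_def[abs_def] gen_uminus gen_shift True by (simp add: expdec_at_0)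
      then show ?thesis using True by (simp add: f_def k_def lam_def cosh_def sinh_def field_simps)
    next
      case False
      have "gen f y = - (k * expdec \<theta> (y - x))"
        unfolding f_def[abs_def] gen_uminus gen_shift k_def
        using False by (subst expdec_eigenfunction[OF d1]) auto
      then show ?thesis using False by (simp add: f_def)
    qed
    have "(LINT \<omega>|Q. of_bool (S a \<omega> = x) * exp (occ (\<lambda>y. lam * indicator {x} y) a (a + t) \<omega>) * f (S (a + t) \<omega>))
        \<le> pmf (p a 0) x * exp (k * t) * f x"
      by (rule Feynman_Kac_le[where f = f, OF _ _ fB VB gen]) (use assms lam in auto)
    also have "f x = - 1" by (simp add: f_def)
    finally have "(LINT \<omega>|Q. e1 \<omega> * f (S (a + t) \<omega>)) \<le> - (P * exp (k * t))"
      by (simp add: e1_def occV P_def)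
    moreover have "(LINT \<omega>|Q. - e1 \<omega>) \<le> (LINT \<omega>|Q. e1 \<omega> * f (S (a + t) \<omega>))"
    proof (rule integral_mono)
      show "integrable Q (\<lambda>\<omega>. - e1 \<omega>)" using i1 by simp
      show "integrable Q (\<lambda>\<omega>. e1 \<omega> * f (S (a + t) \<omega>))"
        using FK_integrable[where f = f and V = "\<lambda>y. lam * indicator {x} y" and a = a and t = t and x = x, OF _ _ fB VB] assms(2,3) lam
        by (simp add: occV e1_def)
      fix \<omega>
      have "e1 \<omega> * (- 1) \<le> e1 \<omega> * f (S (a + t) \<omega>)"
        using fB[of "S (a + t) \<omega>"] by (intro mult_left_mono) (auto simp: e1_def)
      then show "- e1 \<omega> \<le> e1 \<omega> * f (S (a + t) \<omega>)" by simp
    qed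
    ultimately show ?thesis using i1 by simp
  qed
  have E2: "integral\<^sup>L Q e2 \<le> 2 * P * exp (k' * t)"
  proof -
    define f where "f y = 1 + expdec (4 * \<theta>) (y - x)" for y :: "int ^ 'd"
    have f1: "1 \<le> f y" "f y \<le> 2" for y using expdec_le_1[of "4 * \<theta>" "y - x"] \<theta> by (simp_all add: f_def less_imp_le)
    have fB: "\<bar>f y\<bar> \<le> 2" for y using f1[of y] by linarith
    have ch: "cosh (4 * \<theta>) - 1 \<le> k'" using cosh_le_square[of "4 * \<theta>"] \<theta> by (simp add: k'_def)
    have genf: "gen f y = gen (expdec (4 * \<theta>)) (y - x)" for y
      unfolding f_def[abs_def] gen_add gen_shift by simp
    have gen: "gen f y + 2 * lam * indicator {x} y * f y \<le> k' * f y" for y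
    proof (cases "y = x")
      case True
      have "exp (- (4 * \<theta>)) - 1 = cosh (4 * \<theta>) - 1 - sinh (4 * \<theta>)" by (simp add: cosh_def sinh_def field_simps)
      then have "gen f y = cosh (4 * \<theta>) - 1 - sinh (4 * \<theta>)" using True by (simp add: genf expdec_at_0)
      moreover have "f y = 2" using True by (simp add: f_def)
      moreover have "0 \<le> k'" by (simp add: k'_def)
      ultimately show ?thesis using True ch sinh4 by simp
    next
      case False
      have "gen f y = (cosh (4 * \<theta>) - 1) * expdec (4 * \<theta>) (y - x)"
        unfolding genf using False by (intro expdec_eigenfunction[OF d1]) auto
      also have "\<dots> \<le> k' * expdec (4 * \<theta>) (y - x)" using ch by (intro mult_right_mono) (auto simp: less_imp_le)
      also have "\<dots> \<le> k' * f y" by (intro mult_left_mono) (auto simp: f_def k'_def)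
      finally show ?thesis using False by simp
    qed
    have "integral\<^sup>L Q e2 \<le> (LINT \<omega>|Q. e2 \<omega> * f (S (a + t) \<omega>))"
    proof (rule integral_mono[OF i2])
      show "integrable Q (\<lambda>\<omega>. e2 \<omega> * f (S (a + t) \<omega>))"
        using FK_integrable[where f = f and V = "\<lambda>y. 2 * lam * indicator {x} y" and a = a and t = t and x = x, OF _ _ fB VB] assms(2,3) lam
        by (simp add: occV e2_def)
      fix \<omega>
      have "e2 \<omega> * 1 \<le> e2 \<omega> * f (S (a + t) \<omega>)" using f1 by (intro mult_left_mono) (auto simp: e2_def)
      then show "e2 \<omega> \<le> e2 \<omega> * f (S (a + t) \<omega>)" by simp
    qed
    also have "\<dots> = (LINT \<omega>|Q. of_bool (S a \<omega> = x) * exp (occ (\<lambda>y. 2 * lam * indicator {x} y) a (a + t) \<omega>) * f (S (a + t) \<omega>))"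
      unfolding occV e2_def ..
    also have "\<dots> \<le> pmf (p a 0) x * exp (k' * t) * f x"
      by (rule Feynman_Kac_le[where f = f, OF _ _ fB VB gen]) (use assms lam in auto)
    also have "f x = 2" by (simp add: f_def)
    finally show ?thesis by (simp add: P_def)
  qed
  have A: "?A \<in> sets Q" by (rule FK_event) (use assms in auto)
  have iA: "integrable Q (indicat_real ?A)" using A by (simp add: Q.emeasure_eq_measure)
  have iB: "integrable Q (\<lambda>\<omega>. of_bool (S a \<omega> = x) :: real)" using int1[of 0] by simp
  have PB: "(LINT \<omega>|Q. of_bool (S a \<omega> = x)) = P"
  proof -
    have "{\<omega> \<in> space Q. S a \<omega> = x} \<in> sets Q" using S_measurable[OF assms(2)] by simp
    moreover have "(LINT \<omega>|Q. of_bool (S a \<omega> = x) :: real) = (LINT \<omega>|Q. indicator {\<omega> \<in> space Q. S a \<omega> = x} \<omega>)"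
      by (rule Bochner_Integration.integral_cong) (auto simp: indicator_def)
    ultimately show ?thesis using prob_S_eq[OF assms(2), of x] by (simp add: P_def)
  qed
  \<comment> \<open>The inequality 2u \<le> s u^2 + 1/s replaces Cauchy--Schwarz; this s makes the
    second moment contribute at most P/2.\<close>
  define s where "s = exp (- k' * t) / 2"
  have s: "0 < s" by (simp add: s_def)
  have "integral\<^sup>L Q e1 \<le> (LINT \<omega>|Q. exp (lam * \<tau>) * of_bool (S a \<omega> = x) + (s / 2 * e2 \<omega> + 1 / (2 * s) * indicator ?A \<omega>))"
  proof (rule integral_mono[OF i1])
    show "integrable Q (\<lambda>\<omega>. exp (lam * \<tau>) * of_bool (S a \<omega> = x) + (s / 2 * e2 \<omega> + 1 / (2 * s) * indicator ?A \<omega>))"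
      using iA iB i2 by simp
    fix \<omega> assume \<omega>: "\<omega> \<in> space Q"
    show "e1 \<omega> \<le> exp (lam * \<tau>) * of_bool (S a \<omega> = x) + (s / 2 * e2 \<omega> + 1 / (2 * s) * indicator ?A \<omega>)"
    proof (cases "S a \<omega> = x")
      case Sx: True
      define u where "u = exp (lam * L \<omega>)"
      have e: "e1 \<omega> = u" "e2 \<omega> = u * u" using Sx by (simp_all add: e1_def e2_def u_def exp_add[symmetric])
      show ?thesis
      proof (cases "\<tau> \<le> L \<omega>")
        case True
        then have "\<omega> \<in> ?A" using \<omega> Sx by (simp add: L_def)
        have "2 * u \<le> s * (u * u) + 1 / s"
        proof -
          have "0 \<le> (s * u - 1) * (s * u - 1)" by simp
          then have "2 * u * s \<le> s * (u * u) * s + 1" by (simp add: algebra_simps)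
          then have "2 * u * s / s \<le> (s * (u * u) * s + 1) / s" using s by (intro divide_right_mono) auto
          then show ?thesis using s by (simp add: add_divide_distrib)
        qed
        then have "u \<le> s / 2 * (u * u) + 1 / (2 * s)" by simp
        then show ?thesis using \<open>\<omega> \<in> ?A\<close> Sx unfolding e by (simp add: add_increasing)
      next
        case False
        then have "\<omega> \<notin> ?A" by (simp add: L_def)
        have "u \<le> exp (lam * \<tau>)" using False lam by (simp add: u_def)
        moreover have "0 \<le> s / 2 * (u * u)" using s by simp
        ultimately show ?thesis using \<open>\<omega> \<notin> ?A\<close> Sx unfolding e by simp
      qed
    qed (use s in \<open>simp add: e1_def e2_def\<close>)
  qed
  also have "\<dots> = exp (lam * \<tau>) * P + (s / 2 * integral\<^sup>L Q e2 + 1 / (2 * s) * Q.prob ?A)"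
    using iA iB i2 A PB by simp
  also have "s / 2 * integral\<^sup>L Q e2 \<le> s / 2 * (2 * P * exp (k' * t))" using E2 s by (intro mult_left_mono) auto
  also have "\<dots> = P / 2" by (simp add: s_def exp_minus)
  finally have main: "P * exp (k * t) \<le> exp (lam * \<tau>) * P + (P / 2 + 1 / (2 * s) * Q.prob ?A)" using E1 by simp
  have "exp (lam * \<tau>) + 1 \<le> exp (k * t)"
  proof -
    have "exp (lam * \<tau>) + 1 \<le> exp (lam * \<tau>) + exp (lam * \<tau>)" using lam \<tau>0 by simp
    also have "\<dots> = exp (lam * \<tau>) * 2" by simp
    also have "\<dots> \<le> exp (lam * \<tau>) * exp 1" using exp_ge_add_one_self[of 1] by (intro mult_left_mono) auto
    also have "\<dots> = exp (lam * \<tau> + 1)" by (simp add: exp_add)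
    also have "\<dots> \<le> exp (k * t)" using kt by simp
    finally show ?thesis .
  qed
  then have "P * (exp (lam * \<tau>) + 1) \<le> P * exp (k * t)" by (intro mult_left_mono) (auto simp: P_def)
  with main have "P / 2 \<le> 1 / (2 * s) * Q.prob ?A" by (simp add: algebra_simps)
  then have "P * s \<le> Q.prob ?A" using s by (simp add: field_simps)
  moreover have "k' * t = 16384 * \<tau>\<^sup>2 / t" using \<open>0 < t\<close> by (simp add: k'_def \<theta>_def power2_eq_square)
  ultimately show ?thesis by (simp add: P_def s_def)
qed

subsection \<open>First moments\<close>

lemma nn_integral_occ:
  assumes f: "\<And>x. 0 \<le> f x" and "0 \<le> t"
  shows "(\<integral>\<^sup>+ \<omega>. ennreal (occ f 0 t \<omega>) \<partial>Q) =
    (\<integral>\<^sup>+ u. indicator {0..t} u * (\<integral>\<^sup>+ y. ennreal (f y) \<partial>measure_pmf (p (max 0 u) 0)) \<partial>lborel)"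
proof -
  interpret LQ: pair_sigma_finite lborel Q ..
  have jm: "(\<lambda>(u, \<omega>). f (S (max 0 u) \<omega>)) \<in> borel_measurable (lborel \<Otimes>\<^sub>M Q)"
    using joint_measurable[of f] by simp
  have m: "(\<lambda>(u, \<omega>). indicator {0..t} u * ennreal (f (S (max 0 u) \<omega>))) \<in> borel_measurable (lborel \<Otimes>\<^sub>M Q)"
    using jm unfolding case_prod_unfold by measurable
  have "(\<integral>\<^sup>+ \<omega>. ennreal (occ f 0 t \<omega>) \<partial>Q) = (\<integral>\<^sup>+ \<omega>. (\<integral>\<^sup>+ u. indicator {0..t} u * ennreal (f (S (max 0 u) \<omega>)) \<partial>lborel) \<partial>Q)"
  proof (rule nn_integral_cong)
    fix \<omega> assume "\<omega> \<in> space Q"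
    then have "integrable lborel (\<lambda>u. indicator {0..t} u *\<^sub>R f (S (max 0 u) \<omega>))"
      using path_integrable_max[of \<omega> 0 t f] by (simp add: set_integrable_def)
    then have "(\<integral>\<^sup>+ u. ennreal (indicator {0..t} u *\<^sub>R f (S (max 0 u) \<omega>)) \<partial>lborel) = ennreal (occ f 0 t \<omega>)"
      unfolding occ_max[OF order_refl] set_lebesgue_integral_def by (rule nn_integral_eq_integral) (use f in auto)
    moreover have "ennreal (indicator {0..t} u *\<^sub>R f (S (max 0 u) \<omega>)) = indicator {0..t} u * ennreal (f (S (max 0 u) \<omega>))" for u
      by (auto simp: indicator_def)
    ultimately show "ennreal (occ f 0 t \<omega>) = (\<integral>\<^sup>+ u. indicator {0..t} u * ennreal (f (S (max 0 u) \<omega>)) \<partial>lborel)" by simp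
  qed
  also have "\<dots> = (\<integral>\<^sup>+ u. (\<integral>\<^sup>+ \<omega>. indicator {0..t} u * ennreal (f (S (max 0 u) \<omega>)) \<partial>Q) \<partial>lborel)"
    using LQ.Fubini'[OF m] by simp
  also have "\<dots> = (\<integral>\<^sup>+ u. indicator {0..t} u * (\<integral>\<^sup>+ y. ennreal (f y) \<partial>measure_pmf (p (max 0 u) 0)) \<partial>lborel)"
  proof (rule nn_integral_cong)
    fix u :: real
    have Sm: "S (max 0 u) \<in> measurable Q (count_space UNIV)" by (rule S_measurable) simp
    have "(\<integral>\<^sup>+ y. ennreal (f y) \<partial>measure_pmf (p (max 0 u) 0)) = (\<integral>\<^sup>+ \<omega>. ennreal (f (S (max 0 u) \<omega>)) \<partial>Q)"
      by (subst distr_S[symmetric]) (auto intro!: nn_integral_distr[OF Sm])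
    moreover have "(\<lambda>\<omega>. ennreal (f (S (max 0 u) \<omega>))) \<in> borel_measurable Q"
      by (rule measurable_compose[OF Sm]) simp
    ultimately show "(\<integral>\<^sup>+ \<omega>. indicator {0..t} u * ennreal (f (S (max 0 u) \<omega>)) \<partial>Q) =
        indicator {0..t} u * (\<integral>\<^sup>+ y. ennreal (f y) \<partial>measure_pmf (p (max 0 u) 0))"
      by (simp add: nn_integral_cmult)
  qed
  finally show ?thesis .
qed

lemma occ_tail_first_moment:
  assumes f: "\<And>x. 0 \<le> f x" and "0 \<le> t" "0 < c" "0 \<le> C"
    and C: "\<And>u. 0 \<le> u \<Longrightarrow> u \<le> t \<Longrightarrow> (\<integral>\<^sup>+ y. ennreal (f y) \<partial>measure_pmf (p u 0)) \<le> ennreal C"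
  shows "Q.prob {\<omega> \<in> space Q. c \<le> occ f 0 t \<omega>} \<le> t * C / c"
proof -
  have m: "occ f 0 t \<in> borel_measurable Q" by (rule occ_measurable) simp
  have "ennreal c * emeasure Q {\<omega> \<in> space Q. c \<le> occ f 0 t \<omega>} =
      (\<integral>\<^sup>+ \<omega>. ennreal c * indicator {\<omega> \<in> space Q. c \<le> occ f 0 t \<omega>} \<omega> \<partial>Q)"
    by (rule nn_integral_cmult_indicator[symmetric]) (rule occ_event, simp)
  also have "\<dots> \<le> (\<integral>\<^sup>+ \<omega>. ennreal (occ f 0 t \<omega>) \<partial>Q)"
    by (intro nn_integral_mono) (auto simp: indicator_def intro: ennreal_leI)
  also have "\<dots> \<le> (\<integral>\<^sup>+ u. indicator {0..t} u * ennreal C \<partial>lborel)"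
    unfolding nn_integral_occ[OF f \<open>0 \<le> t\<close>]
    by (rule nn_integral_mono) (use C in \<open>auto simp: indicator_def\<close>)
  also have "\<dots> = ennreal (t * C)"
    using assms by (simp add: nn_integral_multc ennreal_mult)
  finally have "ennreal (c * Q.prob {\<omega> \<in> space Q. c \<le> occ f 0 t \<omega>}) \<le> ennreal (t * C)"
    using assms by (simp add: Q.emeasure_eq_measure ennreal_mult)
  then have "c * Q.prob {\<omega> \<in> space Q. c \<le> occ f 0 t \<omega>} \<le> t * C"
    using assms by (subst (asm) ennreal_le_iff) auto
  then show ?thesis using assms by (simp add: field_simps)
qed

text \<open>The mean is at least t q/2, already from the second half of the time interval, and the
  variable is at most t. Discarding the values below t q/4 leaves a contribution of at least t q/4
  to the mean.\<close>

lemma occ_lower_first_moment: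
  assumes "0 < t" "0 \<le> q"
    and q: "\<And>u. t / 2 \<le> u \<Longrightarrow> u \<le> t \<Longrightarrow> q \<le> measure (measure_pmf (p u 0)) G"
  shows "q / 4 \<le> Q.prob {\<omega> \<in> space Q. t * q / 4 \<le> occ (indicator G) 0 t \<omega>}"
    (is "_ \<le> Q.prob ?A")
proof -
  have m: "occ (indicator G) 0 t \<in> borel_measurable Q" by (rule occ_measurable) simp
  have A: "?A \<in> sets Q" by (rule occ_event) simp
  have "ennreal (t / 2 * q) = (\<integral>\<^sup>+ u. indicator {t/2..t} u * ennreal q \<partial>lborel)"
    using assms by (simp add: nn_integral_multc ennreal_mult[symmetric])
  also have "\<dots> \<le> (\<integral>\<^sup>+ u. indicator {0..t} u * (\<integral>\<^sup>+ y. ennreal (indicator G y) \<partial>measure_pmf (p (max 0 u) 0)) \<partial>lborel)"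
  proof (rule nn_integral_mono)
    fix u :: real
    have "(\<integral>\<^sup>+ y. ennreal (indicator G y) \<partial>measure_pmf (p (max 0 u) 0)) = ennreal (measure (measure_pmf (p (max 0 u) 0)) G)"
      by (simp add: ennreal_indicator measure_pmf.emeasure_eq_measure)
    then show "indicator {t/2..t} u * ennreal q \<le>
        indicator {0..t} u * (\<integral>\<^sup>+ y. ennreal (indicator G y) \<partial>measure_pmf (p (max 0 u) 0))"
      using q[of u] assms by (auto simp: indicator_def max_def intro: ennreal_leI)
  qed
  also have "\<dots> = (\<integral>\<^sup>+ \<omega>. ennreal (occ (indicator G) 0 t \<omega>) \<partial>Q)"
    by (rule nn_integral_occ[symmetric]) (use assms in auto)
  also have "\<dots> \<le> (\<integral>\<^sup>+ \<omega>. ennreal (t * q / 4) + ennreal t * indicator ?A \<omega> \<partial>Q)"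
  proof (rule nn_integral_mono)
    fix \<omega> assume \<omega>: "\<omega> \<in> space Q"
    have "occ (indicator G) 0 t \<omega> \<le> occ (\<lambda>_. 1) 0 t \<omega>" by (rule occ_mono[OF \<omega>]) (auto simp: indicator_def)
    then have "occ (indicator G) 0 t \<omega> \<le> t" using assms by (simp add: occ_const)
    then have "occ (indicator G) 0 t \<omega> \<le> t * q / 4 + t * indicator ?A \<omega>" using assms \<omega> by (auto simp: indicator_def intro: add_increasing)
    then have "ennreal (occ (indicator G) 0 t \<omega>) \<le> ennreal (t * q / 4 + t * indicator ?A \<omega>)" by (rule ennreal_leI)
    also have "\<dots> = ennreal (t * q / 4) + ennreal t * indicator ?A \<omega>" using assms by (auto simp: indicator_def ennreal_plus)
    finally show "ennreal (occ (indicator G) 0 t \<omega>) \<le> ennreal (t * q / 4) + ennreal t * indicator ?A \<omega>" .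
  qed
  also have "\<dots> = ennreal (t * q / 4) + ennreal t * emeasure Q ?A"
    using A by (simp add: nn_integral_add nn_integral_cmult Q.emeasure_space_1)
  also have "\<dots> = ennreal (t * q / 4 + t * Q.prob ?A)"
    using assms by (simp add: Q.emeasure_eq_measure ennreal_mult ennreal_plus)
  finally have "t / 2 * q \<le> t * q / 4 + t * Q.prob ?A" using assms by (subst (asm) ennreal_le_iff) auto
  then have "t * (q / 4) \<le> t * Q.prob ?A" by (simp add: algebra_simps)
  then show ?thesis using assms by simp
qed

end

section \<open>The scenery\<close>

definition cube :: "real \<Rightarrow> (int ^ 'd) set" where
  "cube r = {x. \<forall>i. real_of_int \<bar>x $ i\<bar> \<le> r}"

lemma cube_mono: "r \<le> s \<Longrightarrow> cube r \<subseteq> cube s"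
  by (auto simp: cube_def intro: order_trans)

lemma abs_le_floor_iff: "real_of_int \<bar>k\<bar> \<le> r \<longleftrightarrow> k \<in> {- \<lfloor>r\<rfloor>..\<lfloor>r\<rfloor>}"
  unfolding le_floor_iff[symmetric] by auto

lemma bij_betw_cube:
  "bij_betw vec_nth (cube r :: (int ^ 'd) set) (PiE UNIV (\<lambda>_. {- \<lfloor>r\<rfloor>..\<lfloor>r\<rfloor>}))"
proof (rule bij_betwI[where g = vec_lambda])
  show "vec_nth \<in> (cube r :: (int ^ 'd) set) \<rightarrow> (PiE UNIV (\<lambda>_. {- \<lfloor>r\<rfloor>..\<lfloor>r\<rfloor>}))"
    unfolding cube_def abs_le_floor_iff by auto
  show "vec_lambda \<in> PiE UNIV (\<lambda>_. {- \<lfloor>r\<rfloor>..\<lfloor>r\<rfloor>}) \<rightarrow> (cube r :: (int ^ 'd) set)"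
    unfolding cube_def abs_le_floor_iff by (auto simp: PiE_iff)
qed auto

lemma finite_cube [simp]: "finite (cube r)"
  using bij_betw_finite[OF bij_betw_cube] by (simp add: finite_PiE)

lemma card_cube: "0 \<le> r \<Longrightarrow> card (cube r :: (int ^ 'd) set) = nat (2 * \<lfloor>r\<rfloor> + 1) ^ CARD('d)"
  using bij_betw_same_card[OF bij_betw_cube, of r] by (simp add: card_PiE algebra_simps)

lemma card_cube_le:
  assumes "1 \<le> r"
  shows "real (card (cube r :: (int ^ 'd) set)) \<le> (3 * r) ^ CARD('d)"
proof -
  have "real (nat (2 * \<lfloor>r\<rfloor> + 1)) \<le> 3 * r" using assms by linarith
  then have "real (nat (2 * \<lfloor>r\<rfloor> + 1)) ^ CARD('d) \<le> (3 * r) ^ CARD('d)" by (intro power_mono) auto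
  then show ?thesis using assms by (simp only: card_cube of_nat_power)
qed

lemma card_cube_ge:
  assumes "0 \<le> r"
  shows "r ^ CARD('d) \<le> real (card (cube r :: (int ^ 'd) set))"
proof -
  have "0 \<le> \<lfloor>r\<rfloor>" using assms by simp
  then have "r \<le> real (nat (2 * \<lfloor>r\<rfloor> + 1))" by linarith
  then have "r ^ CARD('d) \<le> real (nat (2 * \<lfloor>r\<rfloor> + 1)) ^ CARD('d)" using assms by (intro power_mono) auto
  then show ?thesis using assms by (simp only: card_cube of_nat_power)
qed

lemma translate_cube: "{y. y - x \<in> cube r} = (\<lambda>v. v + x) ` cube r"
  by (auto simp: image_iff) (metis diff_add_cancel)

lemma finite_translate_cube [simp]: "finite {y. y - x \<in> cube r}"
  by (simp add: translate_cube)

lemma card_translate_cube: "card {y. y - x \<in> cube r} = card (cube r :: (int ^ 'd) set)"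
  for x :: "int ^ 'd"
  unfolding translate_cube by (rule card_image) (simp add: inj_on_def)

text \<open>Borel--Cantelli yields statements along powers of 2; a statement arranged to cover a
  whole dyadic block passes to all large real t.\<close>

lemma eventually_dyadic:
  assumes "\<forall>\<^sub>F j in sequentially. P j"
    and "\<And>j t. P j \<Longrightarrow> 2 ^ j \<le> t \<Longrightarrow> t \<le> 2 * 2 ^ j \<Longrightarrow> R t"
  shows "\<forall>\<^sub>F t :: real in at_top. R t"
proof -
  obtain J where J: "\<And>j. J \<le> j \<Longrightarrow> P j" using assms(1) by (auto simp: eventually_sequentially)
  have "R t" if t: "2 ^ J \<le> t" for t :: real
  proof -
    define j where "j = nat \<lfloor>log 2 t\<rfloor>"
    have "1 \<le> t" using t one_le_power[of 2 J] by (meson one_le_numeral order_trans)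
    then have t0: "0 < t" "0 \<le> log 2 t" by auto
    have fl: "real j \<le> log 2 t" "log 2 t < real j + 1" using t0 by (auto simp: j_def)
    have "real J \<le> log 2 t" using t t0 by (simp add: le_log_iff powr_realpow)
    then have "J \<le> j" by (simp add: j_def le_nat_floor)
    moreover have "2 ^ j \<le> t" using fl(1) t0 by (simp add: le_log_iff powr_realpow)
    moreover have "t \<le> 2 * 2 ^ j"
      using fl(2) t0 by (simp add: log_less_iff powr_add powr_realpow less_imp_le)
    ultimately show ?thesis using J assms(2) by blast
  qed
  then show ?thesis by (auto simp: eventually_at_top_linorder)
qed

locale scenery = prob_space M
  for M :: "'a measure" +
  fixes z :: "int ^ 'd \<Rightarrow> 'a \<Rightarrow> real" and \<alpha> :: real
  assumes alpha: "0 < \<alpha>"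
    and indep: "indep_vars (\<lambda>_. borel) z UNIV"
    and ident: "distr M borel (z x) = distr M borel (z y)"
    and tail: "power_asymp (\<lambda>r. measure M {\<omega> \<in> space M. z x \<omega> > r}) (- \<alpha>)"
begin

lemma z_measurable [measurable]: "z x \<in> borel_measurable M"
  using indep by (auto simp: indep_vars_def)

definition F :: "real \<Rightarrow> real" where "F r = prob {\<omega> \<in> space M. z 0 \<omega> > r}"

lemma prob_gt: "prob {\<omega> \<in> space M. z x \<omega> > r} = F r"
proof -
  have "prob {\<omega> \<in> space M. z x \<omega> > r} = measure (distr M borel (z x)) {r<..}" for x
    by (subst measure_distr) (auto intro!: arg_cong[where f = prob])
  from this[of x] this[of 0] show ?thesis unfolding F_def using ident[of x 0] by simp
qed

lemma F_01: "0 \<le> F r" "F r \<le> 1" by (simp_all add: F_def)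

lemma F_antimono: "r \<le> s \<Longrightarrow> F s \<le> F r"
  unfolding F_def by (rule finite_measure_mono) auto

lemma tail_bounds:
  assumes "0 < \<delta>"
  shows "\<forall>\<^sub>F r in at_top. r powr (- \<alpha> - \<delta>) \<le> F r \<and> F r \<le> r powr (- \<alpha> + \<delta>)"
proof -
  have "((\<lambda>r. ln (F r) / ln r) \<longlongrightarrow> - \<alpha>) at_top"
    using tail[of 0] by (simp add: power_asymp_def F_def)
  \<comment> \<open>Closeness within \<alpha> also excludes F r = 0, where the quotient would be 0
    because ln 0 = 0.\<close>
  from tendstoD[OF this, of "min \<delta> \<alpha>"] assms alpha
  have "\<forall>\<^sub>F r in at_top. \<bar>ln (F r) / ln r + \<alpha>\<bar> < min \<delta> \<alpha>" by (simp add: dist_real_def)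
  moreover have "\<forall>\<^sub>F r :: real in at_top. 1 < r" by (rule eventually_gt_at_top)
  ultimately show ?thesis
  proof eventually_elim
    case (elim r)
    have l: "0 < ln r" using elim by simp
    have "F r \<noteq> 0"
    proof
      assume "F r = 0"
      with elim(1) alpha show False by simp
    qed
    then have F: "0 < F r" using F_01(1)[of r] by simp
    have "(- \<alpha> - \<delta>) < ln (F r) / ln r" "ln (F r) / ln r < - \<alpha> + \<delta>" using elim(1) by (auto simp: abs_less_iff)
    then have "(- \<alpha> - \<delta>) * ln r < ln (F r)" "ln (F r) < (- \<alpha> + \<delta>) * ln r"
      using l by (simp_all add: pos_less_divide_eq pos_divide_less_eq)
    then have "exp ((- \<alpha> - \<delta>) * ln r) \<le> exp (ln (F r))" "exp (ln (F r)) \<le> exp ((- \<alpha> + \<delta>) * ln r)" by simp_all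
    then show ?case using F elim(2) by (simp add: powr_def)
  qed
qed

lemma prob_all_gt:
  assumes "finite A"
  shows "prob {\<omega> \<in> space M. \<forall>y\<in>A. z y \<omega> > r} = F r ^ card A"
proof (cases "A = {}")
  case False
  have "{\<omega> \<in> space M. \<forall>y\<in>A. z y \<omega> > r} = (\<Inter>y\<in>A. z y -` {r<..} \<inter> space M)" using False by auto
  also have "prob \<dots> = (\<Prod>y\<in>A. prob (z y -` {r<..} \<inter> space M))"
    by (rule indep_varsD[OF indep False assms]) auto
  also have "\<dots> = (\<Prod>y\<in>A. F r)"
    by (rule prod.cong[OF refl], subst prob_gt[symmetric]) (auto intro!: arg_cong[where f = prob])
  finally show ?thesis by simp
qed (simp add: prob_space)

lemma prob_all_le:
  assumes "finite A"
  shows "prob {\<omega> \<in> space M. \<forall>y\<in>A. z y \<omega> \<le> r} = (1 - F r) ^ card A"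
proof (cases "A = {}")
  case False
  have "{\<omega> \<in> space M. \<forall>y\<in>A. z y \<omega> \<le> r} = (\<Inter>y\<in>A. z y -` {..r} \<inter> space M)" using False by auto
  also have "prob \<dots> = (\<Prod>y\<in>A. prob (z y -` {..r} \<inter> space M))"
    by (rule indep_varsD[OF indep False assms]) auto
  also have "\<dots> = (\<Prod>y\<in>A. 1 - F r)"
  proof (rule prod.cong[OF refl])
    fix y
    have "z y -` {..r} \<inter> space M = space M - {\<omega> \<in> space M. z y \<omega> > r}" by auto
    then show "prob (z y -` {..r} \<inter> space M) = 1 - F r"
      by (simp add: prob_compl prob_gt)
  qed
  finally show ?thesis by simp
qed (simp add: prob_space)

section \<open>Sparseness of high sites\<close>

definition crowded :: "real \<Rightarrow> real \<Rightarrow> real \<Rightarrow> nat \<Rightarrow> 'a set" where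
  "crowded R r h K = (\<Union>x\<in>cube R. \<Union>A\<in>{A. A \<subseteq> {y. y - x \<in> cube r} \<and> card A = Suc K}.
     {\<omega> \<in> space M. \<forall>y\<in>A. z y \<omega> > h})"

lemma finite_subsets_cube: "finite {A. A \<subseteq> {y. y - x \<in> cube r} \<and> card A = k}"
  by (rule finite_subset[of _ "Pow {y. y - x \<in> cube r}"]) auto

lemma event_all_gt: "finite A \<Longrightarrow> {\<omega> \<in> space M. \<forall>y\<in>A. z y \<omega> > h} \<in> events"
  by measurable

lemma finite_of_subset_cube: "A \<subseteq> {y. y - x \<in> cube r} \<Longrightarrow> finite A"
  by (rule finite_subset) auto

lemma crowded_event: "crowded R r h K \<in> events"
  unfolding crowded_def
  by (intro sets.finite_UN finite_cube finite_subsets_cube event_all_gt)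
    (auto intro: finite_of_subset_cube)

text \<open>Union bound over the centres and over the (K+1)-subsets of a cube, whose number is at
  most the (K+1)st power of its cardinality; independence gives a factor F h for each point.\<close>

lemma prob_crowded_le:
  "prob (crowded R r h K) \<le> real (card (cube R :: (int ^ 'd) set)) * (real (card (cube r :: (int ^ 'd) set)) * F h) ^ Suc K"
proof -
  have inner: "prob (\<Union>A\<in>{A. A \<subseteq> {y. y - x \<in> cube r} \<and> card A = Suc K}. {\<omega> \<in> space M. \<forall>y\<in>A. z y \<omega> > h})
      \<le> (real (card (cube r :: (int ^ 'd) set)) * F h) ^ Suc K" for x
  proof -
    have "prob (\<Union>A\<in>{A. A \<subseteq> {y. y - x \<in> cube r} \<and> card A = Suc K}. {\<omega> \<in> space M. \<forall>y\<in>A. z y \<omega> > h})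
        \<le> (\<Sum>A\<in>{A. A \<subseteq> {y. y - x \<in> cube r} \<and> card A = Suc K}. prob {\<omega> \<in> space M. \<forall>y\<in>A. z y \<omega> > h})"
      by (rule finite_measure_subadditive_finite[OF finite_subsets_cube])
        (auto intro!: event_all_gt intro: finite_of_subset_cube)
    also have "\<dots> = (\<Sum>A\<in>{A. A \<subseteq> {y. y - x \<in> cube r} \<and> card A = Suc K}. F h ^ Suc K)"
    proof (rule sum.cong[OF refl])
      fix A assume "A \<in> {A. A \<subseteq> {y. y - x \<in> cube r} \<and> card A = Suc K}"
      then have "finite A" "card A = Suc K" by (auto intro: finite_of_subset_cube)
      then show "prob {\<omega> \<in> space M. \<forall>y\<in>A. z y \<omega> > h} = F h ^ Suc K" by (simp only: prob_all_gt)
    qed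
    also have "\<dots> = real (card (cube r :: (int ^ 'd) set) choose Suc K) * F h ^ Suc K"
      using n_subsets[of "{y. y - x \<in> cube r}" "Suc K"] by (simp add: card_translate_cube)
    also have "\<dots> \<le> real (card (cube r :: (int ^ 'd) set)) ^ Suc K * F h ^ Suc K"
    proof (rule mult_right_mono)
      have "card (cube r :: (int ^ 'd) set) choose Suc K \<le> card (cube r :: (int ^ 'd) set) ^ Suc K"
        by (cases "Suc K \<le> card (cube r :: (int ^ 'd) set)") (auto simp: binomial_le_pow binomial_eq_0 simp del: power_Suc)
      then show "real (card (cube r :: (int ^ 'd) set) choose Suc K) \<le> real (card (cube r :: (int ^ 'd) set)) ^ Suc K"
        by (metis of_nat_le_iff of_nat_power)
    qed (simp add: F_01 del: power_Suc)
    finally show ?thesis by (simp only: power_mult_distrib)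
  qed
  have "prob (crowded R r h K) \<le> (\<Sum>x\<in>(cube R :: (int ^ 'd) set). (real (card (cube r :: (int ^ 'd) set)) * F h) ^ Suc K)"
    unfolding crowded_def
    by (rule order_trans[OF finite_measure_subadditive_finite sum_mono[OF inner]])
      (auto intro!: event_all_gt sets.finite_UN finite_subsets_cube intro: finite_of_subset_cube)
  then show ?thesis by simp
qed

lemma not_crowded:
  assumes "\<omega> \<in> space M - crowded R r h K" "x \<in> cube R"
  shows "card {y. y - x \<in> cube r \<and> h < z y \<omega>} \<le> K"
proof (rule ccontr)
  assume "\<not> ?thesis"
  then have "Suc K \<le> card {y. y - x \<in> cube r \<and> h < z y \<omega>}" by simp
  then obtain A where "A \<subseteq> {y. y - x \<in> cube r \<and> h < z y \<omega>}" "card A = Suc K"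
    by (rule obtain_subset_with_card_n)
  then have "\<omega> \<in> crowded R r h K" using assms unfolding crowded_def by fastforce
  with assms show False by simp
qed

lemma two_powr: "((2::real) ^ j) powr s = (2 powr s) ^ j"
  by (simp add: powr_realpow[symmetric] powr_powr mult.commute)

text \<open>The expected number of high sites in one small cube is a negative power of t, about
  t^(\<gamma>d-\<eta>\<alpha>). Finding K + 1 of them costs the (K+1)st power, which beats the
  number t^(Cd) of centres.\<close>

theorem AE_sparse:
  assumes C: "0 \<le> C" and \<gamma>: "0 \<le> \<gamma>" and \<eta>: "0 < \<eta>"
    and K: "C * real CARD('d) < real (Suc K) * (\<eta> * \<alpha> - \<gamma> * real CARD('d))"
  shows "AE \<omega> in M. \<forall>\<^sub>F t in at_top. \<forall>x\<in>cube (t powr C).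
    card {y. y - x \<in> cube (t powr \<gamma>) \<and> t powr \<eta> < z y \<omega>} \<le> K"
proof -
  define d where "d = real CARD('d)"
  define e where "e = real (Suc K) * (\<eta> * \<alpha> - \<gamma> * d) - C * d"
  have e: "0 < e" using K by (simp add: e_def d_def)
  \<comment> \<open>The tail exponent is known only up to \<delta>; this choice uses up half of the
    surplus e.\<close>
  define \<delta> where "\<delta> = e / (2 * (real (Suc K) * \<eta>))"
  have \<delta>: "0 < \<delta>" using e \<eta> by (simp add: \<delta>_def)
  have e2: "C * d + real (Suc K) * (\<gamma> * d - \<eta> * (\<alpha> - \<delta>)) = - (e / 2)"
  proof -
    have "real (Suc K) * \<eta> * \<delta> = e / 2" using \<eta> by (simp add: \<delta>_def)
    moreover have "C * d + real (Suc K) * (\<gamma> * d - \<eta> * (\<alpha> - \<delta>)) = - e + real (Suc K) * \<eta> * \<delta>"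
      by (simp add: e_def algebra_simps)
    ultimately show ?thesis by linarith
  qed
  \<comment> \<open>Radii at the right end of the dyadic block, height at its left end: the
    complement controls every t of the block.\<close>
  define U where "U j = crowded ((2 * 2 ^ j) powr C) ((2 * 2 ^ j) powr \<gamma>) ((2 ^ j) powr \<eta>) K" for j :: nat
  define c where "c = (3 * 2 powr C) ^ CARD('d) * ((3 * 2 powr \<gamma>) ^ CARD('d)) ^ Suc K"
  have "filterlim (\<lambda>j. (2 ^ j :: real) powr \<eta>) at_top sequentially" using \<eta> by real_asymp
  from eventually_compose_filterlim[OF tail_bounds[OF \<delta>] this]
  have "\<forall>\<^sub>F j in sequentially. prob (U j) \<le> c * (2 powr (- (e / 2))) ^ j"
  proof eventually_elim
    case (elim j)
    define a where "a = (2::real) ^ j"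
    have a: "1 \<le> a" by (simp add: a_def)
    have cb: "real (card (cube ((2 * a) powr s) :: (int ^ 'd) set)) \<le> (3 * 2 powr s) ^ CARD('d) * a powr (s * d)" if "0 \<le> s" for s
    proof -
      have "real (card (cube ((2 * a) powr s) :: (int ^ 'd) set)) \<le> (3 * (2 * a) powr s) ^ CARD('d)"
        using a that by (intro card_cube_le) (simp add: ge_one_powr_ge_zero)
      also have "3 * (2 * a) powr s = 3 * 2 powr s * a powr s" using a by (simp add: powr_mult)
      also have "(3 * 2 powr s * a powr s) ^ CARD('d) = (3 * 2 powr s) ^ CARD('d) * a powr (s * d)"
        using a by (simp add: power_mult_distrib powr_powr[symmetric] powr_realpow d_def)
      finally show ?thesis .
    qed
    have "F (a powr \<eta>) \<le> (a powr \<eta>) powr (- \<alpha> + \<delta>)" using elim by (simp add: a_def)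
    then have Fle: "F (a powr \<eta>) \<le> a powr (- \<eta> * (\<alpha> - \<delta>))" by (simp add: powr_powr algebra_simps)
    have "prob (U j) \<le> real (card (cube ((2 * a) powr C) :: (int ^ 'd) set)) *
        (real (card (cube ((2 * a) powr \<gamma>) :: (int ^ 'd) set)) * F (a powr \<eta>)) ^ Suc K"
      unfolding U_def a_def by (rule prob_crowded_le)
    also have "\<dots> \<le> ((3 * 2 powr C) ^ CARD('d) * a powr (C * d)) *
        (((3 * 2 powr \<gamma>) ^ CARD('d) * a powr (\<gamma> * d)) * a powr (- \<eta> * (\<alpha> - \<delta>))) ^ Suc K"
      by (intro mult_mono power_mono cb C \<gamma> Fle) (auto simp: F_01 simp del: power_Suc)
    also have "\<dots> = c * (a powr (C * d) * (a powr (\<gamma> * d - \<eta> * (\<alpha> - \<delta>))) ^ Suc K)"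
    proof -
      have pw: "a powr (\<gamma> * d) * a powr (- \<eta> * (\<alpha> - \<delta>)) = a powr (\<gamma> * d - \<eta> * (\<alpha> - \<delta>))"
        using a by (simp add: powr_add[symmetric])
      show ?thesis unfolding c_def
        by (simp only: mult.assoc pw power_mult_distrib[of _ "a powr (\<gamma> * d - \<eta> * (\<alpha> - \<delta>))"]) (simp only: mult_ac)
    qed
    also have "(a powr (\<gamma> * d - \<eta> * (\<alpha> - \<delta>))) ^ Suc K = a powr (real (Suc K) * (\<gamma> * d - \<eta> * (\<alpha> - \<delta>)))"
      using a by (simp add: powr_realpow[symmetric] powr_powr mult.commute del: power_Suc)
    also have "a powr (C * d) * \<dots> = a powr (- (e / 2))" using a e2 by (simp add: powr_add[symmetric])
    finally show ?case by (simp add: a_def two_powr)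
  qed
  then have ev: "\<forall>\<^sub>F j in sequentially. norm (prob (U j)) \<le> c * (2 powr (- (e / 2))) ^ j"
    by eventually_elim simp
  have "norm ((2::real) powr (- (e / 2))) < 1" using e by (simp add: powr_less_one)
  then have "summable (\<lambda>j. prob (U j))"
    by (intro summable_comparison_test_ev[OF ev] summable_mult summable_geometric)
  then have "AE \<omega> in M. \<forall>\<^sub>F j in sequentially. \<omega> \<in> space M - U j"
    by (intro borel_cantelli_AE1) (auto simp: U_def crowded_event emeasure_eq_measure)
  then show ?thesis
  proof eventually_elim
    case (elim \<omega>)
    from elim show ?case
    proof (rule eventually_dyadic)
      fix j and t :: real assume j: "\<omega> \<in> space M - U j" and t: "2 ^ j \<le> t" "t \<le> 2 * 2 ^ j"
      have t0: "0 < t" using t(1) zero_less_power[of 2 j] by (meson less_le_trans zero_less_numeral)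
      have pm: "t powr s \<le> (2 * 2 ^ j) powr s" if "0 \<le> s" for s using t t0 that by (intro powr_mono2) auto
      have pm': "(2 ^ j) powr \<eta> \<le> t powr \<eta>" using t \<eta> by (intro powr_mono2) auto
      show "\<forall>x\<in>cube (t powr C). card {y. y - x \<in> cube (t powr \<gamma>) \<and> t powr \<eta> < z y \<omega>} \<le> K"
      proof
        fix x :: "int ^ 'd" assume "x \<in> cube (t powr C)"
        then have x: "x \<in> cube ((2 * 2 ^ j) powr C)" using cube_mono[OF pm[OF C]] by blast
        have "card {y. y - x \<in> cube (t powr \<gamma>) \<and> t powr \<eta> < z y \<omega>} \<le>
            card {y. y - x \<in> cube ((2 * 2 ^ j) powr \<gamma>) \<and> (2 ^ j) powr \<eta> < z y \<omega>}"
          by (rule card_mono) (use cube_mono[OF pm[OF \<gamma>]] pm' in \<open>auto intro: finite_subset[OF _ finite_translate_cube]\<close>)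
        also have "\<dots> \<le> K" using not_crowded[OF j[unfolded U_def] x] .
        finally show "card {y. y - x \<in> cube (t powr \<gamma>) \<and> t powr \<eta> < z y \<omega>} \<le> K" .
      qed
    qed
  qed
qed

section \<open>Existence of high sites\<close>

definition deserted :: "real \<Rightarrow> real \<Rightarrow> real \<Rightarrow> 'a set" where
  "deserted R r h = (\<Union>x\<in>cube R. {\<omega> \<in> space M. \<forall>y\<in>{y. y - x \<in> cube r}. z y \<omega> \<le> h})"

lemma event_all_le: "finite A \<Longrightarrow> {\<omega> \<in> space M. \<forall>y\<in>A. z y \<omega> \<le> h} \<in> events"
  by measurable

lemma deserted_event: "deserted R r h \<in> events"
  unfolding deserted_def by (intro sets.finite_UN finite_cube event_all_le finite_translate_cube)

lemma prob_deserted_le: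
  assumes "0 \<le> r"
  shows "prob (deserted R r h) \<le> real (card (cube R :: (int ^ 'd) set)) * exp (- F h * r ^ CARD('d))"
proof -
  have inner: "prob {\<omega> \<in> space M. \<forall>y\<in>{y. y - x \<in> cube r}. z y \<omega> \<le> h} \<le> exp (- F h * r ^ CARD('d))" for x
  proof -
    let ?n = "card (cube r :: (int ^ 'd) set)"
    have "prob {\<omega> \<in> space M. \<forall>y\<in>{y. y - x \<in> cube r}. z y \<omega> \<le> h} = (1 - F h) ^ ?n"
      by (subst prob_all_le) (simp_all add: card_translate_cube)
    also have "\<dots> \<le> exp (- F h) ^ ?n"
      using exp_ge_add_one_self[of "- F h"] F_01[of h] by (intro power_mono) auto
    also have "\<dots> = exp (- (F h * real ?n))" by (simp add: exp_of_nat_mult[symmetric] mult.commute)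
    also have "\<dots> \<le> exp (- (F h * r ^ CARD('d)))"
      using card_cube_ge[OF assms, where 'd = 'd] F_01[of h] by (simp add: mult_left_mono)
    finally show ?thesis by simp
  qed
  have "prob (deserted R r h) \<le> (\<Sum>x\<in>(cube R :: (int ^ 'd) set). exp (- F h * r ^ CARD('d)))"
    unfolding deserted_def
    by (rule order_trans[OF finite_measure_subadditive_finite sum_mono[OF inner]])
      (use event_all_le[OF finite_translate_cube] in auto)
  then show ?thesis by simp
qed

text \<open>A cube without high sites has probability at most exp (-b a^s) with a = 2^j, which beats
  the polynomial number of centres. The height \<open>h j\<close> is left free because it grows in
  one application and is the constant 1 in the other.\<close>

lemma AE_dense_dyadic:
  assumes C: "0 \<le> C" and \<gamma>: "0 \<le> \<gamma>" and "0 < b" "\<kappa> < \<gamma> * real CARD('d)"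
    and h: "\<forall>\<^sub>F j in sequentially. b * (2 ^ j) powr (- \<kappa>) \<le> F (h j)"
  shows "AE \<omega> in M. \<forall>\<^sub>F j in sequentially. \<forall>x\<in>cube ((2 * 2 ^ j) powr C).
    \<exists>y. y - x \<in> cube ((2 ^ j) powr \<gamma>) \<and> h j < z y \<omega>"
proof -
  define d where "d = real CARD('d)"
  define U where "U j = deserted ((2 * 2 ^ j) powr C) ((2 ^ j) powr \<gamma>) (h j)" for j :: nat
  define c where "c = (3 * 2 powr C) ^ CARD('d)"
  define s where "s = \<gamma> * d - \<kappa>"
  have s: "0 < s" using assms by (simp add: s_def d_def)
  \<comment> \<open>The additional factor a provides the summable bound 1/a = 2^(-j).\<close>
  have lim: "((\<lambda>a. c * a powr (C * d) * exp (- (b * a powr s)) * a) \<longlongrightarrow> 0) at_top"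
    using s \<open>0 < b\<close> by real_asymp
  have "filterlim (\<lambda>j. 2 ^ j :: real) at_top sequentially" by real_asymp
  from eventually_compose_filterlim[OF order_tendstoD(2)[OF lim zero_less_one] this] h
  have "\<forall>\<^sub>F j in sequentially. prob (U j) \<le> (1 / 2) ^ j"
  proof eventually_elim
    case (elim j)
    define a where "a = (2::real) ^ j"
    have a: "1 \<le> a" by (simp add: a_def)
    have "prob (U j) \<le> real (card (cube ((2 * a) powr C) :: (int ^ 'd) set)) * exp (- F (h j) * (a powr \<gamma>) ^ CARD('d))"
      unfolding U_def a_def by (rule prob_deserted_le) simp
    also have "\<dots> \<le> (c * a powr (C * d)) * exp (- (b * a powr s))"
    proof (intro mult_mono)
      have "real (card (cube ((2 * a) powr C) :: (int ^ 'd) set)) \<le> (3 * (2 * a) powr C) ^ CARD('d)"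
        using a C by (intro card_cube_le) (simp add: ge_one_powr_ge_zero)
      also have "3 * (2 * a) powr C = 3 * 2 powr C * a powr C" using a by (simp add: powr_mult)
      also have "(3 * 2 powr C * a powr C) ^ CARD('d) = c * a powr (C * d)"
        using a by (simp add: power_mult_distrib powr_powr[symmetric] powr_realpow d_def c_def)
      finally show "real (card (cube ((2 * a) powr C) :: (int ^ 'd) set)) \<le> c * a powr (C * d)" .
      have "b * a powr s = b * a powr (- \<kappa>) * (a powr \<gamma>) ^ CARD('d)"
        using a by (simp add: s_def powr_diff powr_minus powr_powr[symmetric] powr_realpow d_def divide_inverse)
      also have "\<dots> \<le> F (h j) * (a powr \<gamma>) ^ CARD('d)" using elim by (intro mult_right_mono) (auto simp: a_def)
      finally show "exp (- F (h j) * (a powr \<gamma>) ^ CARD('d)) \<le> exp (- (b * a powr s))" by simp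
    qed (auto simp: c_def)
    also have "\<dots> \<le> 1 / a" using elim(1) a by (simp add: a_def[symmetric] field_simps less_imp_le)
    finally show ?case by (simp add: a_def power_one_over)
  qed
  then have ev: "\<forall>\<^sub>F j in sequentially. norm (prob (U j)) \<le> (1 / 2) ^ j" by eventually_elim simp
  have "summable (\<lambda>j. prob (U j))"
    by (rule summable_comparison_test_ev[OF ev]) (rule summable_geometric, simp)
  then have "AE \<omega> in M. \<forall>\<^sub>F j in sequentially. \<omega> \<in> space M - U j"
    by (intro borel_cantelli_AE1) (auto simp: U_def deserted_event emeasure_eq_measure)
  then show ?thesis
  proof eventually_elim
    case (elim \<omega>)
    then show ?case
    proof eventually_elim
      case (elim j)
      show ?case
      proof (intro ballI, rule ccontr)
        fix x :: "int ^ 'd"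
        assume x: "x \<in> cube ((2 * 2 ^ j) powr C)" and "\<not> (\<exists>y. y - x \<in> cube ((2 ^ j) powr \<gamma>) \<and> h j < z y \<omega>)"
        then have "\<forall>y\<in>{y. y - x \<in> cube ((2 ^ j) powr \<gamma>)}. z y \<omega> \<le> h j" by (auto simp: not_less)
        with x elim show False unfolding U_def deserted_def by blast
      qed
    qed
  qed
qed

theorem AE_high_site:
  assumes "0 < \<eta>" "0 \<le> \<gamma>" "\<eta> * \<alpha> < \<gamma> * real CARD('d)"
  shows "AE \<omega> in M. \<forall>\<^sub>F t in at_top. \<exists>y\<in>cube (t powr \<gamma>). t powr \<eta> < z y \<omega>"
proof -
  define \<delta> where "\<delta> = (\<gamma> * real CARD('d) - \<eta> * \<alpha>) / (2 * \<eta>)"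
  have \<delta>: "0 < \<delta>" using assms by (simp add: \<delta>_def)
  have "\<eta> * \<delta> = (\<gamma> * real CARD('d) - \<eta> * \<alpha>) / 2" using assms(1) by (simp add: \<delta>_def)
  then have lt: "\<eta> * (\<alpha> + \<delta>) < \<gamma> * real CARD('d)" using assms(3) by (simp add: algebra_simps)
  have b: "0 < 2 powr (- \<eta> * (\<alpha> + \<delta>))" by simp
  have "filterlim (\<lambda>j. (2 * 2 ^ j :: real) powr \<eta>) at_top sequentially" using assms(1) by real_asymp
  from eventually_compose_filterlim[OF tail_bounds[OF \<delta>] this]
  have "\<forall>\<^sub>F j in sequentially. 2 powr (- \<eta> * (\<alpha> + \<delta>)) * (2 ^ j) powr (- (\<eta> * (\<alpha> + \<delta>))) \<le> F ((2 * 2 ^ j) powr \<eta>)"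
  proof eventually_elim
    case (elim j)
    then show ?case by (simp add: powr_powr powr_mult algebra_simps)
  qed
  from AE_dense_dyadic[OF order_refl assms(2) b lt this] show ?thesis
  proof eventually_elim
    case (elim \<omega>)
    from elim show ?case
    proof (rule eventually_dyadic, goal_cases)
      case (1 j t)
      have t0: "0 < t" using 1(2) zero_less_power[of 2 j] by (meson less_le_trans zero_less_numeral)
      have "0 \<in> (cube ((2 * 2 ^ j) powr 0) :: (int ^ 'd) set)" by (simp add: cube_def)
      with 1(1) obtain y :: "int ^ 'd" where y: "y - 0 \<in> cube ((2 ^ j) powr \<gamma>)" "(2 * 2 ^ j) powr \<eta> < z y \<omega>" by blast
      have "(2 ^ j) powr \<gamma> \<le> t powr \<gamma>" using 1 assms by (intro powr_mono2) auto
      from cube_mono[OF this] y(1) have "y \<in> cube (t powr \<gamma>)" by auto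
      moreover have "t powr \<eta> \<le> (2 * 2 ^ j) powr \<eta>" using 1 assms t0 by (intro powr_mono2) auto
      ultimately show ?case using y(2) by (intro bexI[of _ y]) auto
    qed
  qed
qed

text \<open>F 1 > 0, because the power tail is positive at large heights and F is antitone. At a
  fixed height any positive power of t suffices as radius.\<close>

theorem AE_positive_sites:
  assumes "0 < \<gamma>" "0 \<le> C"
  shows "AE \<omega> in M. \<forall>\<^sub>F t in at_top. \<forall>x\<in>cube (t powr C). \<exists>y. y - x \<in> cube (t powr \<gamma>) \<and> 1 < z y \<omega>"
proof -
  have "\<forall>\<^sub>F r in at_top. r powr (- \<alpha> - 1) \<le> F r \<and> F r \<le> r powr (- \<alpha> + 1)" by (rule tail_bounds) simp
  moreover have "\<forall>\<^sub>F r :: real in at_top. 1 < r" by (rule eventually_gt_at_top)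
  ultimately have "\<forall>\<^sub>F r :: real in at_top. 0 < F 1"
  proof eventually_elim
    case (elim r)
    have "0 < r powr (- \<alpha> - 1)" using elim by simp
    also have "\<dots> \<le> F r" using elim by simp
    also have "\<dots> \<le> F 1" using elim by (intro F_antimono) auto
    finally show ?case .
  qed
  then have F1: "0 < F 1" by simp
  have "\<forall>\<^sub>F j in sequentially. F 1 * (2 ^ j) powr (- 0) \<le> F ((\<lambda>_. 1) j)" by simp
  from AE_dense_dyadic[OF assms(2) _ F1 _ this, of \<gamma>]
  have "AE \<omega> in M. \<forall>\<^sub>F j in sequentially. \<forall>x\<in>cube ((2 * 2 ^ j) powr C). \<exists>y. y - x \<in> cube ((2 ^ j) powr \<gamma>) \<and> 1 < z y \<omega>"
    using assms by simp
  then show ?thesis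
  proof eventually_elim
    case (elim \<omega>)
    then show ?case
    proof (rule eventually_dyadic, goal_cases)
      case (1 j t)
      have t0: "0 < t" using 1(2) zero_less_power[of 2 j] by (meson less_le_trans zero_less_numeral)
      have "t powr C \<le> (2 * 2 ^ j) powr C" "(2 ^ j) powr \<gamma> \<le> t powr \<gamma>" using 1 assms t0 by (auto intro!: powr_mono2)
      from cube_mono[OF this(1)] cube_mono[OF this(2)] 1(1) show ?case by blast
    qed
  qed
qed

end

section \<open>Quenched upper bounds\<close>

lemma eventually_powr_le:
  fixes a b c :: real
  assumes "a < b"
  shows "\<forall>\<^sub>F t in at_top. c * t powr a \<le> t powr b"
proof -
  have "((\<lambda>t. c * t powr (a - b)) \<longlongrightarrow> 0) at_top" using assms by real_asymp
  from order_tendstoD(2)[OF this zero_less_one] eventually_gt_at_top[of 0]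
  show ?thesis
  proof eventually_elim
    case (elim t)
    then have "c * t powr (a - b) * t powr b \<le> 1 * t powr b" by (intro mult_right_mono) auto
    then show ?case using elim(2) by (simp add: mult.assoc powr_add[symmetric])
  qed
qed

lemma eventually_exp_le:
  fixes a b q \<pi> K :: real
  assumes "\<pi> < q" "0 < q" "0 < b" "0 < K"
  shows "\<forall>\<^sub>F t in at_top. K * t powr a * exp (- (b * t powr q)) \<le> exp (- (t powr \<pi>))"
proof -
  have "((\<lambda>t. (ln K + a * ln t) / t powr q) \<longlongrightarrow> 0) at_top" using assms(2) by real_asymp
  moreover have "0 < b / 2" using assms by simp
  ultimately have "\<forall>\<^sub>F t in at_top. (ln K + a * ln t) / t powr q < b / 2" by (rule order_tendstoD(2))
  moreover have "\<forall>\<^sub>F t in at_top. 2 / b * t powr \<pi> \<le> t powr q" by (rule eventually_powr_le[OF assms(1)])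
  ultimately show ?thesis using eventually_gt_at_top[of 0]
  proof eventually_elim
    case (elim t)
    have "ln K + a * ln t \<le> b / 2 * t powr q" using elim by (simp add: pos_divide_less_eq)
    moreover have "t powr \<pi> \<le> b / 2 * t powr q" using elim assms by (simp add: field_simps)
    ultimately have "ln K + a * ln t - b * t powr q \<le> - (t powr \<pi>)" by linarith
    then have "exp (ln K + a * ln t - b * t powr q) \<le> exp (- (t powr \<pi>))" by simp
    moreover have "exp (ln K + a * ln t - b * t powr q) = exp (ln K) * exp (a * ln t) * exp (- (b * t powr q))"
      by (simp add: exp_add[symmetric])
    moreover have "exp (a * ln t) = t powr a" using elim by (simp add: powr_def)
    moreover have "exp (ln K) = K" using assms by simp
    ultimately show ?case by metis
  qed
qed

section \<open>Contribution of distant sites\<close>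

definition supn :: "int ^ 'd \<Rightarrow> real" where
  "supn x = Max (range (\<lambda>i. real_of_int \<bar>x $ i\<bar>))"

lemma cube_iff_supn: "x \<in> cube r \<longleftrightarrow> supn x \<le> r"
  by (auto simp: cube_def supn_def)

lemma supn_attained: "\<exists>i. supn x = real_of_int \<bar>x $ i\<bar>"
proof -
  have "supn x \<in> range (\<lambda>i. real_of_int \<bar>x $ i\<bar>)" unfolding supn_def by (rule Max_in) auto
  then show ?thesis by auto
qed

lemma supn_nonneg: "0 \<le> supn x"
  using supn_attained[of x] by auto

lemma supn_le_l1: "supn x \<le> l1 x"
proof -
  obtain i where "supn x = real_of_int \<bar>x $ i\<bar>" using supn_attained by blast
  then show ?thesis unfolding l1_def using member_le_sum[of i UNIV "\<lambda>i. \<bar>real_of_int (x $ i)\<bar>"] by simp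
qed

context walk
begin

text \<open>The growth m^\<beta> is absorbed into exp (\<theta> m) at the price
  (\<beta>/\<theta>)^\<beta>, by x \<le> exp x. Outside radius r, exp (\<theta> m) \<le> exp
  (-\<theta> r) exp (2\<theta> m), and the last factor is dominated by the cosh moments of the
  coordinates at rate 2\<theta>, whence 4\<theta>^2 t.\<close>

lemma outside_tail:
  assumes \<theta>: "0 < \<theta>" "2 * \<theta> \<le> 1" and "0 < \<beta>" "0 < t" "0 < c"
    and \<zeta>: "\<And>y. 0 \<le> \<zeta> y" "\<And>y m. r \<le> m \<Longrightarrow> y \<in> cube m \<Longrightarrow> \<zeta> y \<le> m powr \<beta>"
  shows "Q.prob {\<omega> \<in> space Q. c \<le> occ (\<lambda>y. \<zeta> y * indicator (- cube r) y) 0 t \<omega>}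
    \<le> t * ((\<beta> / \<theta>) powr \<beta> * (2 * real CARD('d)) * exp (4 * \<theta>\<^sup>2 * t - \<theta> * r)) / c"
proof (rule occ_tail_first_moment)
  define k where "k = (\<beta> / \<theta>) powr \<beta> * exp (- \<theta> * r)"
  have k: "0 \<le> k" by (simp add: k_def)
  have bound: "\<zeta> y * indicator (- cube r) y \<le> k * (\<Sum>i\<in>UNIV. 2 * cosh (2 * \<theta> * real_of_int (y $ i - 0 $ i)))" for y :: "int ^ 'd"
  proof (cases "y \<in> cube r")
    case True
    then show ?thesis using k by (simp add: sum_nonneg)
  next
    case False
    define m where "m = supn y"
    have m: "r < m" "y \<in> cube m" "0 \<le> m" using False by (auto simp: m_def cube_iff_supn supn_nonneg)
    have "m powr \<beta> \<le> (\<beta> / \<theta>) powr \<beta> * exp (\<theta> * m)"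
    proof -
      have "\<theta> * m / \<beta> \<le> exp (\<theta> * m / \<beta>)" using exp_ge_add_one_self[of "\<theta> * m / \<beta>"] by linarith
      then have "(\<theta> * m / \<beta>) powr \<beta> \<le> exp (\<theta> * m / \<beta>) powr \<beta>"
        using \<theta> m \<open>0 < \<beta>\<close> by (intro powr_mono2) auto
      also have "\<dots> = exp (\<theta> * m)" using \<open>0 < \<beta>\<close> by (simp add: exp_powr_real)
      finally have "(\<beta> / \<theta>) powr \<beta> * (\<theta> * m / \<beta>) powr \<beta> \<le> (\<beta> / \<theta>) powr \<beta> * exp (\<theta> * m)"
        by (intro mult_left_mono) auto
      moreover have "(\<beta> / \<theta>) powr \<beta> * (\<theta> * m / \<beta>) powr \<beta> = m powr \<beta>"
        using \<theta> m \<open>0 < \<beta>\<close> by (simp add: powr_mult[symmetric])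
      ultimately show ?thesis by simp
    qed
    moreover have "exp (\<theta> * m) \<le> exp (- \<theta> * r) * exp (2 * \<theta> * m)"
    proof -
      have "\<theta> * r \<le> \<theta> * m" using m \<theta> by (intro mult_left_mono) auto
      then show ?thesis by (simp add: exp_add[symmetric])
    qed
    ultimately have "m powr \<beta> \<le> (\<beta> / \<theta>) powr \<beta> * (exp (- \<theta> * r) * exp (2 * \<theta> * m))"
      by (meson mult_left_mono order_trans powr_ge_zero)
    also have "\<dots> = k * exp (2 * \<theta> * m)" by (simp add: k_def)
    also have "exp (2 * \<theta> * m) \<le> (\<Sum>i\<in>UNIV. 2 * cosh (2 * \<theta> * real_of_int (y $ i)))"
    proof -
      obtain i where i: "m = real_of_int \<bar>y $ i\<bar>" using supn_attained[of y] by (auto simp: m_def)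
      have "exp (2 * \<theta> * m) \<le> 2 * cosh (2 * \<theta> * m)" by (simp add: cosh_def)
      also have "\<dots> = 2 * cosh \<bar>2 * \<theta> * real_of_int (y $ i)\<bar>" using \<theta> by (simp add: i abs_mult)
      also have "\<dots> = 2 * cosh (2 * \<theta> * real_of_int (y $ i))" by (simp only: cosh_real_abs)
      also have "\<dots> \<le> (\<Sum>i\<in>UNIV. 2 * cosh (2 * \<theta> * real_of_int (y $ i)))"
        by (rule member_le_sum[of i UNIV "\<lambda>i. 2 * cosh (2 * \<theta> * real_of_int (y $ i))"]) auto
      finally show ?thesis .
    qed
    finally have "m powr \<beta> \<le> k * (\<Sum>i\<in>UNIV. 2 * cosh (2 * \<theta> * real_of_int (y $ i)))" using k by (simp add: mult_left_mono)
    moreover have "\<zeta> y \<le> m powr \<beta>" using \<zeta>(2)[of m y] m by simp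
    ultimately show ?thesis using False by simp
  qed
  show "(\<integral>\<^sup>+ y. ennreal (\<zeta> y * indicator (- cube r) y) \<partial>measure_pmf (p u 0))
      \<le> ennreal ((\<beta> / \<theta>) powr \<beta> * (2 * real CARD('d)) * exp (4 * \<theta>\<^sup>2 * t - \<theta> * r))"
    if u: "0 \<le> u" "u \<le> t" for u
  proof -
    have "(\<integral>\<^sup>+ y. ennreal (\<zeta> y * indicator (- cube r) y) \<partial>measure_pmf (p u 0))
        \<le> (\<integral>\<^sup>+ y. ennreal (k * (\<Sum>i\<in>UNIV. 2 * cosh (2 * \<theta> * real_of_int (y $ i - 0 $ i)))) \<partial>measure_pmf (p u 0))"
      by (intro nn_integral_mono ennreal_leI bound)
    also have "\<dots> = (\<integral>\<^sup>+ y. (\<Sum>i\<in>UNIV. ennreal (2 * k) * ennreal (cosh (2 * \<theta> * real_of_int (y $ i - 0 $ i)))) \<partial>measure_pmf (p u 0))"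
      using k by (intro nn_integral_cong) (simp add: sum_distrib_left ennreal_mult[symmetric] mult_ac)
    also have "\<dots> = (\<Sum>i\<in>UNIV. ennreal (2 * k) * (\<integral>\<^sup>+ y. ennreal (cosh (2 * \<theta> * real_of_int (y $ i - 0 $ i))) \<partial>measure_pmf (p u 0)))"
      by (simp add: nn_integral_sum nn_integral_cmult)
    also have "\<dots> \<le> (\<Sum>i\<in>(UNIV :: 'd set). ennreal (2 * k) * ennreal (exp (4 * \<theta>\<^sup>2 * t)))"
    proof (intro sum_mono mult_left_mono)
      fix i :: 'd
      have "(\<integral>\<^sup>+ y. ennreal (cosh (2 * \<theta> * real_of_int (y $ i - 0 $ i))) \<partial>measure_pmf (p u 0)) \<le> ennreal (exp ((2 * \<theta>)\<^sup>2 * u))"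
        by (rule cosh_moment) (use u \<theta> in auto)
      also have "\<dots> \<le> ennreal (exp (4 * \<theta>\<^sup>2 * t))"
        using u by (intro ennreal_leI) (simp add: power2_eq_square mult_left_mono)
      finally show "(\<integral>\<^sup>+ y. ennreal (cosh (2 * \<theta> * real_of_int (y $ i - 0 $ i))) \<partial>measure_pmf (p u 0)) \<le> ennreal (exp (4 * \<theta>\<^sup>2 * t))" .
    qed auto
    also have "\<dots> = ennreal (real CARD('d) * (2 * k * exp (4 * \<theta>\<^sup>2 * t)))"
      using k by (simp add: ennreal_mult[symmetric] ennreal_of_nat_eq_real_of_nat)
    also have "real CARD('d) * (2 * k * exp (4 * \<theta>\<^sup>2 * t)) = (\<beta> / \<theta>) powr \<beta> * (2 * real CARD('d)) * exp (4 * \<theta>\<^sup>2 * t - \<theta> * r)"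
      by (simp add: k_def exp_diff exp_minus field_simps)
    finally show ?thesis .
  qed
qed (use assms in auto)

text \<open>The exponential rate is of order t^(-s). For C \<le> 1 the Gaussian choice is s = 1 - C,
  with decay exponent C - s = 2C - 1; for C \<ge> 1 a constant rate, s = 0, gives the exponent
  C.\<close>

lemma outside_asymp:
  assumes s: "0 \<le> s" "1 - 2 * s \<le> C - s" "\<pi> < C - s" "0 < C - s" "0 < C" and "0 < \<beta>"
    and \<zeta>: "\<And>y. 0 \<le> \<zeta> y" "\<forall>\<^sub>F m in at_top. \<forall>y\<in>cube m. \<zeta> y \<le> m powr \<beta>"
  shows "\<forall>\<^sub>F t in at_top. Q.prob {\<omega> \<in> space Q. t powr \<rho> / 3 \<le> occ (\<lambda>y. \<zeta> y * indicator (- cube (t powr C)) y) 0 t \<omega>}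
    \<le> exp (- (t powr \<pi>))"
proof -
  obtain m0 where m0: "\<And>m y. m0 \<le> m \<Longrightarrow> y \<in> cube m \<Longrightarrow> \<zeta> y \<le> m powr \<beta>"
    using \<zeta>(2) by (auto simp: eventually_at_top_linorder)
  have "filterlim (\<lambda>t. t powr C) at_top at_top" using \<open>0 < C\<close> by real_asymp
  then have "\<forall>\<^sub>F t in at_top. m0 \<le> t powr C" by (simp add: filterlim_at_top)
  moreover have "\<forall>\<^sub>F t in at_top. 3 * (8 * \<beta>) powr \<beta> * (2 * real CARD('d)) * t powr (1 + s * \<beta> - \<rho>) * exp (- (1 / 16 * t powr (C - s))) \<le> exp (- (t powr \<pi>))"
    by (rule eventually_exp_le) (use s \<open>0 < \<beta>\<close> in auto)
  ultimately show ?thesis using eventually_ge_at_top[of 1]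
  proof eventually_elim
    case (elim t)
    \<comment> \<open>The factor 1/8 makes 4 \<theta>^2 t = t^(1-2s)/16 at most half of \<theta> t^C
      = t^(C-s)/8.\<close>
    define \<theta> where "\<theta> = t powr (- s) / 8"
    have "t powr (- s) \<le> t powr 0" using elim s by (intro powr_mono) auto
    then have \<theta>: "0 < \<theta>" "2 * \<theta> \<le> 1" using elim by (auto simp: \<theta>_def)
    have "Q.prob {\<omega> \<in> space Q. t powr \<rho> / 3 \<le> occ (\<lambda>y. \<zeta> y * indicator (- cube (t powr C)) y) 0 t \<omega>}
        \<le> t * ((\<beta> / \<theta>) powr \<beta> * (2 * real CARD('d)) * exp (4 * \<theta>\<^sup>2 * t - \<theta> * t powr C)) / (t powr \<rho> / 3)"
      by (rule outside_tail[OF \<theta> \<open>0 < \<beta>\<close>]) (use elim \<zeta>(1) m0 in auto)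
    also have "\<dots> \<le> t * ((\<beta> / \<theta>) powr \<beta> * (2 * real CARD('d)) * exp (- (1 / 16 * t powr (C - s)))) / (t powr \<rho> / 3)"
    proof -
      have "4 * \<theta>\<^sup>2 * t = t powr (1 - 2 * s) / 16"
      proof -
        have "(t powr (- s))\<^sup>2 * t = t powr (- s) * t powr (- s) * t powr 1" using elim by (simp add: power2_eq_square)
        also have "\<dots> = t powr (1 - 2 * s)" by (simp only: powr_add[symmetric]) simp
        finally show ?thesis by (simp add: \<theta>_def power_divide)
      qed
      also have "\<dots> \<le> t powr (C - s) / 16" using elim s by (simp add: powr_mono)
      finally have "4 * \<theta>\<^sup>2 * t \<le> t powr (C - s) / 16" .
      moreover have "\<theta> * t powr C = t powr (C - s) / 8" by (simp add: \<theta>_def powr_add[symmetric])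
      ultimately have "exp (4 * \<theta>\<^sup>2 * t - \<theta> * t powr C) \<le> exp (- (1 / 16 * t powr (C - s)))" by simp
      then show ?thesis using elim by (intro divide_right_mono mult_left_mono) auto
    qed
    also have "\<dots> = 3 * (8 * \<beta>) powr \<beta> * (2 * real CARD('d)) * t powr (1 + s * \<beta> - \<rho>) * exp (- (1 / 16 * t powr (C - s)))"
    proof -
      have "(\<beta> / \<theta>) powr \<beta> = (8 * \<beta>) powr \<beta> * t powr (s * \<beta>)"
      proof -
        have "\<beta> / \<theta> = 8 * \<beta> * t powr s" using elim by (simp add: \<theta>_def powr_minus field_simps)
        then show ?thesis using \<open>0 < \<beta>\<close> by (simp add: powr_mult powr_powr)
      qed
      moreover have "t powr (1 + s * \<beta> - \<rho>) = t * t powr (s * \<beta>) / t powr \<rho>"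
        using elim by (simp add: powr_add powr_diff)
      ultimately show ?thesis by simp
    qed
    also have "\<dots> \<le> exp (- (t powr \<pi>))" by (rule elim)
    finally show ?case .
  qed
qed

text \<open>The resolvent has rate t^(-th), and its range t^th is shorter than the sparseness scale
  t^\<gamma>. Each point therefore feels at most K sites and a negligible rest, so that D = K + 1.
  With t^g bounding the Green function the tail exponent is \<sigma> - g, provided that it exceeds
  the exponent 1 - 2 th of \<theta>^2 t.\<close>

lemma level_tail:
  assumes \<theta>: "0 \<le> th" "th < \<gamma>" and C: "0 \<le> C"
    and sparse: "\<forall>\<^sub>F t in at_top. \<forall>x\<in>cube (t powr C). card {y. y - x \<in> cube (t powr \<gamma>) \<and> t powr \<eta> < \<zeta> y} \<le> K"
    and green: "\<forall>\<^sub>F t in at_top. green_bound CARD('d) (t powr (- th)) \<le> t powr g"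
    and \<sigma>: "1 - 2 * th < \<sigma> - g" "0 < \<sigma> - g" "\<pi> < \<sigma> - g"
  shows "\<forall>\<^sub>F t in at_top. Q.prob {\<omega> \<in> space Q. t powr \<sigma> \<le> occ (indicator {y \<in> cube (t powr C). t powr \<eta> < \<zeta> y}) 0 t \<omega>}
    \<le> exp (- (t powr \<pi>))"
proof -
  have lim: "((\<lambda>t. (3 * t powr C) ^ CARD('d) * exp (- (t powr (\<gamma> - th) / 2))) \<longlongrightarrow> 0) at_top"
  proof -
    have "((\<lambda>t. 3 ^ CARD('d) * t powr (C * real CARD('d)) * exp (- (t powr (\<gamma> - th) / 2))) \<longlongrightarrow> 0) at_top"
      using \<theta> by real_asymp
    moreover have "\<forall>\<^sub>F t in at_top. 3 ^ CARD('d) * t powr (C * real CARD('d)) * exp (- (t powr (\<gamma> - th) / 2)) =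
        (3 * t powr C) ^ CARD('d) * exp (- (t powr (\<gamma> - th) / 2))"
      using eventually_gt_at_top[of 0]
      by eventually_elim (simp add: power_mult_distrib powr_powr[symmetric] powr_realpow)
    ultimately show ?thesis by (rule Lim_transform_eventually)
  qed
  \<comment> \<open>Half of the coefficient 1/(2(K+1)) from \<open>occupation_tail\<close>; the
    other half absorbs the term t^(1-2th).\<close>
  define b where "b = 1 / (4 * (real K + 1))"
  have b: "0 < b" by (simp add: b_def)
  have "\<forall>\<^sub>F t in at_top. 1 / b * t powr (1 - 2 * th) \<le> t powr (\<sigma> - g)" by (rule eventually_powr_le[OF \<sigma>(1)])
  moreover have "\<forall>\<^sub>F t in at_top. 2 * t powr 0 * exp (- (b * t powr (\<sigma> - g))) \<le> exp (- (t powr \<pi>))"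
    by (rule eventually_exp_le) (use \<sigma> b in auto)
  ultimately show ?thesis
    using sparse green order_tendstoD(2)[OF lim zero_less_one] eventually_ge_at_top[of 1]
  proof eventually_elim
    case (elim t)
    define H where "H = {y \<in> cube (t powr C). t powr \<eta> < \<zeta> y}"
    have H: "finite H" by (simp add: H_def)
    define \<theta>' where "\<theta>' = t powr (- th)"
    have "t powr (- th) \<le> t powr 0" using elim \<theta> by (intro powr_mono) auto
    then have \<theta>': "0 < \<theta>'" "\<theta>' \<le> 1" using elim by (auto simp: \<theta>'_def)
    have D: "(\<Sum>y\<in>H. expdec \<theta>' (x - y)) \<le> real K + 1" for x :: "int ^ 'd"
    proof -
      \<comment> \<open>Half the radius, since x is arbitrary and possibly outside the large cube,
        whereas sparseness holds around points of that cube. Two sites within t^\<gamma>/2 of x lie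
        within t^\<gamma> of each other, so one of them can serve as the centre.\<close>
      define N where "N = {y \<in> H. y - x \<in> cube (t powr \<gamma> / 2)}"
      have "(\<Sum>y\<in>H. expdec \<theta>' (x - y)) = (\<Sum>y\<in>N. expdec \<theta>' (x - y)) + (\<Sum>y\<in>H - N. expdec \<theta>' (x - y))"
        by (rule sum.subset_diff[of N H, THEN trans, OF _ _ add.commute]) (auto simp: N_def H)
      also have "(\<Sum>y\<in>N. expdec \<theta>' (x - y)) \<le> real K"
      proof -
        have "card N \<le> K"
        proof (cases "N = {}")
          case False
          then obtain y0 where y0: "y0 \<in> N" by blast
          have "N \<subseteq> {y. y - y0 \<in> cube (t powr \<gamma>) \<and> t powr \<eta> < \<zeta> y}"
          proof
            fix y assume y: "y \<in> N"
            have "y - y0 \<in> cube (t powr \<gamma>)" unfolding cube_def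
            proof (clarify)
              fix i
              have "real_of_int \<bar>(y - x) $ i\<bar> \<le> t powr \<gamma> / 2" "real_of_int \<bar>(y0 - x) $ i\<bar> \<le> t powr \<gamma> / 2"
                using y y0 by (auto simp: N_def cube_def)
              then show "real_of_int \<bar>(y - y0) $ i\<bar> \<le> t powr \<gamma>"
                unfolding vector_minus_component of_int_abs of_int_diff by linarith
            qed
            then show "y \<in> {y. y - y0 \<in> cube (t powr \<gamma>) \<and> t powr \<eta> < \<zeta> y}" using y by (simp add: N_def H_def)
          qed
          then have "card N \<le> card {y. y - y0 \<in> cube (t powr \<gamma>) \<and> t powr \<eta> < \<zeta> y}"
            by (rule card_mono[rotated]) (auto intro: finite_subset[OF _ finite_translate_cube])
          also have "\<dots> \<le> K" using elim(3) y0 by (auto simp: N_def H_def)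
          finally show ?thesis .
        qed simp
        have "(\<Sum>y\<in>N. expdec \<theta>' (x - y)) \<le> (\<Sum>y\<in>N. 1)" by (rule sum_mono) (use \<theta>' in \<open>simp add: expdec_le_1\<close>)
        with \<open>card N \<le> K\<close> show ?thesis by simp
      qed
      also have "(\<Sum>y\<in>H - N. expdec \<theta>' (x - y)) \<le> 1"
      proof -
        have "(\<Sum>y\<in>H - N. expdec \<theta>' (x - y)) \<le> (\<Sum>y\<in>H - N. exp (- (t powr (\<gamma> - th) / 2)))"
        proof (rule sum_mono)
          fix y assume "y \<in> H - N"
          then have "t powr \<gamma> / 2 < supn (y - x)" by (auto simp: N_def cube_iff_supn)
          also have "\<dots> \<le> l1 (y - x)" by (rule supn_le_l1)
          also have "\<dots> = l1 (x - y)" by (simp add: l1_def abs_minus_commute)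
          finally have "\<theta>' * (t powr \<gamma> / 2) \<le> \<theta>' * l1 (x - y)" using \<theta>' by (intro mult_left_mono) auto
          moreover have "\<theta>' * (t powr \<gamma> / 2) = t powr (\<gamma> - th) / 2" by (simp add: \<theta>'_def powr_add[symmetric])
          ultimately show "expdec \<theta>' (x - y) \<le> exp (- (t powr (\<gamma> - th) / 2))" by (simp add: expdec_def)
        qed
        also have "\<dots> = real (card (H - N)) * exp (- (t powr (\<gamma> - th) / 2))" by simp
        also have "\<dots> \<le> (3 * t powr C) ^ CARD('d) * exp (- (t powr (\<gamma> - th) / 2))"
        proof (rule mult_right_mono)
          have "card (H - N) \<le> card (cube (t powr C) :: (int ^ 'd) set)" by (rule card_mono) (auto simp: H_def)
          then have "real (card (H - N)) \<le> real (card (cube (t powr C) :: (int ^ 'd) set))" by simp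
          also have "\<dots> \<le> (3 * t powr C) ^ CARD('d)" using elim C by (intro card_cube_le) (simp add: ge_one_powr_ge_zero)
          finally show "real (card (H - N)) \<le> (3 * t powr C) ^ CARD('d)" .
        qed simp
        also have "\<dots> \<le> 1" using elim(5) by simp
        finally show ?thesis .
      qed
      finally show ?thesis by simp
    qed
    define G where "G = green_bound CARD('d) \<theta>'"
    have G: "0 < G" "G \<le> t powr g" using \<theta>' elim by (simp_all add: G_def \<theta>'_def green_bound_pos)
    have "Q.prob {\<omega> \<in> space Q. t powr \<sigma> \<le> occ (indicator H) 0 t \<omega>} \<le> 2 * exp (\<theta>'\<^sup>2 * t - t powr \<sigma> / (2 * G * (real K + 1)))"
      unfolding G_def by (rule occupation_tail[OF \<theta>' _ H _ D]) (use elim in auto)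
    also have "\<dots> \<le> 2 * exp (- (b * t powr (\<sigma> - g)))"
    proof -
      have "\<theta>'\<^sup>2 * t = t powr (- th) * t powr (- th) * t powr 1" using elim by (simp add: \<theta>'_def power2_eq_square)
      also have "\<dots> = t powr (1 - 2 * th)" by (simp only: powr_add[symmetric]) simp
      also have "\<dots> \<le> b * t powr (\<sigma> - g)" using elim(1) b by (simp add: field_simps)
      finally have "\<theta>'\<^sup>2 * t \<le> b * t powr (\<sigma> - g)" .
      moreover have "2 * b * t powr (\<sigma> - g) \<le> t powr \<sigma> / (2 * G * (real K + 1))"
      proof -
        have b2: "2 * b = 1 / (2 * (real K + 1))" by (simp add: b_def field_simps)
        have "2 * b * t powr (\<sigma> - g) = t powr \<sigma> / (2 * t powr g * (real K + 1))"
          unfolding b2 by (simp add: powr_diff mult_ac)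
        also have "\<dots> \<le> t powr \<sigma> / (2 * G * (real K + 1))"
          using G elim by (intro divide_left_mono mult_right_mono mult_left_mono mult_pos_pos) auto
        finally show ?thesis .
      qed
      ultimately show ?thesis by simp
    qed
    also have "\<dots> \<le> exp (- (t powr \<pi>))" using elim(2,6) by simp
    finally show ?case unfolding H_def .
  qed
qed

text \<open>Level k counts heights up to t^(\<eta> k + \<epsilon>). If the time above t^(\<eta> k)
  stays below t^(\<rho>-\<eta> k-2\<epsilon>), it contributes at most t^(\<rho>-\<epsilon>). The
  base height t^(\<eta> 0), taken over the whole time, contributes the same, as \<eta> 0 + 1 =
  \<rho> - \<epsilon>. These N + 1 pieces are at most t^\<rho>/2 together, the outside part less
  than t^\<rho>/3.\<close>

lemma upper_levels:
  fixes \<zeta> :: "int ^ 'd \<Rightarrow> real" and \<epsilon> \<rho> :: real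
  defines "\<eta> \<equiv> \<lambda>k :: nat. \<rho> - 1 - \<epsilon> + real k * \<epsilon>"
  assumes "0 < \<epsilon>" "0 < \<pi>'" "\<pi> < \<pi>'" and \<zeta>: "\<And>y. 0 \<le> \<zeta> y" and "E \<le> \<eta> N"
    and inside: "\<forall>\<^sub>F t in at_top. \<forall>y\<in>cube (t powr C). \<zeta> y \<le> t powr E"
    and levels: "\<And>k. k < N \<Longrightarrow> \<forall>\<^sub>F t in at_top.
      Q.prob {\<omega> \<in> space Q. t powr (\<rho> - \<eta> k - 2 * \<epsilon>) \<le> occ (indicator {y \<in> cube (t powr C). t powr \<eta> k < \<zeta> y}) 0 t \<omega>}
        \<le> exp (- (t powr \<pi>'))"
    and outside: "\<forall>\<^sub>F t in at_top. Q.prob {\<omega> \<in> space Q. t powr \<rho> / 3 \<le> occ (\<lambda>y. \<zeta> y * indicator (- cube (t powr C)) y) 0 t \<omega>}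
        \<le> exp (- (t powr \<pi>'))"
  shows "\<forall>\<^sub>F t in at_top. Q.prob {\<omega> \<in> space Q. t powr \<rho> \<le> occ \<zeta> 0 t \<omega>} \<le> exp (- (t powr \<pi>))"
proof -
  have "\<forall>\<^sub>F t in at_top. \<forall>k\<in>{..<N}.
      Q.prob {\<omega> \<in> space Q. t powr (\<rho> - \<eta> k - 2 * \<epsilon>) \<le> occ (indicator {y \<in> cube (t powr C). t powr \<eta> k < \<zeta> y}) 0 t \<omega>}
        \<le> exp (- (t powr \<pi>'))"
    by (rule eventually_ball_finite) (use levels in auto)
  moreover have "\<forall>\<^sub>F t in at_top. 2 * (1 + real N) * t powr (\<rho> - \<epsilon>) \<le> t powr \<rho>"
    by (rule eventually_powr_le) (use \<open>0 < \<epsilon>\<close> in simp)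
  moreover have "\<forall>\<^sub>F t in at_top. (1 + real N) * t powr 0 * exp (- (1 * t powr \<pi>')) \<le> exp (- (t powr \<pi>))"
    by (rule eventually_exp_le) (use assms in auto)
  ultimately show ?thesis using inside outside eventually_ge_at_top[of 1]
  proof eventually_elim
    case (elim t)
    define out where "out y = \<zeta> y * indicator (- cube (t powr C)) y" for y
    define H where "H k = {y \<in> cube (t powr C). t powr \<eta> k < \<zeta> y}" for k
    have dom: "\<zeta> y \<le> t powr \<eta> 0 + ((\<Sum>k<N. t powr (\<eta> k + \<epsilon>) * indicator (H k) y) + out y)" for y
    proof (cases "y \<in> cube (t powr C)")
      case False
      then show ?thesis by (simp add: out_def sum_nonneg)
    next
      case True
      \<comment> \<open>The least grid height not below \<zeta> y: for j = 0 the base term covers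
        the site, otherwise it belongs to the level j - 1.\<close>
      define j where "j = (LEAST j. \<zeta> y \<le> t powr \<eta> j)"
      have "\<zeta> y \<le> t powr E" using elim(4) True by simp
      also have "\<dots> \<le> t powr \<eta> N" using elim \<open>E \<le> \<eta> N\<close> by (intro powr_mono) auto
      finally have "\<zeta> y \<le> t powr \<eta> N" .
      then have j: "\<zeta> y \<le> t powr \<eta> j" "j \<le> N" unfolding j_def by (rule LeastI, rule Least_le)
      show ?thesis
      proof (cases j)
        case 0
        then have "\<zeta> y \<le> t powr \<eta> 0" using j by simp
        moreover have "0 \<le> (\<Sum>k<N. t powr (\<eta> k + \<epsilon>) * indicator (H k) y) + out y"
          using \<zeta> by (simp add: out_def sum_nonneg)
        ultimately show ?thesis by linarith
      next
        case (Suc k)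
        then have "\<not> \<zeta> y \<le> t powr \<eta> k" using not_less_Least[of k "\<lambda>j. \<zeta> y \<le> t powr \<eta> j"] by (simp add: j_def)
        then have "y \<in> H k" using True by (simp add: H_def)
        have "\<eta> j = \<eta> k + \<epsilon>" by (simp add: \<eta>_def Suc algebra_simps)
        then have "\<zeta> y \<le> t powr (\<eta> k + \<epsilon>) * indicator (H k) y" using j \<open>y \<in> H k\<close> by simp
        also have "\<dots> \<le> (\<Sum>k<N. t powr (\<eta> k + \<epsilon>) * indicator (H k) y)"
          using j Suc by (intro member_le_sum[of k "{..<N}" "\<lambda>k. t powr (\<eta> k + \<epsilon>) * indicator (H k) y"]) auto
        finally have "\<zeta> y \<le> (\<Sum>k<N. t powr (\<eta> k + \<epsilon>) * indicator (H k) y)" .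
        moreover have "0 \<le> out y" "0 \<le> t powr \<eta> 0" using \<zeta> by (simp_all add: out_def)
        ultimately show ?thesis by linarith
      qed
    qed
    define A where "A k = {\<omega> \<in> space Q. t powr (\<rho> - \<eta> k - 2 * \<epsilon>) \<le> occ (indicator (H k)) 0 t \<omega>}" for k
    define B where "B = {\<omega> \<in> space Q. t powr \<rho> / 3 \<le> occ out 0 t \<omega>}"
    have AB: "A k \<in> sets Q" "B \<in> sets Q" for k unfolding A_def B_def by (rule occ_event, simp)+
    have sub: "{\<omega> \<in> space Q. t powr \<rho> \<le> occ \<zeta> 0 t \<omega>} \<subseteq> (\<Union>k\<in>{..<N}. A k) \<union> B"
    proof (rule subsetI, rule ccontr)
      fix \<omega> assume \<omega>: "\<omega> \<in> {\<omega> \<in> space Q. t powr \<rho> \<le> occ \<zeta> 0 t \<omega>}" "\<omega> \<notin> (\<Union>k\<in>{..<N}. A k) \<union> B"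
      then have \<omega>Q: "\<omega> \<in> space Q" by simp
      have "occ \<zeta> 0 t \<omega> \<le> occ (\<lambda>y. t powr \<eta> 0 + ((\<Sum>k<N. t powr (\<eta> k + \<epsilon>) * indicator (H k) y) + out y)) 0 t \<omega>"
        by (rule occ_mono[OF \<omega>Q _ dom]) simp
      also have "\<dots> = t powr \<eta> 0 * t + ((\<Sum>k<N. t powr (\<eta> k + \<epsilon>) * occ (indicator (H k)) 0 t \<omega>) + occ out 0 t \<omega>)"
        unfolding occ_add[OF \<omega>Q order_refl] occ_sum[OF \<omega>Q order_refl finite_lessThan] occ_cmult
        using elim by (simp add: occ_const)
      also have "t powr \<eta> 0 * t = t powr (\<rho> - \<epsilon>)"
      proof -
        have "t powr \<eta> 0 * t powr 1 = t powr (\<rho> - \<epsilon>)" by (simp only: powr_add[symmetric]) (simp add: \<eta>_def)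
        then show ?thesis using elim by simp
      qed
      also have "(\<Sum>k<N. t powr (\<eta> k + \<epsilon>) * occ (indicator (H k)) 0 t \<omega>) \<le> (\<Sum>k<N. t powr (\<rho> - \<epsilon>))"
      proof (rule sum_mono)
        fix k assume "k \<in> {..<N}"
        then have "\<omega> \<notin> A k" using \<omega> by blast
        then have "occ (indicator (H k)) 0 t \<omega> \<le> t powr (\<rho> - \<eta> k - 2 * \<epsilon>)" using \<omega>Q by (simp add: A_def)
        then have "t powr (\<eta> k + \<epsilon>) * occ (indicator (H k)) 0 t \<omega> \<le> t powr (\<eta> k + \<epsilon>) * t powr (\<rho> - \<eta> k - 2 * \<epsilon>)"
          by (intro mult_left_mono) auto
        also have "\<dots> = t powr (\<rho> - \<epsilon>)" by (simp add: powr_add[symmetric])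
        finally show "t powr (\<eta> k + \<epsilon>) * occ (indicator (H k)) 0 t \<omega> \<le> t powr (\<rho> - \<epsilon>)" .
      qed
      also have "(\<Sum>k<N. t powr (\<rho> - \<epsilon>)) = real N * t powr (\<rho> - \<epsilon>)" by simp
      finally have "occ \<zeta> 0 t \<omega> \<le> (1 + real N) * t powr (\<rho> - \<epsilon>) + occ out 0 t \<omega>" by (simp add: algebra_simps)
      moreover have "occ out 0 t \<omega> < t powr \<rho> / 3" using \<omega> by (auto simp: B_def)
      moreover have "(1 + real N) * t powr (\<rho> - \<epsilon>) \<le> t powr \<rho> / 2" using elim(2) unfolding mult.assoc by linarith
      moreover have "0 < t powr \<rho>" using elim by simp
      ultimately have "occ \<zeta> 0 t \<omega> < t powr \<rho>" by linarith
      with \<omega> show False by simp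
    qed
    have "Q.prob {\<omega> \<in> space Q. t powr \<rho> \<le> occ \<zeta> 0 t \<omega>} \<le> Q.prob ((\<Union>k\<in>{..<N}. A k) \<union> B)"
      by (rule Q.finite_measure_mono[OF sub]) (use AB in auto)
    also have "\<dots> \<le> Q.prob (\<Union>k\<in>{..<N}. A k) + Q.prob B" by (rule measure_Un_le) (use AB in auto)
    also have "Q.prob (\<Union>k\<in>{..<N}. A k) \<le> (\<Sum>k\<in>{..<N}. Q.prob (A k))"
      by (rule Q.finite_measure_subadditive_finite) (use AB in auto)
    also have "\<dots> \<le> (\<Sum>k\<in>{..<N}. exp (- (t powr \<pi>')))"
      by (rule sum_mono) (use elim(1) in \<open>simp add: A_def H_def\<close>)
    also have "(\<Sum>k\<in>{..<N}. exp (- (t powr \<pi>'))) = real N * exp (- (t powr \<pi>'))" by simp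
    also have "Q.prob B \<le> exp (- (t powr \<pi>'))" using elim(5) by (simp add: B_def out_def[abs_def])
    finally have "Q.prob {\<omega> \<in> space Q. t powr \<rho> \<le> occ \<zeta> 0 t \<omega>} \<le> (1 + real N) * exp (- (t powr \<pi>'))"
      by (simp add: algebra_simps)
    also have "\<dots> \<le> exp (- (t powr \<pi>))" using elim(3,6) by simp
    finally show ?case .
  qed
qed

end

locale walk_in_scenery = walk p Q S + scenery M z \<alpha>
  for p :: "real \<Rightarrow> int ^ 'd \<Rightarrow> (int ^ 'd) pmf" and Q :: "'w measure" and S :: "real \<Rightarrow> 'w \<Rightarrow> int ^ 'd"
    and M :: "'a measure" and z :: "int ^ 'd \<Rightarrow> 'a \<Rightarrow> real" and \<alpha> :: real +
  assumes nonneg: "AE \<omega> in M. \<forall>x. 0 \<le> z x \<omega>"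
begin

definition upper_tail :: "'a \<Rightarrow> real \<Rightarrow> real \<Rightarrow> real" where
  "upper_tail \<omega> \<rho> t = Q.prob {\<omega>' \<in> space Q. t powr \<rho> \<le> occ (\<lambda>x. z x \<omega>) 0 t \<omega>'}"

text \<open>Sparseness with K = 0 around the origin means that the high set is empty.\<close>

lemma AE_sup:
  assumes "real CARD('d) < \<beta> * \<alpha>"
  shows "AE \<omega> in M. \<forall>\<^sub>F m in at_top. \<forall>y\<in>cube m. z y \<omega> \<le> m powr \<beta>"
proof -
  have "0 < \<beta>"
  proof (rule ccontr)
    assume "\<not> 0 < \<beta>"
    then have "\<beta> * \<alpha> \<le> 0" using alpha by (simp add: mult_nonpos_nonneg)
    with assms show False by simp
  qed
  have "AE \<omega> in M. \<forall>\<^sub>F t in at_top. \<forall>x\<in>cube (t powr 0).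
      card {y. y - x \<in> cube (t powr 1) \<and> t powr \<beta> < z y \<omega>} \<le> 0"
    by (rule AE_sparse) (use assms \<open>0 < \<beta>\<close> in auto)
  then show ?thesis
  proof eventually_elim
    case (elim \<omega>)
    then show ?case using eventually_gt_at_top[of 0]
    proof eventually_elim
      case (elim m)
      have "0 \<in> (cube (m powr 0) :: (int ^ 'd) set)" by (simp add: cube_def)
      with elim have "card {y. y - 0 \<in> cube (m powr 1) \<and> m powr \<beta> < z y \<omega>} = 0" by blast
      moreover have "finite {y. y - 0 \<in> cube (m powr 1) \<and> m powr \<beta> < z y \<omega>}"
        by (rule finite_subset[OF _ finite_translate_cube[of 0 "m powr 1"]]) auto
      ultimately have "{y. y - 0 \<in> cube (m powr 1) \<and> m powr \<beta> < z y \<omega>} = {}" by (simp only: card_0_eq)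
      then show ?case using elim by force
    qed
  qed
qed

end

lemma eventually_ln_le: "0 < q \<Longrightarrow> \<forall>\<^sub>F t in at_top. c * (a + b * ln t) \<le> t powr q" for a b c q :: real
proof -
  assume q: "0 < q"
  have "((\<lambda>t. c * (a + b * ln t) / t powr q) \<longlongrightarrow> 0) at_top" using q by real_asymp
  from order_tendstoD(2)[OF this zero_less_one] eventually_gt_at_top[of 0] show ?thesis
    by eventually_elim (simp add: pos_divide_less_eq)
qed

lemma green_bound_asymp:
  assumes "0 < d" "0 \<le> th" "if d = 1 then th < g else 0 < g"
  shows "\<forall>\<^sub>F t in at_top. green_bound d (t powr (- th)) \<le> t powr g"
proof (cases "d = 1")
  case True
  with assms have "th < g" by simp
  from eventually_powr_le[OF this, of 2] eventually_gt_at_top[of 0] show ?thesis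
    by eventually_elim (use True in \<open>simp add: green_bound_def powr_minus divide_inverse\<close>)
next
  case False
  with assms have "0 < g" by simp
  from eventually_ln_le[OF this, of "2 * real d / ln 16" "ln 2" "2 * th"] eventually_ge_at_top[of 1] show ?thesis
  proof eventually_elim
    case (elim t)
    have "1 / (t powr (- th))\<^sup>2 = t powr (2 * th)"
      using elim by (simp add: powr_minus power2_eq_square powr_add[symmetric] divide_inverse)
    moreover have "1 \<le> t powr (2 * th)" using elim assms by (simp add: ge_one_powr_ge_zero)
    then have "ln (1 + t powr (2 * th)) \<le> ln (2 * t powr (2 * th))" by (intro ln_mono) auto
    moreover have "ln (2 * t powr (2 * th)) = ln 2 + 2 * th * ln t" using elim by (simp add: ln_mult ln_powr)
    ultimately have "ln (1 + 1 / (t powr (- th))\<^sup>2) \<le> ln 2 + 2 * th * ln t" by simp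
    then have "2 * real d / ln 16 * ln (1 + 1 / (t powr (- th))\<^sup>2) \<le> 2 * real d / ln 16 * (ln 2 + 2 * th * ln t)"
      by (intro mult_left_mono) auto
    with elim(1) False show ?case by (simp add: green_bound_def)
  qed
qed

subsection \<open>Exponents\<close>

lemma threshold_gt:
  assumes "0 < d" "0 < \<alpha>" "threshold d \<alpha> < \<rho>"
  shows "1 < \<rho>" "if d = 1 then (\<alpha> + 1) / (2 * \<alpha>) < \<rho> else real d / (2 * \<alpha>) < \<rho>"
  using assms by (auto simp: threshold_def split: if_splits)

text \<open>The exponent of the highest site that the walk can reach at cost \<open>t\<^sup>p\<close> when \<open>p \<le> 1\<close>.\<close>

definition peak :: "nat \<Rightarrow> real \<Rightarrow> real \<Rightarrow> real" where
  "peak d \<alpha> \<rho> = real d * (rate_exponent d \<alpha> \<rho> + 1) / (2 * \<alpha>)"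

text \<open>The last claim is the balance of costs. A site of height t^peak needs the time
  t^(\<rho>-peak), whose cost has exponent 2(\<rho>-peak) - 1 for d = 1 and \<rho> - peak for d
  \<ge> 2; both equal p, the exponent of the journey.\<close>

lemma small_rate:
  assumes "0 < d" "0 < \<alpha>" "threshold d \<alpha> < \<rho>" "\<rho> \<le> (\<alpha> + real d) / \<alpha>"
  defines "p \<equiv> rate_exponent d \<alpha> \<rho>"
  shows "0 < p" "p \<le> 1" "peak d \<alpha> \<rho> = (if d = 1 then \<rho> - (p + 1) / 2 else \<rho> - p)"
proof -
  note thr = threshold_gt[OF assms(1-3)]
  have le: "\<rho> * \<alpha> \<le> \<alpha> + real d" using assms by (simp add: field_simps)
  show "0 < p"
  proof (cases "d = 1")
    case True
    then have "\<alpha> + 1 < 2 * \<alpha> * \<rho>" using thr(2) assms by (simp add: pos_divide_less_eq mult_ac)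
    then have "1 < 2 * \<alpha> * \<rho> / (\<alpha> + 1)" using assms by (simp add: pos_less_divide_eq)
    then show ?thesis using True assms by (simp add: p_def rate_exponent_def)
  next
    case False
    then have "real d < 2 * \<alpha> * \<rho>" using thr(2) assms by (simp add: pos_divide_less_eq mult_ac)
    then show ?thesis using False assms by (simp add: p_def rate_exponent_def)
  qed
  show "p \<le> 1"
    using le assms by (cases "d = 1") (auto simp: p_def rate_exponent_def field_simps)
  show "peak d \<alpha> \<rho> = (if d = 1 then \<rho> - (p + 1) / 2 else \<rho> - p)"
  proof (cases "d = 1")
    case True
    have "p = 2 * \<alpha> * \<rho> / (\<alpha> + 1) - 1" using True assms by (simp add: p_def rate_exponent_def)
    then show ?thesis using True assms unfolding peak_def p_def[symmetric] by (simp add: field_simps)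
  next
    case False
    have "p = (2 * \<alpha> * \<rho> - real d) / (2 * \<alpha> + real d)" using False assms by (simp add: p_def rate_exponent_def)
    then have "p * (2 * \<alpha> + real d) = 2 * \<alpha> * \<rho> - real d" using assms by simp
    then have "real d * (p + 1) = 2 * \<alpha> * (\<rho> - p)" by (simp add: algebra_simps)
    then show ?thesis using False assms unfolding peak_def p_def[symmetric] by simp
  qed
qed

text \<open>The right side is affine in \<eta>, hence minimal at an end of the interval. At \<eta> =
  \<rho> - 1 it equals \<kappa>(\<rho>-1), of which at least half survives the shift by
  \<epsilon>.\<close>

lemma linear_lower_bound:
  fixes \<rho> :: real
  assumes "0 < \<kappa>" "\<epsilon> \<le> (\<rho> - 1) / 2" "\<rho> - 1 - \<epsilon> \<le> \<eta>" "\<eta> \<le> E" "0 < \<epsilon>"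
    and "m \<le> \<kappa> * (\<rho> - 1) / 2" "m \<le> \<rho> - 1 + E * (\<kappa> - 1)"
  shows "m \<le> \<rho> - 1 + \<eta> * (\<kappa> - 1)"
proof (cases "1 \<le> \<kappa>")
  case True
  have "\<kappa> * \<epsilon> \<le> \<kappa> * ((\<rho> - 1) / 2)" using assms by (intro mult_left_mono) auto
  moreover have "(\<rho> - 1 - \<epsilon>) * (\<kappa> - 1) \<le> \<eta> * (\<kappa> - 1)" using True assms by (intro mult_right_mono) auto
  moreover have "(\<rho> - 1 - \<epsilon>) * (\<kappa> - 1) = \<kappa> * (\<rho> - 1) - (\<rho> - 1) - \<kappa> * \<epsilon> + \<epsilon>" by (simp add: algebra_simps)
  ultimately show ?thesis using assms by linarith
next
  case False
  have "E * (\<kappa> - 1) \<le> \<eta> * (\<kappa> - 1)" using False assms by (intro mult_right_mono_neg) auto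
  then show ?thesis using assms by linarith
qed

text \<open>A level \<eta> is controlled if th fits below the sparseness limit \<eta>\<alpha>/d and
  still 1 - 2 th < \<rho> - \<eta> - g. For d = 1, where g is close to th, the latter asks for th >
  1 - \<rho> + \<eta>, and th is put just above this value. For d \<ge> 2, where g is close to 0, th
  is put just below the limit. Up to multiples of \<epsilon>, either case is possible when \<rho> -
  1 + \<eta>(\<kappa> - 1) > 0.\<close>

lemma level_exponents:
  assumes d: "0 < d" "0 < \<alpha>" "threshold d \<alpha> < \<rho>" "\<rho> \<le> (\<alpha> + real d) / \<alpha>"
    and \<pi>: "\<pi> < rate_exponent d \<alpha> \<rho>"
  obtains \<epsilon> where "0 < \<epsilon>" "\<epsilon> < \<rho> - 1" "\<pi> < rate_exponent d \<alpha> \<rho> - 2 * \<epsilon>"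
    "\<And>\<eta>. \<rho> - 1 - \<epsilon> \<le> \<eta> \<Longrightarrow> \<eta> < peak d \<alpha> \<rho> \<Longrightarrow>
      \<exists>th \<gamma> g. 0 \<le> th \<and> th < \<gamma> \<and> \<gamma> * real d < \<eta> * \<alpha> \<and> (if d = 1 then th < g else 0 < g) \<and>
        1 - 2 * th < \<rho> - \<eta> - 2 * \<epsilon> - g \<and> \<pi> < \<rho> - \<eta> - 2 * \<epsilon> - g"
proof -
  define p where "p = rate_exponent d \<alpha> \<rho>"
  define E where "E = peak d \<alpha> \<rho>"
  note rate = small_rate[OF d, folded p_def E_def]
  have \<rho>: "1 < \<rho>" using threshold_gt[OF d(1-3)] by simp
  define \<kappa> where "\<kappa> = (if d = 1 then \<alpha> else 2 * \<alpha> / real d)"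
  have \<kappa>: "0 < \<kappa>" using d by (simp add: \<kappa>_def)
  have E0: "2 * \<alpha> * E = real d * (p + 1)" using d by (simp add: E_def peak_def p_def)
  \<comment> \<open>At the peak this quantity equals p for d = 1 and 2p for d \<ge> 2.\<close>
  have end2: "0 < \<rho> - 1 + E * (\<kappa> - 1)"
  proof (cases "d = 1")
    case True
    then have "E = \<rho> - (p + 1) / 2" using rate(3) by simp
    moreover have "E * \<alpha> = (p + 1) / 2" using E0 True by (simp add: mult.commute)
    moreover have "E * (\<kappa> - 1) = E * \<alpha> - E" using True by (simp add: \<kappa>_def right_diff_distrib)
    ultimately have "\<rho> - 1 + E * (\<kappa> - 1) = p" by argo
    then show ?thesis using rate by simp
  next
    case False
    then have "E * \<kappa> = p + 1" using E0 d by (simp add: \<kappa>_def field_simps)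
    moreover have "E = \<rho> - p" using False rate(3) by simp
    moreover have "E * (\<kappa> - 1) = E * \<kappa> - E" by (simp add: right_diff_distrib)
    ultimately have "\<rho> - 1 + E * (\<kappa> - 1) = 2 * p" by argo
    then show ?thesis using rate by simp
  qed
  define m where "m = min (\<kappa> * (\<rho> - 1) / 2) (\<rho> - 1 + E * (\<kappa> - 1))"
  have m: "0 < m" using end2 \<kappa> \<rho> by (simp add: m_def)
  \<comment> \<open>m/8 leaves room for all \<epsilon>-corrections in the affine condition, (p -
    \<pi>)/8 keeps the exponents above \<pi>, and the last entry makes th \<ge> 0 when d \<ge>
    2.\<close>
  define \<epsilon> where "\<epsilon> = Min {(\<rho> - 1) / 2, m / 8, (p - \<pi>) / 8, \<alpha> * (\<rho> - 1) / (8 * real d)}"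
  have \<epsilon>0: "0 < \<epsilon>" using m \<rho> \<pi> d by (simp add: \<epsilon>_def p_def)
  have \<epsilon>: "\<epsilon> \<le> (\<rho> - 1) / 2" "8 * \<epsilon> \<le> m" "8 * \<epsilon> \<le> p - \<pi>" "\<epsilon> \<le> \<alpha> * (\<rho> - 1) / (8 * real d)"
  proof -
    have "\<epsilon> \<le> m / 8" "\<epsilon> \<le> (p - \<pi>) / 8" unfolding \<epsilon>_def by (rule Min_le; simp)+
    then show "8 * \<epsilon> \<le> m" "8 * \<epsilon> \<le> p - \<pi>" by auto
  next
    show "\<epsilon> \<le> (\<rho> - 1) / 2" "\<epsilon> \<le> \<alpha> * (\<rho> - 1) / (8 * real d)" unfolding \<epsilon>_def by (rule Min_le; simp)+
  qed
  show ?thesis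
  proof (rule that[OF \<epsilon>0])
    show "\<epsilon> < \<rho> - 1" using \<epsilon>(1) \<rho> by argo
    show "\<pi> < rate_exponent d \<alpha> \<rho> - 2 * \<epsilon>" using \<epsilon>(3) \<epsilon>0 by (simp add: p_def)
    fix \<eta> assume \<eta>: "\<rho> - 1 - \<epsilon> \<le> \<eta>" "\<eta> < peak d \<alpha> \<rho>"
    then have \<eta>E: "\<eta> < E" by (simp add: E_def)
    have lin: "8 * \<epsilon> \<le> \<rho> - 1 + \<eta> * (\<kappa> - 1)"
      by (rule order_trans[OF \<epsilon>(2) linear_lower_bound[OF \<kappa> \<epsilon>(1) \<eta>(1) less_imp_le[OF \<eta>E] \<epsilon>0]])
        (simp_all only: m_def min.cobounded1 min.cobounded2)
    show "\<exists>th \<gamma> g. 0 \<le> th \<and> th < \<gamma> \<and> \<gamma> * real d < \<eta> * \<alpha> \<and> (if d = 1 then th < g else 0 < g) \<and>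
        1 - 2 * th < \<rho> - \<eta> - 2 * \<epsilon> - g \<and> \<pi> < \<rho> - \<eta> - 2 * \<epsilon> - g"
    proof (cases "d = 1")
      case True
      define th where "th = 1 - \<rho> + \<eta> + 3 * \<epsilon>"
      have "0 \<le> th" using \<eta>(1) \<epsilon>0 by (simp add: th_def)
      moreover have "(th + \<epsilon>) * real d < \<eta> * \<alpha>"
        using lin True \<epsilon>0 by (simp add: th_def \<kappa>_def algebra_simps)
      moreover have "1 - 2 * th < \<rho> - \<eta> - 2 * \<epsilon> - (th + \<epsilon> / 2)" using \<epsilon>0 by (simp add: th_def)
      moreover have "\<pi> < \<rho> - \<eta> - 2 * \<epsilon> - (th + \<epsilon> / 2)"
      proof -
        have "E = \<rho> - (p + 1) / 2" using True rate(3) by simp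
        then show ?thesis using \<epsilon>(3) \<eta>E \<epsilon>0 unfolding th_def by argo
      qed
      ultimately show ?thesis using True \<epsilon>0 by (intro exI[of _ th] exI[of _ "th + \<epsilon>"] exI[of _ "th + \<epsilon> / 2"]) auto
    next
      case False
      define th where "th = \<alpha> * \<eta> / real d - 2 * \<epsilon>"
      have "0 \<le> th"
      proof -
        have "4 * \<epsilon> \<le> \<alpha> / real d * ((\<rho> - 1) / 2)" using \<epsilon>(4) by simp
        also have "\<dots> \<le> \<alpha> / real d * \<eta>" using \<eta>(1) \<epsilon>(1) d by (intro mult_left_mono) auto
        finally show ?thesis using \<epsilon>0 by (simp add: th_def)
      qed
      moreover have "(th + \<epsilon>) * real d < \<eta> * \<alpha>" using d \<epsilon>0 by (simp add: th_def algebra_simps)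
      moreover have "1 - 2 * th < \<rho> - \<eta> - 2 * \<epsilon> - \<epsilon>"
        using lin False \<epsilon>0 by (simp add: th_def \<kappa>_def algebra_simps)
      moreover have "E = \<rho> - p" using False rate(3) by simp
      then have "\<pi> < \<rho> - \<eta> - 2 * \<epsilon> - \<epsilon>" using \<epsilon>(3) \<eta>E \<epsilon>0 by argo
      ultimately show ?thesis using False \<epsilon>0 by (intro exI[of _ th] exI[of _ "th + \<epsilon>"] exI[of _ \<epsilon>]) auto
    qed
  qed
qed

context walk_in_scenery
begin

lemma upper_small_rate:
  assumes \<rho>: "threshold CARD('d) \<alpha> < \<rho>" "\<rho> \<le> (\<alpha> + real CARD('d)) / \<alpha>"
    and \<pi>: "0 < \<pi>" "\<pi> < rate_exponent CARD('d) \<alpha> \<rho>"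
  shows "AE \<omega> in M. \<forall>\<^sub>F t in at_top. upper_tail \<omega> \<rho> t \<le> exp (- (t powr \<pi>))"
proof -
  let ?d = "real CARD('d)"
  define p0 where "p0 = rate_exponent CARD('d) \<alpha> \<rho>"
  define E where "E = peak CARD('d) \<alpha> \<rho>"
  note rate = small_rate[OF zero_less_card_finite alpha \<rho>, folded p0_def]
  define \<pi>' where "\<pi>' = (\<pi> + p0) / 2"
  have "\<pi> < p0" using \<pi> by (simp add: p0_def)
  then have \<pi>': "0 < \<pi>'" "\<pi> < \<pi>'" "\<pi>' < p0" using \<pi>(1) by (auto simp: \<pi>'_def)
  obtain \<epsilon> where \<epsilon>: "0 < \<epsilon>" "\<epsilon> < \<rho> - 1" "\<pi>' < p0 - 2 * \<epsilon>"
    and lev: "\<And>\<eta>. \<rho> - 1 - \<epsilon> \<le> \<eta> \<Longrightarrow> \<eta> < E \<Longrightarrow>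
      \<exists>th \<gamma> g. 0 \<le> th \<and> th < \<gamma> \<and> \<gamma> * ?d < \<eta> * \<alpha> \<and> (if CARD('d) = 1 then th < g else 0 < g) \<and>
        1 - 2 * th < \<rho> - \<eta> - 2 * \<epsilon> - g \<and> \<pi>' < \<rho> - \<eta> - 2 * \<epsilon> - g"
    by (rule level_exponents[OF zero_less_card_finite alpha \<rho> \<pi>'(3)[unfolded p0_def], folded p0_def E_def]) (rule that)
  define \<eta> where "\<eta> k = \<rho> - 1 - \<epsilon> + real k * \<epsilon>" for k :: nat
  \<comment> \<open>Leaving the cube of radius t^C has the cost exponent 2C - 1 = p0 - 2\<epsilon> >
    \<pi>'.\<close>
  define C where "C = (p0 + 1) / 2 - \<epsilon>"
  have C: "0 < C" "C \<le> 1" "\<pi>' < 2 * C - 1" using \<epsilon> \<pi>' rate(1,2) unfolding C_def by argo+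
  have E: "2 * \<alpha> * E = ?d * (p0 + 1)" using alpha by (simp add: E_def peak_def p0_def)
  \<comment> \<open>With this \<beta> the heights in the cube are at most t^E, and \<beta>\<alpha> >
    d because C is below (p0 + 1)/2, the radius exponent at which the height t^E is typical.\<close>
  define \<beta> where "\<beta> = E / C"
  have "2 * C < p0 + 1" using \<epsilon>(1) unfolding C_def by argo
  then have "?d * (2 * C) < ?d * (p0 + 1)" by (intro mult_strict_left_mono) auto
  then have "?d * (2 * C) < 2 * \<alpha> * E" unfolding E .
  then have \<beta>: "?d < \<beta> * \<alpha>" using C by (simp add: \<beta>_def pos_less_divide_eq mult_ac)
  then have \<beta>0: "0 < \<beta>" using alpha by (meson less_trans of_nat_0_less_iff zero_less_card_finite zero_less_mult_pos2)
  define N where "N = nat \<lceil>(E - (\<rho> - 1 - \<epsilon>)) / \<epsilon>\<rceil>"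
  have N1: "E \<le> \<eta> N"
  proof -
    have "(E - (\<rho> - 1 - \<epsilon>)) / \<epsilon> \<le> real N" unfolding N_def by (rule real_nat_ceiling_ge)
    then show ?thesis using \<epsilon>(1) by (simp add: \<eta>_def pos_divide_le_eq)
  qed
  have N2: "\<eta> k < E" if "k < N" for k
  proof -
    have "real k < (E - (\<rho> - 1 - \<epsilon>)) / \<epsilon>" using that unfolding N_def by linarith
    then show ?thesis using \<epsilon>(1) by (simp add: \<eta>_def pos_less_divide_eq)
  qed
  have "AE \<omega> in M. \<forall>\<^sub>F t in at_top.
      Q.prob {\<omega>' \<in> space Q. t powr (\<rho> - \<eta> k - 2 * \<epsilon>) \<le> occ (indicator {y \<in> cube (t powr C). t powr \<eta> k < z y \<omega>}) 0 t \<omega>'}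
        \<le> exp (- (t powr \<pi>'))" if k: "k < N" for k
  proof -
    have \<eta>: "\<rho> - 1 - \<epsilon> \<le> \<eta> k" "0 < \<eta> k" using \<epsilon> by (simp_all add: \<eta>_def add_pos_nonneg)
    obtain th \<gamma> g where g: "0 \<le> th" "th < \<gamma>" "\<gamma> * ?d < \<eta> k * \<alpha>" "if CARD('d) = 1 then th < g else 0 < g"
      "1 - 2 * th < \<rho> - \<eta> k - 2 * \<epsilon> - g" "\<pi>' < \<rho> - \<eta> k - 2 * \<epsilon> - g"
      using lev[OF \<eta>(1) N2[OF k]] by blast
    obtain K where "C * ?d / (\<eta> k * \<alpha> - \<gamma> * ?d) < real K" using reals_Archimedean2 by blast
    then have "C * ?d < real K * (\<eta> k * \<alpha> - \<gamma> * ?d)" using g(3) by (simp add: pos_divide_less_eq)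
    also have "\<dots> \<le> real (Suc K) * (\<eta> k * \<alpha> - \<gamma> * ?d)" using g(3) by (intro mult_right_mono) auto
    finally have "AE \<omega> in M. \<forall>\<^sub>F t in at_top. \<forall>x\<in>cube (t powr C).
        card {y. y - x \<in> cube (t powr \<gamma>) \<and> t powr \<eta> k < z y \<omega>} \<le> K"
      using C g \<eta> by (intro AE_sparse) auto
    then show ?thesis
    proof eventually_elim
      case (elim \<omega>)
      show ?case
        by (rule level_tail[OF g(1,2) _ elim green_bound_asymp[OF zero_less_card_finite g(1,4)] g(5) _ g(6)])
          (use C g \<pi>' in auto)
    qed
  qed
  then have "AE \<omega> in M. \<forall>k\<in>{..<N}. \<forall>\<^sub>F t in at_top.
      Q.prob {\<omega>' \<in> space Q. t powr (\<rho> - \<eta> k - 2 * \<epsilon>) \<le> occ (indicator {y \<in> cube (t powr C). t powr \<eta> k < z y \<omega>}) 0 t \<omega>'}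
        \<le> exp (- (t powr \<pi>'))"
    by (intro AE_finite_allI) auto
  with nonneg AE_sup[OF \<beta>] show ?thesis
  proof eventually_elim
    case (elim \<omega>)
    have "filterlim (\<lambda>t. t powr C) at_top at_top" using C by real_asymp
    from eventually_compose_filterlim[OF elim(2) this]
    have inside: "\<forall>\<^sub>F t in at_top. \<forall>y\<in>cube (t powr C). z y \<omega> \<le> t powr E"
      using C by (simp add: powr_powr \<beta>_def)
    have outside: "\<forall>\<^sub>F t in at_top. Q.prob {\<omega>' \<in> space Q. t powr \<rho> / 3 \<le> occ (\<lambda>y. z y \<omega> * indicator (- cube (t powr C)) y) 0 t \<omega>'}
        \<le> exp (- (t powr \<pi>'))"
      by (rule outside_asymp[where s = "1 - C" and \<beta> = \<beta>]) (use C \<pi>' \<beta>0 elim in auto)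
    show ?case unfolding upper_tail_def
      by (rule upper_levels[OF \<epsilon>(1) \<pi>'(1,2) _ N1[unfolded \<eta>_def] inside _ outside])
        (use elim in \<open>auto simp: \<eta>_def\<close>)
  qed
qed

text \<open>For C < p0 all heights within distance t^C are at most t^E with E < \<rho> - 1, too
  small even over the whole time, so only the cost of leaving the cube remains. Formally N = 0, and
  \<epsilon> is such that the base height of \<open>upper_levels\<close> is t^E.\<close>

lemma upper_large_rate:
  assumes \<rho>: "(\<alpha> + real CARD('d)) / \<alpha> < \<rho>" and \<pi>: "0 < \<pi>" "\<pi> < \<alpha> * (\<rho> - 1) / real CARD('d)"
  shows "AE \<omega> in M. \<forall>\<^sub>F t in at_top. upper_tail \<omega> \<rho> t \<le> exp (- (t powr \<pi>))"
proof -
  let ?d = "real CARD('d)"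
  define p0 where "p0 = \<alpha> * (\<rho> - 1) / ?d"
  have "\<alpha> + ?d < \<rho> * \<alpha>" using \<rho> alpha by (simp add: pos_divide_less_eq)
  then have p0: "1 < p0" by (simp add: p0_def pos_less_divide_eq algebra_simps)
  define \<pi>' where "\<pi>' = (\<pi> + p0) / 2"
  have "\<pi> < p0" using \<pi> by (simp add: p0_def)
  then have \<pi>': "0 < \<pi>'" "\<pi> < \<pi>'" "\<pi>' < p0" using \<pi>(1) by (auto simp: \<pi>'_def)
  obtain C where C: "max 1 \<pi>' < C" "C < p0" using dense[of "max 1 \<pi>'" p0] p0 \<pi>' by auto
  have "?d / \<alpha> < (\<rho> - 1) / C"
  proof -
    have "C * ?d < \<alpha> * (\<rho> - 1)" using C(2) by (simp add: p0_def pos_less_divide_eq)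
    then show ?thesis using C(1) alpha by (simp add: field_simps)
  qed
  then obtain \<beta> where \<beta>: "?d / \<alpha> < \<beta>" "\<beta> < (\<rho> - 1) / C" using dense by blast
  have \<beta>0: "0 < \<beta>" using \<beta>(1) alpha by (meson divide_pos_pos less_trans of_nat_0_less_iff zero_less_card_finite)
  have \<beta>1: "?d < \<beta> * \<alpha>" using \<beta>(1) alpha by (simp add: pos_divide_less_eq)
  define E where "E = C * \<beta>"
  have E: "E < \<rho> - 1" using \<beta>(2) C by (simp add: E_def pos_less_divide_eq mult.commute)
  from nonneg AE_sup[OF \<beta>1] show ?thesis
  proof eventually_elim
    case (elim \<omega>)
    have "filterlim (\<lambda>t. t powr C) at_top at_top" using C by real_asymp
    from eventually_compose_filterlim[OF elim(2) this]
    have inside: "\<forall>\<^sub>F t in at_top. \<forall>y\<in>cube (t powr C). z y \<omega> \<le> t powr E"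
      by (simp add: powr_powr E_def)
    have outside: "\<forall>\<^sub>F t in at_top. Q.prob {\<omega>' \<in> space Q. t powr \<rho> / 3 \<le> occ (\<lambda>y. z y \<omega> * indicator (- cube (t powr C)) y) 0 t \<omega>'}
        \<le> exp (- (t powr \<pi>'))"
      by (rule outside_asymp[where s = 0 and \<beta> = \<beta>]) (use C \<pi>' \<beta>0 elim in auto)
    show ?case unfolding upper_tail_def
      by (rule upper_levels[where \<epsilon> = "\<rho> - 1 - E" and N = 0, OF _ \<pi>'(1,2) _ _ inside _ outside])
        (use elim E in auto)
  qed
qed

end

section \<open>Quenched lower bounds\<close>

lemma exp_add_half: "exp (a + b - ln 2) = exp a * exp b / 2" for a b :: real
  by (simp add: exp_diff exp_add)

context walk
begin

lemma occ_site:
  assumes "\<omega> \<in> space Q" "0 \<le> a" "b \<le> t" and \<zeta>: "\<And>y. 0 \<le> \<zeta> y"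
  shows "\<zeta> x * occ (indicator {x}) a b \<omega> \<le> occ \<zeta> 0 t \<omega>"
proof -
  have "\<zeta> x * occ (indicator {x}) a b \<omega> \<le> \<zeta> x * occ (indicator {x}) 0 t \<omega>"
    using assms by (intro mult_left_mono occ_subinterval) auto
  also have "\<dots> = occ (\<lambda>y. \<zeta> x * indicator {x} y) 0 t \<omega>" by (simp only: occ_cmult)
  also have "\<dots> \<le> occ \<zeta> 0 t \<omega>" by (rule occ_mono) (use assms in \<open>auto simp: indicator_def\<close>)
  finally show ?thesis .
qed

lemma tail_ge_site:
  assumes "0 \<le> a" "b \<le> t" "0 \<le> \<tau>" and \<zeta>: "\<And>y. 0 \<le> \<zeta> y" and "c \<le> \<zeta> x * \<tau>"
  shows "Q.prob {\<omega> \<in> space Q. S a \<omega> = x \<and> \<tau> \<le> occ (indicator {x}) a b \<omega>}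
    \<le> Q.prob {\<omega> \<in> space Q. c \<le> occ \<zeta> 0 t \<omega>}"
proof (rule Q.finite_measure_mono)
  show "{\<omega> \<in> space Q. c \<le> occ \<zeta> 0 t \<omega>} \<in> Q.events" by (rule occ_event) simp
  show "{\<omega> \<in> space Q. S a \<omega> = x \<and> \<tau> \<le> occ (indicator {x}) a b \<omega>} \<subseteq> {\<omega> \<in> space Q. c \<le> occ \<zeta> 0 t \<omega>}"
  proof clarify
    fix \<omega> assume \<omega>: "\<omega> \<in> space Q" and "\<tau> \<le> occ (indicator {S a \<omega>}) a b \<omega>" "x = S a \<omega>"
    then have "\<zeta> x * \<tau> \<le> \<zeta> x * occ (indicator {x}) a b \<omega>" using \<zeta> by (intro mult_left_mono) auto
    also have "\<dots> \<le> occ \<zeta> 0 t \<omega>" by (rule occ_site) (use assms \<omega> in auto)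
    finally show "c \<le> occ \<zeta> 0 t \<omega>" using assms(5) by linarith
  qed
qed

lemma lower_stay:
  assumes "0 \<le> a" "1 \<le> s" "a + s \<le> t" and \<zeta>: "\<And>y. 0 \<le> \<zeta> y" and "c \<le> \<zeta> x * (s / 2)"
  shows "pmf (p a 0) x * exp (- s) / 2 \<le> Q.prob {\<omega> \<in> space Q. c \<le> occ \<zeta> 0 t \<omega>}"
  by (rule order_trans[OF stay_prob[OF assms(1,2)] tail_ge_site]) (use assms in auto)

lemma lower_local_time:
  assumes "CARD('d) = 1" "0 \<le> a" "0 < s" "a + s \<le> t" "sqrt s \<le> 8 * \<tau>" "128 * \<tau> \<le> s"
    and \<zeta>: "\<And>y. 0 \<le> \<zeta> y" and "c \<le> \<zeta> x * \<tau>"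
  shows "pmf (p a 0) x * exp (- 16384 * \<tau>\<^sup>2 / s) / 2 \<le> Q.prob {\<omega> \<in> space Q. c \<le> occ \<zeta> 0 t \<omega>}"
proof -
  have "0 < sqrt s" using assms(3) by simp
  then have "0 \<le> \<tau>" using assms(5) by linarith
  show ?thesis
    by (rule order_trans[OF local_time_lower[OF assms(1,2,3,5,6)] tail_ge_site]) (use assms \<open>0 \<le> \<tau>\<close> in auto)
qed

lemma pmf_ge_real:
  assumes \<mu>: "2 * real CARD('d) \<le> s" and y: "y \<in> cube R" "0 \<le> R"
  shows "exp (- real CARD('d) * (4 + 2 * ln s + R * ln (1 + 2 * real CARD('d) * R / s))) \<le> pmf (p s x) (x + y)"
proof -
  define m where "m = s / (2 * real CARD('d))"
  have s0: "0 < s" using \<mu> zero_less_card_finite[where 'a = 'd] by (smt (verit) of_nat_0_less_iff)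
  have m: "1 \<le> m" using \<mu> by (simp add: m_def pos_le_divide_eq)
  have "1 \<le> real CARD('d)" using zero_less_card_finite[where 'a = 'd] by (simp add: Suc_le_eq)
  then have "s / (2 * real CARD('d)) \<le> s / 1" using s0 by (intro divide_left_mono) (auto intro: order_trans[of 1 "real CARD('d)"])
  then have ms: "m \<le> s" by (simp add: m_def)
  define n where "n = nat \<lfloor>R\<rfloor>"
  have n: "real n \<le> R" using y by (simp add: n_def)
  have "\<bar>y $ i\<bar> \<le> int n" for i
  proof -
    have "real_of_int \<bar>y $ i\<bar> \<le> R" using y by (simp add: cube_def)
    then show ?thesis using y by (simp add: n_def le_floor_iff)
  qed
  from pmf_ge[of s, folded m_def, OF m this, of x]
  have low: "exp (- real CARD('d) * (4 + 2 * ln m + real n * ln (1 + real n / m))) \<le> pmf (p s x) (x + y)" .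
  have "real n * ln (1 + real n / m) \<le> R * ln (1 + R / m)"
    using n m y by (intro mult_mono ln_mono add_left_mono divide_right_mono) (auto intro!: ln_ge_zero add_pos_nonneg)
  moreover have "ln m \<le> ln s" using m ms by (intro ln_mono) auto
  ultimately have "real CARD('d) * (4 + 2 * ln m + real n * ln (1 + real n / m)) \<le>
      real CARD('d) * (4 + 2 * ln s + R * ln (1 + R / m))"
    by (intro mult_left_mono) auto
  then have "exp (- real CARD('d) * (4 + 2 * ln s + R * ln (1 + R / m))) \<le>
      exp (- real CARD('d) * (4 + 2 * ln m + real n * ln (1 + real n / m)))" by simp
  from order_trans[OF this low] show ?thesis by (simp add: m_def mult_ac)
qed

text \<open>At diffusive distance the entropy term is bounded, by ln (1 + x) \<le> x, and only the
  polynomial mode factors remain.\<close>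

lemma pmf_ge_poly:
  assumes s: "2 * real CARD('d) \<le> s" and y: "y \<in> cube (sqrt s)"
  shows "exp (- real CARD('d) * (4 + 2 * real CARD('d))) * s powr (- 2 * real CARD('d)) \<le> pmf (p s x) (x + y)"
proof -
  let ?d = "real CARD('d)"
  have s0: "0 < s" using s zero_less_card_finite[where 'a = 'd] by (smt (verit) of_nat_0_less_iff)
  have "ln (1 + 2 * ?d * sqrt s / s) \<le> 2 * ?d * sqrt s / s"
    using s0 by (intro ln_add_one_self_le_self) auto
  then have "sqrt s * ln (1 + 2 * ?d * sqrt s / s) \<le> sqrt s * (2 * ?d * sqrt s / s)"
    using s0 by (intro mult_left_mono) auto
  also have "\<dots> = 2 * ?d * (sqrt s * sqrt s / s)" by simp
  also have "\<dots> = 2 * ?d" using s0 by simp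
  finally have "?d * (4 + 2 * ln s + sqrt s * ln (1 + 2 * ?d * sqrt s / s)) \<le> ?d * (4 + 2 * ln s + 2 * ?d)"
    by (intro mult_left_mono add_left_mono) auto
  then have "exp (- (?d * (4 + 2 * ln s + 2 * ?d))) \<le> exp (- ?d * (4 + 2 * ln s + sqrt s * ln (1 + 2 * ?d * sqrt s / s)))"
    by simp
  also have "\<dots> \<le> pmf (p s x) (x + y)" by (rule pmf_ge_real[OF s y]) (use s0 in simp)
  also have "exp (- (?d * (4 + 2 * ln s + 2 * ?d))) = exp (- ?d * (4 + 2 * ?d) + - 2 * ?d * ln s)"
    by (simp add: algebra_simps)
  also have "\<dots> = exp (- ?d * (4 + 2 * ?d)) * s powr (- 2 * ?d)"
    using s0 by (simp only: exp_add) (simp add: powr_def)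
  finally show ?thesis .
qed

text \<open>For \<gamma> \<le> 1, ln (1 + x) \<le> x gives the Gaussian exponent 2\<gamma> - 1; for
  \<gamma> > 1 the logarithm is of order ln t and fits between \<gamma> and q. Arriving at time t/2
  leaves the second half for the stay at the target.\<close>

lemma heat_lower:
  assumes "0 \<le> \<gamma>" "\<gamma> \<le> 1 \<Longrightarrow> 2 * \<gamma> - 1 < q" "1 < \<gamma> \<Longrightarrow> \<gamma> < q" "0 < q"
  shows "\<forall>\<^sub>F t in at_top. \<forall>y\<in>cube (t powr \<gamma>). exp (- (t powr q)) \<le> pmf (p (t / 2) 0) y"
proof -
  let ?d = "real CARD('d)"
  have main: "\<forall>\<^sub>F t in at_top. 2 * ?d * (t powr \<gamma> * ln (1 + 4 * ?d * t powr \<gamma> / t)) \<le> t powr q"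
  proof (cases "\<gamma> \<le> 1")
    case True
    from eventually_powr_le[OF assms(2)[OF True], of "8 * ?d * ?d"] eventually_gt_at_top[of 0] show ?thesis
    proof eventually_elim
      case (elim t)
      have "ln (1 + 4 * ?d * t powr \<gamma> / t) \<le> 4 * ?d * t powr \<gamma> / t"
        using elim by (intro ln_add_one_self_le_self) auto
      then have "2 * ?d * (t powr \<gamma> * ln (1 + 4 * ?d * t powr \<gamma> / t)) \<le> 2 * ?d * (t powr \<gamma> * (4 * ?d * t powr \<gamma> / t))"
        by (intro mult_left_mono) auto
      also have "\<dots> = 8 * ?d * ?d * t powr (2 * \<gamma> - 1)"
      proof -
        have "t powr (2 * \<gamma> - 1) = t powr \<gamma> * t powr \<gamma> / t" using elim by (simp add: powr_diff powr_add[symmetric])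
        then show ?thesis by simp
      qed
      also have "\<dots> \<le> t powr q" by (rule elim)
      finally show ?case .
    qed
  next
    case False
    then have "0 < q - \<gamma>" using assms(3) by simp
    from eventually_ln_le[OF this, of "2 * ?d" "ln (1 + 4 * ?d)" \<gamma>] eventually_ge_at_top[of 1] show ?thesis
    proof eventually_elim
      case (elim t)
      have "4 * ?d * t powr \<gamma> / t \<le> 4 * ?d * t powr \<gamma> / 1" using elim by (intro divide_left_mono) auto
      moreover have "1 \<le> t powr \<gamma>" using elim assms by (simp add: ge_one_powr_ge_zero)
      ultimately have "1 + 4 * ?d * t powr \<gamma> / t \<le> (1 + 4 * ?d) * t powr \<gamma>" by (simp add: distrib_right)
      then have "ln (1 + 4 * ?d * t powr \<gamma> / t) \<le> ln ((1 + 4 * ?d) * t powr \<gamma>)"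
        using elim by (intro ln_mono) (auto intro!: add_pos_nonneg)
      also have "\<dots> = ln (1 + 4 * ?d) + \<gamma> * ln t"
        using elim by (subst ln_mult_pos) (auto simp: ln_powr intro!: add_pos_nonneg)
      finally have "2 * ?d * ln (1 + 4 * ?d * t powr \<gamma> / t) \<le> 2 * ?d * (ln (1 + 4 * ?d) + \<gamma> * ln t)"
        by (intro mult_left_mono) auto
      also have "\<dots> \<le> t powr (q - \<gamma>)" by (rule elim)
      finally have "t powr \<gamma> * (2 * ?d * ln (1 + 4 * ?d * t powr \<gamma> / t)) \<le> t powr \<gamma> * t powr (q - \<gamma>)"
        by (intro mult_left_mono) auto
      then show ?case by (simp add: powr_add[symmetric] mult_ac)
    qed
  qed
  from main eventually_ln_le[OF assms(4), of "2 * ?d" 4 2] eventually_ge_at_top[of "max 1 (4 * ?d)"]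
  show ?thesis
  proof eventually_elim
    case (elim t)
    have t: "1 \<le> t" "4 * ?d \<le> t" using elim by auto
    show ?case
    proof
      fix y :: "int ^ 'd" assume y: "y \<in> cube (t powr \<gamma>)"
      have "exp (- ?d * (4 + 2 * ln (t / 2) + t powr \<gamma> * ln (1 + 2 * ?d * t powr \<gamma> / (t / 2)))) \<le> pmf (p (t / 2) 0) (0 + y)"
        by (rule pmf_ge_real[OF _ y]) (use t in auto)
      moreover have "?d * (4 + 2 * ln (t / 2) + t powr \<gamma> * ln (1 + 2 * ?d * t powr \<gamma> / (t / 2))) \<le> t powr q"
      proof -
        have e: "2 * ?d * t powr \<gamma> / (t / 2) = 4 * ?d * t powr \<gamma> / t" by simp
        have "?d * (2 * ln (t / 2)) \<le> ?d * (2 * ln t)" using t by (intro mult_left_mono) auto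
        then have "?d * (4 + 2 * ln (t / 2)) \<le> ?d * (4 + 2 * ln t)" unfolding distrib_left by argo
        moreover have "2 * (?d * (4 + 2 * ln t)) \<le> t powr q" using elim(2) by (simp only: mult.assoc)
        moreover have "2 * (?d * (t powr \<gamma> * ln (1 + 4 * ?d * t powr \<gamma> / t))) \<le> t powr q"
          using elim(1) by (simp only: mult.assoc)
        ultimately show ?thesis unfolding e distrib_left[of ?d "4 + 2 * ln (t / 2)"] by argo
      qed
      ultimately show "exp (- (t powr q)) \<le> pmf (p (t / 2) 0) y"
        by (simp add: order_trans[rotated])
    qed
  qed
qed

lemma heat_lower_poly:
  assumes "0 \<le> \<gamma>" "\<gamma> < 1 / 2"
  obtains c where "0 < c" "\<forall>\<^sub>F t in at_top. \<forall>y\<in>cube (t powr \<gamma>). c * t powr (- 2 * real CARD('d)) \<le> pmf (p (t / 2) 0) y"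
proof -
  let ?d = "real CARD('d)"
  define c where "c = exp (- ?d * (4 + 2 * ?d))"
  have "\<forall>\<^sub>F t in at_top. 2 * t powr \<gamma> \<le> t powr (1 / 2)" by (rule eventually_powr_le[OF assms(2)])
  then have "\<forall>\<^sub>F t in at_top. \<forall>y\<in>cube (t powr \<gamma>). c * t powr (- 2 * ?d) \<le> pmf (p (t / 2) 0) y"
    using eventually_ge_at_top[of "4 * ?d"]
  proof eventually_elim
    case (elim t)
    have t0: "0 < t" using elim zero_less_card_finite[where 'a = 'd] by (smt (verit) of_nat_0_less_iff)
    have "t powr \<gamma> \<le> sqrt (t / 2)"
    proof -
      have "t powr \<gamma> \<le> sqrt t / 2" using elim t0 by (simp add: powr_half_sqrt)
      also have "\<dots> = sqrt (t / 4)" by (simp add: real_sqrt_divide)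
      also have "\<dots> \<le> sqrt (t / 2)" using t0 by simp
      finally show ?thesis .
    qed
    show ?case
    proof
      fix y :: "int ^ 'd" assume "y \<in> cube (t powr \<gamma>)"
      then have "y \<in> cube (sqrt (t / 2))" using cube_mono[OF \<open>t powr \<gamma> \<le> sqrt (t / 2)\<close>] by blast
      from pmf_ge_poly[OF _ this, of 0] elim
      have "c * (t / 2) powr (- 2 * ?d) \<le> pmf (p (t / 2) 0) y" by (simp add: c_def)
      moreover have "t powr (- 2 * ?d) \<le> (t / 2) powr (- 2 * ?d)" using t0 by (intro powr_mono2') auto
      then have "c * t powr (- 2 * ?d) \<le> c * (t / 2) powr (- 2 * ?d)" by (intro mult_left_mono) (auto simp: c_def)
      ultimately show "c * t powr (- 2 * ?d) \<le> pmf (p (t / 2) 0) y" by linarith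
    qed
  qed
  then show ?thesis by (intro that[of c]) (auto simp: c_def)
qed

end

context walk_in_scenery
begin

lemma lower_small_rate:
  assumes \<rho>: "threshold CARD('d) \<alpha> < \<rho>" "\<rho> \<le> (\<alpha> + real CARD('d)) / \<alpha>"
    and q: "rate_exponent CARD('d) \<alpha> \<rho> < q"
  shows "AE \<omega> in M. \<forall>\<^sub>F t in at_top. exp (- (t powr q)) \<le> upper_tail \<omega> \<rho> t"
proof -
  let ?d = "real CARD('d)"
  define p0 where "p0 = rate_exponent CARD('d) \<alpha> \<rho>"
  note rate = small_rate[OF zero_less_card_finite alpha \<rho>, folded p0_def]
  have \<rho>1: "1 < \<rho>" using threshold_gt[OF zero_less_card_finite alpha \<rho>(1)] by simp
  \<comment> \<open>Intermediate exponents: q1 puts the distance exponent \<gamma> just above its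
    optimum (p0 + 1)/2, q2 bounds the cost of the journey, q the total cost.\<close>
  define q1 where "q1 = (2 * p0 + q) / 3"
  define q2 where "q2 = (p0 + 2 * q) / 3"
  have q12: "p0 < q1" "q1 < q2" "q2 < q" using q by (simp_all add: q1_def q2_def p0_def)
  define \<gamma> where "\<gamma> = (q1 + 1) / 2"
  have \<gamma>: "0 \<le> \<gamma>" "2 * \<gamma> - 1 < q2" "1 < \<gamma> \<Longrightarrow> \<gamma> < q2" "(p0 + 1) / 2 < \<gamma>"
  proof -
    show "0 \<le> \<gamma>" "2 * \<gamma> - 1 < q2" "(p0 + 1) / 2 < \<gamma>" unfolding \<gamma>_def using q12 rate(1) by argo+
    show "\<gamma> < q2" if "1 < \<gamma>" using that q12 unfolding \<gamma>_def by argo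
  qed
  have heat: "\<forall>\<^sub>F t in at_top. \<forall>y\<in>cube (t powr \<gamma>). exp (- (t powr q2)) \<le> pmf (p (t / 2) 0) y"
    by (rule heat_lower) (use \<gamma> q12 rate in auto)
  have E: "2 * \<alpha> * peak CARD('d) \<alpha> \<rho> = ?d * (p0 + 1)" using alpha by (simp add: peak_def p0_def)
  have "p0 + 1 < 2 * \<gamma>" using \<gamma>(4) by argo
  then have "?d * (p0 + 1) < ?d * (2 * \<gamma>)" by (intro mult_strict_left_mono) auto
  then have "2 * \<alpha> * peak CARD('d) \<alpha> \<rho> < ?d * (2 * \<gamma>)" unfolding E .
  then have peak: "peak CARD('d) \<alpha> \<rho> < ?d * \<gamma> / \<alpha>" using alpha by (simp add: pos_less_divide_eq mult_ac)
  have fin: "\<forall>\<^sub>F t in at_top. exp (- (t powr q)) \<le> exp (- (t powr q2)) * exp (- (c * t powr s)) / 2"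
    if "s < q" "0 < c" for s c
  proof -
    have "\<forall>\<^sub>F t in at_top. 3 * t powr q2 \<le> t powr q" by (rule eventually_powr_le) (use q12 in simp)
    moreover have "\<forall>\<^sub>F t in at_top. 3 * c * t powr s \<le> t powr q" by (rule eventually_powr_le) (use that in simp)
    moreover have "\<forall>\<^sub>F t in at_top. 3 * ln 2 * t powr 0 \<le> t powr q" by (rule eventually_powr_le) (use q12 rate in simp)
    ultimately show ?thesis using eventually_gt_at_top[of 0]
    proof eventually_elim
      case (elim t)
      have "t powr q2 + c * t powr s + ln 2 \<le> t powr q" using elim by simp
      then have "exp (- (t powr q)) \<le> exp (- (t powr q2) + - (c * t powr s) - ln 2)" by simp
      also have "\<dots> = exp (- (t powr q2)) * exp (- (c * t powr s)) / 2" by (rule exp_add_half)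
      finally show ?case .
    qed
  qed
  show ?thesis
  proof (cases "CARD('d) = 1")
    case True
    have "\<rho> - (p0 + 1) / 2 < \<gamma> / \<alpha>" using rate(3) True peak by simp
    then have "1 / 2 < (p0 + 1) / 2" "\<rho> - \<gamma> / \<alpha> < (p0 + 1) / 2" using rate(1) by argo+
    then have "max (1 / 2) (\<rho> - \<gamma> / \<alpha>) < (p0 + 1) / 2" by (simp only: max_less_iff_conj)
    \<comment> \<open>The local time to be collected is t^\<sigma>. It exceeds the typical sqrt t by
      \<sigma> > 1/2, the other lower bound provides a site of height t^(\<rho>-\<sigma>) within
      t^\<gamma>, and the upper bound keeps the cost exponent 2\<sigma> - 1 below p0.\<close>
    then obtain \<sigma> where \<sigma>: "max (1 / 2) (\<rho> - \<gamma> / \<alpha>) < \<sigma>" "\<sigma> < (p0 + 1) / 2" using dense by blast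
    have \<sigma>1: "1 / 2 < \<sigma>" "\<sigma> < 1" "\<rho> - \<gamma> / \<alpha> < \<sigma>" "2 * \<sigma> - 1 < q" using \<sigma> rate(2) q12 by auto
    have "(\<rho> - \<sigma>) * \<alpha> < \<gamma> * ?d" using \<sigma>1(3) alpha True by (simp add: field_simps)
    then have "AE \<omega> in M. \<forall>\<^sub>F t in at_top. \<exists>y\<in>cube (t powr \<gamma>). t powr (\<rho> - \<sigma>) < z y \<omega>"
      using \<sigma>1 \<rho>1 \<gamma> by (intro AE_high_site) auto
    with nonneg show ?thesis
    proof eventually_elim
      case (elim \<omega>)
      have "\<forall>\<^sub>F t in at_top. 256 * t powr \<sigma> \<le> t powr 1" by (rule eventually_powr_le) (use \<sigma>1 in simp)
      moreover have "\<forall>\<^sub>F t in at_top. 1 * t powr (1 / 2) \<le> t powr \<sigma>" by (rule eventually_powr_le) (use \<sigma>1 in simp)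
      ultimately show ?case using elim(2) heat fin[OF \<sigma>1(4), of 32768, OF zero_less_numeral] eventually_ge_at_top[of 1]
      proof eventually_elim
        case (elim t)
        then obtain y where y: "y \<in> cube (t powr \<gamma>)" "t powr (\<rho> - \<sigma>) < z y \<omega>" by blast
        have "exp (- (t powr q)) \<le> exp (- (t powr q2)) * exp (- (32768 * t powr (2 * \<sigma> - 1))) / 2" by (rule elim)
        also have "\<dots> \<le> pmf (p (t / 2) 0) y * exp (- (32768 * t powr (2 * \<sigma> - 1))) / 2"
          using elim(4) y by (intro divide_right_mono mult_right_mono) auto
        also have "32768 * t powr (2 * \<sigma> - 1) = 16384 * (t powr \<sigma>)\<^sup>2 / (t / 2)"
        proof -
          have "t powr (2 * \<sigma> - 1) = t powr \<sigma> * t powr \<sigma> / t" using elim by (simp add: powr_diff powr_add[symmetric])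
          then show ?thesis by (simp add: power2_eq_square)
        qed
        also have "pmf (p (t / 2) 0) y * exp (- (16384 * (t powr \<sigma>)\<^sup>2 / (t / 2))) / 2 \<le> upper_tail \<omega> \<rho> t"
          unfolding upper_tail_def minus_divide_left mult_minus_left[symmetric]
        proof (rule lower_local_time[OF True])
          have "sqrt (t / 2) \<le> sqrt t" using elim by simp
          also have "\<dots> \<le> t powr \<sigma>" using elim by (simp add: powr_half_sqrt)
          finally show "sqrt (t / 2) \<le> 8 * t powr \<sigma>" by (smt (verit) powr_ge_zero)
          have "t powr \<rho> = t powr (\<rho> - \<sigma>) * t powr \<sigma>" by (simp add: powr_add[symmetric])
          also have "\<dots> \<le> z y \<omega> * t powr \<sigma>" using y by (intro mult_right_mono) auto
          finally show "t powr \<rho> \<le> z y \<omega> * t powr \<sigma>" .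
        qed (use elim \<open>\<forall>x. 0 \<le> z x \<omega>\<close> in auto)
        finally show ?case .
      qed
    qed
  next
    case False
    \<comment> \<open>Here the time t^\<sigma> is spent by staying put, at a cost of order
      t^\<sigma> itself, so \<sigma> only has to lie below p0.\<close>
    have "max 0 (\<rho> - ?d * \<gamma> / \<alpha>) < p0" using rate False peak by auto
    then obtain \<sigma> where \<sigma>: "max 0 (\<rho> - ?d * \<gamma> / \<alpha>) < \<sigma>" "\<sigma> < p0" using dense by blast
    have \<sigma>1: "0 < \<sigma>" "\<sigma> < 1" "\<rho> - ?d * \<gamma> / \<alpha> < \<sigma>" "\<sigma> < q" using \<sigma> rate(2) q12 by auto
    have "(\<rho> - \<sigma>) * \<alpha> < \<gamma> * ?d" using \<sigma>1(3) alpha by (simp add: field_simps)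
    then have "AE \<omega> in M. \<forall>\<^sub>F t in at_top. \<exists>y\<in>cube (t powr \<gamma>). t powr (\<rho> - \<sigma>) < z y \<omega>"
      using \<sigma>1 \<rho>1 \<gamma> by (intro AE_high_site) auto
    with nonneg show ?thesis
    proof eventually_elim
      case (elim \<omega>)
      have "\<forall>\<^sub>F t in at_top. 4 * t powr \<sigma> \<le> t powr 1" by (rule eventually_powr_le) (use \<sigma>1 in simp)
      with elim(2) heat fin[OF \<sigma>1(4), of 2, OF zero_less_numeral] eventually_ge_at_top[of 1]
      show ?case
      proof eventually_elim
        case (elim t)
        then obtain y where y: "y \<in> cube (t powr \<gamma>)" "t powr (\<rho> - \<sigma>) < z y \<omega>" by blast
        have "exp (- (t powr q)) \<le> exp (- (t powr q2)) * exp (- (2 * t powr \<sigma>)) / 2" by (rule elim)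
        also have "\<dots> \<le> pmf (p (t / 2) 0) y * exp (- (2 * t powr \<sigma>)) / 2"
          using elim(2) y by (intro divide_right_mono mult_right_mono) auto
        also have "\<dots> \<le> upper_tail \<omega> \<rho> t"
          unfolding upper_tail_def
        proof (rule lower_stay)
          have "1 \<le> t powr \<sigma>" using elim \<sigma>1 by (simp add: ge_one_powr_ge_zero)
          then show "1 \<le> 2 * t powr \<sigma>" by simp
          have "t powr \<rho> = t powr (\<rho> - \<sigma>) * t powr \<sigma>" by (simp add: powr_add[symmetric])
          also have "\<dots> \<le> z y \<omega> * t powr \<sigma>" using y by (intro mult_right_mono) auto
          finally show "t powr \<rho> \<le> z y \<omega> * (2 * t powr \<sigma> / 2)" by simp
        qed (use elim \<open>\<forall>x. 0 \<le> z x \<omega>\<close> in auto)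
        finally show ?case .
      qed
    qed
  qed
qed

text \<open>The journey dominates: as p0 > 1, staying for the second half of the time costs only
  t/2, of smaller order than t^q. A time t/4 at height t^\<eta> with \<eta> > \<rho> - 1 is
  enough.\<close>

lemma lower_large_rate:
  assumes \<rho>: "(\<alpha> + real CARD('d)) / \<alpha> < \<rho>" and q: "\<alpha> * (\<rho> - 1) / real CARD('d) < q"
  shows "AE \<omega> in M. \<forall>\<^sub>F t in at_top. exp (- (t powr q)) \<le> upper_tail \<omega> \<rho> t"
proof -
  let ?d = "real CARD('d)"
  define p0 where "p0 = \<alpha> * (\<rho> - 1) / ?d"
  have "\<alpha> + ?d < \<rho> * \<alpha>" using \<rho> alpha by (simp add: pos_divide_less_eq)
  then have p0: "1 < p0" by (simp add: p0_def pos_less_divide_eq algebra_simps)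
  then obtain \<gamma> where \<gamma>: "p0 < \<gamma>" "\<gamma> < q" using dense[of p0 q] q by (auto simp: p0_def)
  obtain q2 where q2: "\<gamma> < q2" "q2 < q" using dense[OF \<gamma>(2)] by blast
  have "\<rho> - 1 < \<gamma> * ?d / \<alpha>"
    using \<gamma>(1) alpha by (simp add: p0_def pos_divide_less_eq pos_less_divide_eq mult_ac)
  then obtain \<eta> where \<eta>: "\<rho> - 1 < \<eta>" "\<eta> < \<gamma> * ?d / \<alpha>" using dense by blast
  have "0 < ?d / \<alpha>" using alpha by simp
  moreover have "1 + ?d / \<alpha> < \<rho>" using \<rho> alpha by (simp add: add_divide_distrib)
  ultimately have \<eta>0: "0 < \<eta>" using \<eta>(1) by linarith
  have heat: "\<forall>\<^sub>F t in at_top. \<forall>y\<in>cube (t powr \<gamma>). exp (- (t powr q2)) \<le> pmf (p (t / 2) 0) y"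
    by (rule heat_lower) (use \<gamma> q2 p0 in auto)
  have "AE \<omega> in M. \<forall>\<^sub>F t in at_top. \<exists>y\<in>cube (t powr \<gamma>). t powr \<eta> < z y \<omega>"
    using \<eta> \<eta>0 alpha \<gamma> p0 by (intro AE_high_site) (auto simp: pos_less_divide_eq)
  with nonneg show ?thesis
  proof eventually_elim
    case (elim \<omega>)
    have "\<forall>\<^sub>F t in at_top. 4 * t powr (\<rho> - 1) \<le> t powr \<eta>" by (rule eventually_powr_le) (use \<eta> in simp)
    moreover have "\<forall>\<^sub>F t in at_top. 3 * t powr q2 \<le> t powr q" by (rule eventually_powr_le) (use q2 in simp)
    moreover have "\<forall>\<^sub>F t in at_top. 3 * t powr 1 \<le> t powr q" by (rule eventually_powr_le) (use \<gamma> p0 in simp)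
    ultimately show ?case using elim(2) heat eventually_ge_at_top[of 2]
    proof eventually_elim
      case (elim t)
      then obtain y where y: "y \<in> cube (t powr \<gamma>)" "t powr \<eta> < z y \<omega>" by blast
      have "ln 2 < (1 :: real)" by (rule ln_2_less_1)
      moreover have "t powr 1 = t" using elim by simp
      ultimately have "t powr q2 + t / 2 + ln 2 \<le> t powr q" using elim(2,3,6) by argo
      then have "exp (- (t powr q)) \<le> exp (- (t powr q2) + - (t / 2) - ln 2)" by simp
      also have "\<dots> = exp (- (t powr q2)) * exp (- (t / 2)) / 2" by (rule exp_add_half)
      also have "\<dots> \<le> pmf (p (t / 2) 0) y * exp (- (t / 2)) / 2"
        using elim(5) y by (intro divide_right_mono mult_right_mono) auto
      also have "\<dots> \<le> upper_tail \<omega> \<rho> t"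
        unfolding upper_tail_def
      proof (rule lower_stay)
        have "t powr \<rho> = t powr (\<rho> - 1) * t" using elim by (simp add: powr_diff)
        also have "4 * \<dots> \<le> z y \<omega> * t" using y elim(1,6) mult_right_mono[of "4 * t powr (\<rho> - 1)" "z y \<omega>" t] by (simp add: mult_ac)
        finally show "t powr \<rho> \<le> z y \<omega> * (t / 2 / 2)" by simp
      qed (use elim \<open>\<forall>x. 0 \<le> z x \<omega>\<close> in auto)
      finally show ?case .
    qed
  qed
qed


text \<open>
  From anywhere in the box that it explores, the walk finds a site with \<open>z > 1\<close> within a small power
  of \<open>t\<close>, with polynomially small probability. Since the occupation time is at most \<open>t\<close>, the resulting
  lower bound on its mean is already a bound in probability.
\<close>

lemma sublinear_lower:
  assumes \<rho>: "0 < \<rho>" "\<rho> < 1"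
  shows "AE \<omega> in M. \<forall>\<^sub>F t in at_top. t powr (- 1) \<le> upper_tail \<omega> \<rho> t"
proof -
  let ?d = "real CARD('d)"
  \<comment> \<open>Covering the distance t^\<gamma> in time s = t^(2\<gamma>) has probability at
    least of order s^(-2d) = t^(-4d\<gamma>), here t^(-(1-\<rho>)/2); multiplied by t this is still
    of larger order than t^\<rho>.\<close>
  define \<gamma> where "\<gamma> = (1 - \<rho>) / (8 * ?d)"
  have d1: "1 \<le> ?d" using zero_less_card_finite[where 'a = 'd] by (simp add: Suc_le_eq)
  have \<gamma>: "0 < \<gamma>" "4 * ?d * \<gamma> = (1 - \<rho>) / 2" using \<rho> d1 by (simp_all add: \<gamma>_def)
  have "\<gamma> \<le> ?d * \<gamma>" using \<gamma>(1) d1 by simp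
  then have \<gamma>2: "2 * \<gamma> < 1" using \<gamma>(2) \<rho> by argo
  define c where "c = exp (- ?d * (4 + 2 * ?d))"
  have c: "0 < c" by (simp add: c_def)
  define q where "q t = c / 2 * t powr (- ((1 - \<rho>) / 2))" for t :: real
  have "AE \<omega> in M. \<forall>\<^sub>F t in at_top. \<forall>x\<in>cube (t powr 2). \<exists>y. y - x \<in> cube (t powr \<gamma>) \<and> 1 < z y \<omega>"
    by (rule AE_positive_sites) (use \<gamma> in auto)
  with nonneg show ?thesis
  proof eventually_elim
    case (elim \<omega>)
    define G where "G = {y. 1 < z y \<omega>}"
    have "\<forall>\<^sub>F t in at_top. 8 / c * t powr (\<rho> - (1 - (1 - \<rho>) / 2)) \<le> t powr 0"
      by (rule eventually_powr_le) (use \<rho> in argo)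
    moreover have "\<forall>\<^sub>F t in at_top. 8 / c * t powr ((1 - \<rho>) / 2 - 1) \<le> t powr 0"
      by (rule eventually_powr_le) (use \<rho> in argo)
    moreover have "\<forall>\<^sub>F t in at_top. 2 * t powr (2 * \<gamma>) \<le> t powr 1"
      by (rule eventually_powr_le[OF \<gamma>2])
    moreover have "\<forall>\<^sub>F t in at_top. 2 * ?d * t powr 0 \<le> t powr (2 * \<gamma>)"
      by (rule eventually_powr_le) (use \<gamma> in simp)
    moreover have "\<forall>\<^sub>F t :: real in at_top. ?d * exp 1 / cosh t < 1 / 2"
    proof -
      have "((\<lambda>t :: real. ?d * exp 1 / cosh t) \<longlongrightarrow> 0) at_top" unfolding cosh_field_def by real_asymp
      then show ?thesis by (rule order_tendstoD(2)) simp
    qed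
    ultimately show ?case using elim(2) eventually_ge_at_top[of 1]
    proof eventually_elim
      case (elim t)
      define s where "s = t powr (2 * \<gamma>)"
      have s: "2 * ?d \<le> s" "s \<le> t / 2" "t powr \<gamma> = sqrt s"
        using elim by (auto simp: s_def powr_half_sqrt[symmetric] powr_powr)
      have t0: "0 < t" using elim by simp
      have s_powr: "s powr (- 2 * ?d) = t powr (- ((1 - \<rho>) / 2))"
      proof -
        have "2 * \<gamma> * (- 2 * ?d) = - ((1 - \<rho>) / 2)" using \<gamma>(2) by (simp add: mult_ac)
        then show ?thesis unfolding s_def powr_powr by (simp only:)
      qed
      have tG: "q t \<le> measure (measure_pmf (p u 0)) G" if u: "t / 2 \<le> u" "u \<le> t" for u
      proof -
        have us: "0 \<le> u - s" "0 \<le> s" using u s t0 by (auto simp: s_def)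
        have near: "c * s powr (- 2 * ?d) * of_bool (x \<in> cube (t powr 2)) \<le> mean (p s x) (indicator G)" for x
        proof (cases "x \<in> cube (t powr 2)")
          case True
          then obtain y where y: "y - x \<in> cube (sqrt s)" "y \<in> G" using elim(6) s(3) by (auto simp: G_def)
          have "c * s powr (- 2 * ?d) \<le> pmf (p s x) (x + (y - x))"
            unfolding c_def by (rule pmf_ge_poly[OF s(1) y(1)])
          also have "\<dots> = measure (measure_pmf (p s x)) {y}" by (simp add: measure_pmf_single)
          also have "\<dots> \<le> measure (measure_pmf (p s x)) G" using y by (intro measure_pmf.finite_measure_mono) auto
          finally show ?thesis using True by simp
        qed (simp add: integral_nonneg)
        \<comment> \<open>Outside the cube some coordinate exceeds t^2 in modulus, and cosh at rate
          1/t then exceeds cosh t, whereas its mean is at most exp 1 up to time t.\<close>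
        have far: "measure (measure_pmf (p (u - s) 0)) (- cube (t powr 2)) \<le> 1 / 2"
        proof -
          have "emeasure (measure_pmf (p (u - s) 0)) (- cube (t powr 2)) =
              (\<integral>\<^sup>+ y. indicator (- cube (t powr 2)) y \<partial>measure_pmf (p (u - s) 0))" by simp
          also have "\<dots> \<le> (\<integral>\<^sup>+ y. (\<Sum>i\<in>UNIV. ennreal (1 / cosh t) * ennreal (cosh (1 / t * real_of_int (y $ i - 0 $ i)))) \<partial>measure_pmf (p (u - s) 0))"
          proof (rule nn_integral_mono)
            fix y :: "int ^ 'd"
            show "indicator (- cube (t powr 2)) y \<le> (\<Sum>i\<in>UNIV. ennreal (1 / cosh t) * ennreal (cosh (1 / t * real_of_int (y $ i - 0 $ i))))"
            proof (cases "y \<in> cube (t powr 2)")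
              case False
              then obtain i where i: "t powr 2 < real_of_int \<bar>y $ i\<bar>" by (auto simp: cube_def not_le)
              have "t powr 2 = t * t" using t0 by (simp add: powr_numeral power2_eq_square)
              then have "t \<le> 1 / t * real_of_int \<bar>y $ i\<bar>" using i t0 by (simp add: field_simps)
              then have "cosh t \<le> cosh (1 / t * real_of_int \<bar>y $ i\<bar>)" using t0 by (intro cosh_real_nonneg_le_iff[THEN iffD2]) auto
              also have "\<dots> = cosh (1 / t * real_of_int (y $ i))"
                using cosh_real_abs[of "1 / t * real_of_int (y $ i)"] t0 by (simp add: abs_mult)
              finally have "1 \<le> 1 / cosh t * cosh (1 / t * real_of_int (y $ i - 0 $ i))"
                by (simp add: field_simps)
              then have "ennreal 1 \<le> ennreal (1 / cosh t * cosh (1 / t * real_of_int (y $ i - 0 $ i)))" by (rule ennreal_leI)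
              also have "\<dots> = ennreal (1 / cosh t) * ennreal (cosh (1 / t * real_of_int (y $ i - 0 $ i)))"
                by (rule ennreal_mult) auto
              also have "\<dots> \<le> (\<Sum>i\<in>UNIV. ennreal (1 / cosh t) * ennreal (cosh (1 / t * real_of_int (y $ i - 0 $ i))))"
                by (rule member_le_sum) auto
              finally show ?thesis using False by simp
            qed simp
          qed
          also have "\<dots> = (\<Sum>i\<in>UNIV. ennreal (1 / cosh t) * (\<integral>\<^sup>+ y. ennreal (cosh (1 / t * real_of_int (y $ i - 0 $ i))) \<partial>measure_pmf (p (u - s) 0)))"
            by (simp add: nn_integral_sum nn_integral_cmult)
          also have "\<dots> \<le> (\<Sum>i\<in>(UNIV :: 'd set). ennreal (1 / cosh t) * ennreal (exp 1))"
          proof (intro sum_mono mult_left_mono)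
            fix i :: 'd
            have "(\<integral>\<^sup>+ y. ennreal (cosh (1 / t * real_of_int (y $ i - 0 $ i))) \<partial>measure_pmf (p (u - s) 0)) \<le> ennreal (exp ((1 / t)\<^sup>2 * (u - s)))"
              by (rule cosh_moment) (use us elim in auto)
            also have "(1 / t)\<^sup>2 * (u - s) \<le> (1 / t)\<^sup>2 * t\<^sup>2"
            proof (rule mult_left_mono)
              have "u - s \<le> t" using u us by simp
              also have "t * 1 \<le> t * t" using elim by (intro mult_left_mono) auto
              finally show "u - s \<le> t\<^sup>2" by (simp add: power2_eq_square)
            qed simp
            also have "(1 / t)\<^sup>2 * t\<^sup>2 = 1" using t0 by (simp add: power_one_over)
            finally show "(\<integral>\<^sup>+ y. ennreal (cosh (1 / t * real_of_int (y $ i - 0 $ i))) \<partial>measure_pmf (p (u - s) 0)) \<le> ennreal (exp 1)"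
              by (simp add: ennreal_leI)
          qed auto
          also have "\<dots> = ennreal (?d * exp 1 / cosh t)"
            by (simp add: ennreal_mult[symmetric] ennreal_of_nat_eq_real_of_nat)
          also have "\<dots> \<le> ennreal (1 / 2)" using elim(5) by (intro ennreal_leI) simp
          finally show ?thesis unfolding measure_pmf.emeasure_eq_measure by (subst (asm) ennreal_le_iff) auto
        qed
        have "q t = c * s powr (- 2 * ?d) * (1 / 2)" unfolding q_def s_powr by simp
        also have "\<dots> \<le> c * s powr (- 2 * ?d) * measure (measure_pmf (p (u - s) 0)) (cube (t powr 2))"
        proof (rule mult_left_mono)
          show "1 / 2 \<le> measure (measure_pmf (p (u - s) 0)) (cube (t powr 2))"
            using far measure_pmf.prob_compl[of "cube (t powr 2)" "p (u - s) 0"] by (simp add: Compl_eq_Diff_UNIV)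
        qed (use c in simp)
        also have "\<dots> = mean (p (u - s) 0) (\<lambda>x. c * s powr (- 2 * ?d) * indicator (cube (t powr 2)) x)" by simp
        also have "\<dots> \<le> mean (p (u - s) 0) (\<lambda>x. mean (p s x) (indicator G))"
        proof (rule integral_mono)
          have ib: "\<bar>indicator G x :: real\<bar> \<le> 1" for x by (simp add: indicator_def)
          show "integrable (measure_pmf (p (u - s) 0)) (\<lambda>x. mean (p s x) (indicator G))"
            by (rule mean_integrable[OF abs_mean_le[OF ib]])
          show "integrable (measure_pmf (p (u - s) 0)) (\<lambda>x. c * s powr (- 2 * ?d) * indicator (cube (t powr 2)) x)"
            by (intro Bochner_Integration.integrable_mult_right integrable_real_indicator) (auto simp: measure_pmf.emeasure_eq_measure)
          show "c * s powr (- 2 * ?d) * indicator (cube (t powr 2)) x \<le> mean (p s x) (indicator G)" for x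
            using near[of x] by (simp add: indicator_def of_bool_def)
        qed
        also have "\<dots> = mean (p (u - s + s) 0) (indicator G)"
          by (rule mean_semigroup[OF us, symmetric, of "indicator G" 1]) (simp add: indicator_def)
        also have "\<dots> = measure (measure_pmf (p u 0)) G" by simp
        finally show ?thesis .
      qed
      have q0: "0 \<le> q t" using c by (simp add: q_def)
      have "t powr (- 1) \<le> q t / 4"
      proof -
        have "8 / c * t powr ((1 - \<rho>) / 2 - 1) \<le> 1" using elim(2) t0 by simp
        then have "t powr ((1 - \<rho>) / 2 - 1) \<le> c / 8" using c by (simp add: field_simps)
        then have "t powr ((1 - \<rho>) / 2 - 1) * t powr (- ((1 - \<rho>) / 2)) \<le> c / 8 * t powr (- ((1 - \<rho>) / 2))"
          by (intro mult_right_mono) auto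
        moreover have "t powr ((1 - \<rho>) / 2 - 1) * t powr (- ((1 - \<rho>) / 2)) = t powr (- 1)"
          by (simp only: powr_add[symmetric]) simp
        ultimately show ?thesis by (simp add: q_def)
      qed
      also have "\<dots> \<le> Q.prob {\<omega>' \<in> space Q. t * q t / 4 \<le> occ (indicator G) 0 t \<omega>'}"
        by (rule occ_lower_first_moment[OF t0 q0 tG])
      also have "\<dots> \<le> upper_tail \<omega> \<rho> t" unfolding upper_tail_def
      proof (rule Q.finite_measure_mono)
        have le: "t powr \<rho> \<le> t * q t / 4"
        proof -
          have "8 / c * t powr (\<rho> - (1 - (1 - \<rho>) / 2)) \<le> 1" using elim(1) t0 by simp
          then have "t powr (\<rho> - (1 - (1 - \<rho>) / 2)) \<le> c / 8" using c by (simp add: field_simps)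
          then have "t powr (\<rho> - (1 - (1 - \<rho>) / 2)) * t powr (1 - (1 - \<rho>) / 2) \<le> c / 8 * t powr (1 - (1 - \<rho>) / 2)"
            by (intro mult_right_mono) auto
          moreover have "t powr (\<rho> - (1 - (1 - \<rho>) / 2)) * t powr (1 - (1 - \<rho>) / 2) = t powr \<rho>"
            by (simp only: powr_add[symmetric]) simp
          moreover have "t powr (1 - (1 - \<rho>) / 2) = t * t powr (- ((1 - \<rho>) / 2))"
            using t0 by (simp add: powr_add[of t 1, simplified, symmetric] powr_mult_base)
          ultimately show ?thesis by (simp add: q_def mult.left_commute)
        qed
        have le': "occ (indicator G) 0 t \<omega>' \<le> occ (\<lambda>x. z x \<omega>) 0 t \<omega>'" if "\<omega>' \<in> space Q" for \<omega>'
          by (rule occ_mono[OF that]) (use \<open>\<forall>x. 0 \<le> z x \<omega>\<close> in \<open>auto simp: G_def indicator_def\<close>)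
        show "{\<omega>' \<in> space Q. t * q t / 4 \<le> occ (indicator G) 0 t \<omega>'} \<subseteq> {\<omega>' \<in> space Q. t powr \<rho> \<le> occ (\<lambda>x. z x \<omega>) 0 t \<omega>'}"
          using order_trans[OF le order_trans[OF _ le']] by auto
        show "{\<omega>' \<in> space Q. t powr \<rho> \<le> occ (\<lambda>x. z x \<omega>) 0 t \<omega>'} \<in> Q.events" by (rule occ_event) simp
      qed
      finally show ?case .
    qed
  qed
qed

text \<open>Below the threshold some \<gamma> < 1/2 already provides a high enough site, so the
  journey is diffusive and costs a power of t. \<sigma> is the exponent of the time at one site that
  is available with constant probability: sqrt t for d = 1, a constant for d \<ge> 2.\<close>

lemma subdiffusive_lower:
  assumes "1 \<le> \<rho>" and \<rho>: "\<rho> < threshold CARD('d) \<alpha>"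
  shows "AE \<omega> in M. \<exists>m>0. \<forall>\<^sub>F t in at_top. t powr (- m) \<le> upper_tail \<omega> \<rho> t"
proof -
  let ?d = "real CARD('d)"
  define \<sigma> where "\<sigma> = (if CARD('d) = 1 then 1 / 2 else 0 :: real)"
  have "2 * \<alpha> * (\<rho> - \<sigma>) < ?d"
  proof (cases "CARD('d) = 1")
    case True
    then have "\<rho> < (\<alpha> + 1) / (2 * \<alpha>)" using assms by (auto simp: threshold_def)
    then have "\<rho> * (2 * \<alpha>) < \<alpha> + 1" using alpha by (simp add: pos_less_divide_eq)
    then show ?thesis using True by (simp add: \<sigma>_def algebra_simps)
  next
    case False
    then have "\<rho> < ?d / (2 * \<alpha>)" using assms by (auto simp: threshold_def)
    then show ?thesis using False alpha by (simp add: \<sigma>_def pos_less_divide_eq mult_ac)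
  qed
  then have "(\<rho> - \<sigma>) * \<alpha> / ?d < 1 / 2" by (simp add: pos_divide_less_eq mult_ac)
  then obtain \<gamma> where \<gamma>: "(\<rho> - \<sigma>) * \<alpha> / ?d < \<gamma>" "\<gamma> < 1 / 2" using dense by blast
  have \<rho>\<sigma>: "0 < \<rho> - \<sigma>" using assms(1) by (simp add: \<sigma>_def)
  have \<gamma>0: "0 \<le> \<gamma>" using \<gamma>(1) \<rho>\<sigma> alpha by (smt (verit) divide_nonneg_nonneg mult_nonneg_nonneg of_nat_0_le_iff)
  obtain c where c: "0 < c" "\<forall>\<^sub>F t in at_top. \<forall>y\<in>cube (t powr \<gamma>). c * t powr (- 2 * ?d) \<le> pmf (p (t / 2) 0) y"
    using heat_lower_poly[OF \<gamma>0 \<gamma>(2)] by blast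
  have "(\<rho> - \<sigma>) * \<alpha> < \<gamma> * ?d" using \<gamma>(1) by (simp add: pos_divide_less_eq)
  then have "AE \<omega> in M. \<forall>\<^sub>F t in at_top. \<exists>y\<in>cube (t powr \<gamma>). t powr (\<rho> - \<sigma>) < z y \<omega>"
    by (intro AE_high_site \<rho>\<sigma> \<gamma>0)
  with nonneg show ?thesis
  proof eventually_elim
    case (elim \<omega>)
    \<comment> \<open>For d = 1, the local time sqrt t within time t/2 gives the factor exp (-16384
      t/(t/2))/2; for d \<ge> 2, a stay with s = 2 in \<open>lower_stay\<close> gives the larger
      factor exp (-2)/2.\<close>
    define k :: real where "k = exp (- 32768) / 2"
    have k: "0 < k" by (simp add: k_def)
    have "\<forall>\<^sub>F t in at_top. 1 / (c * k) * t powr (- (2 * ?d + 1)) \<le> t powr (- 2 * ?d)"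
      by (rule eventually_powr_le) simp
    moreover have "\<forall>\<^sub>F t :: real in at_top. 256 * t powr (1 / 2) \<le> t powr 1" by (rule eventually_powr_le) simp
    ultimately have "\<forall>\<^sub>F t in at_top. t powr (- (2 * ?d + 1)) \<le> upper_tail \<omega> \<rho> t"
      using elim(2) c(2) eventually_ge_at_top[of 4]
    proof eventually_elim
      case (elim t)
      then obtain y where y: "y \<in> cube (t powr \<gamma>)" "t powr (\<rho> - \<sigma>) < z y \<omega>" by blast
      have "t powr (- (2 * ?d + 1)) \<le> c * k * t powr (- 2 * ?d)" using elim(1) c k by (simp add: field_simps)
      also have "\<dots> \<le> pmf (p (t / 2) 0) y * k"
        using mult_right_mono[OF elim(4)[rule_format, OF y(1)], of k] k by (simp add: mult_ac)
      also have "\<dots> \<le> upper_tail \<omega> \<rho> t"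
      proof (cases "CARD('d) = 1")
        case True
        have "pmf (p (t / 2) 0) y * exp (- 16384 * (sqrt t)\<^sup>2 / (t / 2)) / 2 \<le> upper_tail \<omega> \<rho> t"
          unfolding upper_tail_def
        proof (rule lower_local_time[OF True])
          have "sqrt (t / 2) \<le> sqrt t" using elim by simp
          also have "\<dots> \<le> 8 * sqrt t" using elim by simp
          finally show "sqrt (t / 2) \<le> 8 * sqrt t" .
          show "128 * sqrt t \<le> t / 2" using elim by (simp add: powr_half_sqrt)
          have "t powr \<rho> = t powr (\<rho> - \<sigma>) * sqrt t"
            using True elim by (simp add: \<sigma>_def powr_half_sqrt[symmetric] powr_add[symmetric])
          also have "\<dots> \<le> z y \<omega> * sqrt t" using y elim by (intro mult_right_mono) auto
          finally show "t powr \<rho> \<le> z y \<omega> * sqrt t" .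
        qed (use elim \<open>\<forall>x. 0 \<le> z x \<omega>\<close> in auto)
        then show ?thesis using elim by (simp add: k_def)
      next
        case False
        have "k \<le> exp (- 2) / 2" by (simp add: k_def)
        then have "pmf (p (t / 2) 0) y * k \<le> pmf (p (t / 2) 0) y * exp (- 2) / 2"
          using mult_left_mono[of k "exp (- 2) / 2" "pmf (p (t / 2) 0) y"] by simp
        also have "\<dots> \<le> upper_tail \<omega> \<rho> t" unfolding upper_tail_def
          by (rule lower_stay) (use elim y False \<open>\<forall>x. 0 \<le> z x \<omega>\<close> in \<open>auto simp: \<sigma>_def\<close>)
        finally show ?thesis .
      qed
      finally show ?case .
    qed
    then show ?case by (intro exI[of _ "2 * ?d + 1"]) auto
  qed
qed

end

section \<open>The theorem\<close>

text \<open>Countably many exponents around p suffice, so almost sure statements for all n can be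
  intersected; n + 2 keeps the lower exponents positive. The bounds themselves put F t strictly
  between 0 and 1, where both logarithms are meaningful.\<close>

lemma stretched_exp_asympI:
  assumes "0 < p"
    and lower: "\<And>n :: nat. \<forall>\<^sub>F t in at_top. exp (- (t powr (p + p / (real n + 2)))) \<le> F t"
    and upper: "\<And>n :: nat. \<forall>\<^sub>F t in at_top. F t \<le> exp (- (t powr (p - p / (real n + 2))))"
  shows "stretched_exp_asymp F p"
  unfolding stretched_exp_asymp_def
proof (rule tendstoI)
  fix e :: real assume "0 < e"
  obtain n where n: "p / e < real n" using reals_Archimedean2 by blast
  then have "p < e * (real n + 2)" using \<open>0 < e\<close> by (simp add: pos_divide_less_eq algebra_simps)
  then have e: "p / (real n + 2) < e" by (simp add: pos_divide_less_eq)
  from lower[of n] upper[of n] eventually_gt_at_top[of 1]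
  show "\<forall>\<^sub>F t in at_top. dist (ln (- ln (F t)) / ln t) p < e"
  proof eventually_elim
    case (elim t)
    define \<pi> where "\<pi> = p - p / (real n + 2)"
    define q where "q = p + p / (real n + 2)"
    have F: "exp (- (t powr q)) \<le> F t" "F t \<le> exp (- (t powr \<pi>))" using elim by (simp_all add: q_def \<pi>_def)
    have F0: "0 < F t" using F(1) by (rule less_le_trans[OF exp_gt_zero])
    have "- (t powr q) \<le> ln (F t)" using F(1) F0 by (simp add: ln_ge_iff)
    moreover have "ln (F t) \<le> - (t powr \<pi>)" using ln_mono[OF F(2) F0] by simp
    ultimately have L: "t powr \<pi> \<le> - ln (F t)" "- ln (F t) \<le> t powr q" by simp_all
    have tp: "0 < t powr \<pi>" using elim by simp
    have "ln (t powr \<pi>) \<le> ln (- ln (F t))" by (rule ln_mono[OF L(1) tp])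
    moreover have "ln (- ln (F t)) \<le> ln (t powr q)" by (rule ln_mono[OF L(2) less_le_trans[OF tp L(1)]])
    ultimately have "\<pi> * ln t \<le> ln (- ln (F t))" "ln (- ln (F t)) \<le> q * ln t" using elim by (simp_all add: ln_powr)
    moreover have "0 < ln t" using elim by simp
    ultimately have "\<pi> \<le> ln (- ln (F t)) / ln t" "ln (- ln (F t)) / ln t \<le> q"
      by (simp_all add: pos_le_divide_eq pos_divide_le_eq)
    then show ?case using e unfolding dist_real_def abs_less_iff q_def \<pi>_def by argo
  qed
qed

context walk_in_scenery
begin

lemma quenched_tail_eq: "quenched_tail Q S (\<lambda>x. z x \<omega>) \<rho> t = upper_tail \<omega> \<rho> t"
  by (simp add: quenched_tail_def upper_tail_def scenery_integral_def occ_def)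

lemma rate_large:
  assumes "(\<alpha> + real CARD('d)) / \<alpha> < \<rho>"
  shows "rate_exponent CARD('d) \<alpha> \<rho> = \<alpha> * (\<rho> - 1) / real CARD('d)"
  using assms by (auto simp: rate_exponent_def)

lemma rate_pos:
  assumes "threshold CARD('d) \<alpha> < \<rho>"
  shows "0 < rate_exponent CARD('d) \<alpha> \<rho>"
proof (cases "\<rho> \<le> (\<alpha> + real CARD('d)) / \<alpha>")
  case True
  then show ?thesis by (rule small_rate(1)[OF zero_less_card_finite alpha assms])
next
  case False
  have "1 < \<rho>" using threshold_gt[OF zero_less_card_finite alpha assms] by simp
  then show ?thesis using rate_large[of \<rho>] False alpha by simp
qed

lemma stretched_exp:
  assumes \<rho>: "threshold CARD('d) \<alpha> < \<rho>"
  shows "AE \<omega> in M. stretched_exp_asymp (quenched_tail Q S (\<lambda>x. z x \<omega>) \<rho>) (rate_exponent CARD('d) \<alpha> \<rho>)"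
proof -
  define r where "r = rate_exponent CARD('d) \<alpha> \<rho>"
  have r: "0 < r" unfolding r_def by (rule rate_pos[OF \<rho>])
  have n: "0 < r / (real n + 2)" "r / (real n + 2) < r" for n :: nat
    using r by (auto simp: pos_divide_less_eq algebra_simps add_pos_nonneg)
  have "AE \<omega> in M. \<forall>n :: nat. \<forall>\<^sub>F t in at_top. exp (- (t powr (r + r / (real n + 2)))) \<le> upper_tail \<omega> \<rho> t"
    unfolding AE_all_countable
  proof
    fix n :: nat
    show "AE \<omega> in M. \<forall>\<^sub>F t in at_top. exp (- (t powr (r + r / (real n + 2)))) \<le> upper_tail \<omega> \<rho> t"
      using lower_small_rate[OF \<rho>, of "r + r / (real n + 2)"] lower_large_rate[of \<rho> "r + r / (real n + 2)"]
        rate_large[of \<rho>] n(1)[of n] unfolding r_def by (cases "\<rho> \<le> (\<alpha> + real CARD('d)) / \<alpha>") auto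
  qed
  moreover have "AE \<omega> in M. \<forall>n :: nat. \<forall>\<^sub>F t in at_top. upper_tail \<omega> \<rho> t \<le> exp (- (t powr (r - r / (real n + 2))))"
    unfolding AE_all_countable
  proof
    fix n :: nat
    show "AE \<omega> in M. \<forall>\<^sub>F t in at_top. upper_tail \<omega> \<rho> t \<le> exp (- (t powr (r - r / (real n + 2))))"
      using upper_small_rate[OF \<rho>, of "r - r / (real n + 2)"] upper_large_rate[of \<rho> "r - r / (real n + 2)"]
        rate_large[of \<rho>] n[of n] unfolding r_def by (cases "\<rho> \<le> (\<alpha> + real CARD('d)) / \<alpha>") auto
  qed
  ultimately show ?thesis
  proof eventually_elim
    case (elim \<omega>)
    then show ?case unfolding r_def[symmetric] quenched_tail_eq
      by (intro stretched_exp_asympI[OF r]) auto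
  qed
qed

lemma polynomial_lower:
  assumes "0 < \<rho>" "\<rho> < threshold CARD('d) \<alpha>"
  shows "AE \<omega> in M. \<exists>m>0. \<forall>\<^sub>F t in at_top. t powr (- m) \<le> quenched_tail Q S (\<lambda>x. z x \<omega>) \<rho> t"
proof (cases "\<rho> < 1")
  case True
  from sublinear_lower[OF assms(1) True] show ?thesis
    by eventually_elim (auto simp: quenched_tail_eq intro!: exI[of _ 1])
next
  case False
  with subdiffusive_lower[OF _ assms(2)] show ?thesis by (simp add: quenched_tail_eq)
qed

end

theorem theorem1:
  fixes M :: "'a measure" and z :: "int ^ 'd \<Rightarrow> 'a \<Rightarrow> real"
    and Q :: "'w measure" and S :: "real \<Rightarrow> 'w \<Rightarrow> int ^ 'd"
    and \<alpha> \<rho> :: real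
  assumes "\<alpha> > 0" and "\<rho> > 0"
    and "prob_space M"
    and "prob_space.indep_vars M (\<lambda>_. borel) z UNIV"
    and "\<And>x y. distr M borel (z x) = distr M borel (z y)"
    and "\<And>x. AE \<omega> in M. z x \<omega> \<ge> 0"
    and "\<And>x. power_asymp (\<lambda>r. measure M {\<omega> \<in> space M. z x \<omega> > r}) (- \<alpha>)"
    and "simple_random_walk Q S 0"
  shows "(\<rho> > threshold CARD('d) \<alpha> \<longrightarrow>
            (AE \<omega> in M. stretched_exp_asymp (quenched_tail Q S (\<lambda>x. z x \<omega>) \<rho>)
                          (rate_exponent CARD('d) \<alpha> \<rho>))) \<and>
         (\<rho> < threshold CARD('d) \<alpha> \<longrightarrow>
            (AE \<omega> in M. \<exists>m>0. \<forall>\<^sub>F t in at_top.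
                          quenched_tail Q S (\<lambda>x. z x \<omega>) \<rho> t \<ge> t powr (- m)))"
proof -
  obtain p where p: "transition_semigroup p"
    "has_generator p (\<lambda>f x. discrete_laplacian f x / (2 * real CARD('d)))" "markov_process Q S 0 p"
    using assms(8) unfolding simple_random_walk_def by blast
  interpret walk_in_scenery p Q S M z \<alpha>
  proof (intro walk_in_scenery.intro walk.intro walk_semigroup.intro walk_axioms.intro scenery.intro
      scenery_axioms.intro walk_in_scenery_axioms.intro)
    show "AE \<omega> in M. \<forall>x. 0 \<le> z x \<omega>" using assms(6) by (simp add: AE_all_countable)
  qed (use p assms in auto)
  show ?thesis using stretched_exp polynomial_lower assms(2) by blast
qed

end
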